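(* Let $\Gamma$ be a countable sofic group, $\mathtt{A}$ a finite set, $\mathcal{X}\subset\mathtt{A}^\Gamma$ a subshift, and $u:\mathcal{X}\to\mathbb{R}$ continuous with a fixed continuous extension $\tilde u:\mathtt{A}^\Gamma\to\mathbb{R}$. Suppose that for some random (possibly deterministic) sofic approximation $\Sigma=\{\sigma_n:\Gamma\to\operatorname{Sym}(V_n)\}$ we have $\operatorname{lwlim}(u,\Sigma)=\bar\mu$. Then: 1. $\bar\mu$ is a mixture of equilibrium states: there is some $\mathfrak{p}\in\operatorname{Prob}(\operatorname{Prob}^\Gamma(\mathcal{X}))$ with barycenter $\bar\mu$ such that $\mathfrak{p}$-a.e. $\nu$ is $\Sigma$-equilibrium. 2. The maximal value of $\mathrm{p}_\Sigma(\cdot)$ on $\operatorname{Prob}^\Gamma(\mathcal{X})$, attained by equilibrium measures, is $$\lim_{\mathcal{U}\downarrow\operatorname{Prob}^\Gamma(\mathcal{X})}\ \limsup_{n\to\infty}\frac1{|V_n|}\log\mathbb{E}_{\sigma_n}\exp\{\widetilde{\mathrm{P}}^{\sigma_n}(\xi_n^{\mathcal{U}})\}.$$ 3. If $\Sigma$ is good, then the ergodic decomposition of $\bar\mu$ gives full measure to the set of $\Sigma$-equilibrium measures.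
   Context: $\Gamma$ acts on $\mathtt{A}^\Gamma$ by the shift $(g\cdot\mathbf{x})(h)=\mathbf{x}(hg)$; a subshift is a closed shift-invariant subset. $\operatorname{Prob}(\cdot)$ denotes Borel probability measures (weak* topology), $\operatorname{Prob}^\Gamma(\cdot)$ the shift-invariant ones. For a finite set $V$, a map $\sigma:\Gamma\to\operatorname{Sym}(V)$ and $\mathbf{x}\in\mathtt{A}^V$, let $\Pi_v^\sigma\mathbf{x}(\gamma)=\mathbf{x}(\sigma(\gamma)(v))$, $P^\sigma_{\mathbf{x}}=\frac1{|V|}\sum_{v\in V}\delta_{\Pi_v^\sigma\mathbf{x}}$ and $\Omega(\sigma,\mathcal{O})=\{\mathbf{x}\in\mathtt{A}^V:P_{\mathbf{x}}^\sigma\in\mathcal{O}\}$ for $\mathcal{O}\subset\operatorname{Prob}(\mathtt{A}^\Gamma)$. For $\zeta\in\operatorname{Prob}(\mathtt{A}^V)$ let $P_\zeta^\sigma=\sum_{\mathbf{x}}\zeta\{\mathbf{x}\}P_{\mathbf{x}}^\sigma$ and $\mathbf{\Omega}(\sigma,\mathcal{O})=\{\zeta\in\operatorname{Prob}(\mathtt{A}^V):P_\zeta^\sigma\in\mathcal{O}\}$. For finite $F\subset\Gamma$ and $\delta>0$, $\sigma$ is $(F,\delta)$-sofic if $\frac1{|V|}|\{v:\sigma(\gamma)(v)\ne v\ \forall\gamma\in F\setminus\{1_\Gamma\}\}|>1-\delta$ and $\frac1{|V|}|\{v:\sigma(\gamma_1\gamma_2)(v)=\sigma(\gamma_1)(\sigma(\gamma_2)(v))\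 \forall\gamma_1,\gamma_2\in F\}|>1-\delta$. A sequence of random maps $\Sigma=\{\sigma_n:\Gamma\to\operatorname{Sym}(V_n)\}$ with $|V_n|\to\infty$ is a random sofic approximation if for all $F,\delta$ and all $c>0$, $\mathbb{P}(\sigma_n\text{ is }(F,\delta)\text{-sofic})>1-e^{-c|V_n|}$ for all large $n$; deterministic sofic approximations (each $\sigma_n$ fixed and eventually $(F,\delta)$-sofic for every $F,\delta$) are the special case of non-random maps. $\Gamma$ is sofic if it has a deterministic sofic approximation. Entropy and pressure: $\mathrm{h}_\Sigma(\mu)=\inf_{\mathcal{O}\ni\mu}\limsup_{n\to\infty}\frac1{|V_n|}\log\mathbb{E}|\Omega(\sigma_n,\mathcal{O})|$ ($\mathcal{O}$ over weak*-open neighborhoods of $\mu$), $u(\mu)=\int_{\mathcal{X}}u\,d\mu$, $\mathrm{p}_\Sigma(\mu)=\mathrm{h}_\Sigma(\mu)-u(\mu)$ for $\mu\in\operatorname{Prob}^\Gamma(\mathcal{X})$. $\mu\in\operatorname{Prob}^\Gamma(\mathcal{X})$ is $\Sigma$-equilibrium if it maximizes $\mathrm{p}_\Sigma$ over $\operatorname{Prob}^\Gamma(\mathcal{X})$. Finitary quantities: $\tilde U^\sigma(\mathbf{x})=\sum_{v\in V}\tilde u(\Pi_v^\sigma\mathbf{x})$, $\tilde U^\sigma(\zeta)=\int\tilde U^\sigma\,d\zeta$, and $\widetilde{\mathrm{P}}^\sigma(\zeta)=\mathrm{H}(\zeta)-\tilde U^\sigma(\zeta)$ with $\mathrm{H}$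 Shannon entropy. For an open $\mathcal{U}\supset\operatorname{Prob}^\Gamma(\mathcal{X})$ in $\operatorname{Prob}(\mathtt{A}^\Gamma)$, the restricted finitary Gibbs state $\xi_n^{\mathcal{U}}\in\operatorname{Prob}(\mathtt{A}^{V_n})$ is supported on $\Omega(\sigma_n,\mathcal{U})$ with $\xi_n^{\mathcal{U}}\{\mathbf{x}\}\propto\exp(-\tilde U^{\sigma_n}(\mathbf{x}))\mathbf{1}_{\mathbf{x}\in\Omega(\sigma_n,\mathcal{U})}$. Convention: if $\Omega(\sigma_n,\mathcal{U})=\varnothing$ then $\xi_n^{\mathcal U}$ is undefined, it is counted as not belonging to any $\mathbf{\Omega}(\sigma_n,\mathcal{O})$, and $\exp\{\widetilde{\mathrm{P}}^{\sigma_n}(\xi_n^{\mathcal{U}})\}:=0$. $\operatorname{lwlim}(u,\Sigma)=\mu$ means that for every open neighborhood $\mathcal{O}\ni\mu$ in $\operatorname{Prob}(\mathtt{A}^\Gamma)$, $$\limsup_{\mathcal{U}\downarrow\operatorname{Prob}^\Gamma(\mathcal{X})}\limsup_{n\to\infty}\frac1{|V_n|}\log\mathbb{P}\{\xi_n^{\mathcal{U}}\notin\mathbf{\Omega}(\sigma_n,\mathcal{O})\}=-\infty,$$ where limits over $\mathcal{U}$ are along the directed set (by reverse inclusion) of open neighborhoods of $\operatorname{Prob}^\Gamma(\mathcal{X})$. A measure $\mathfrak{p}$ on $\operatorname{Prob}^\Gamma(\mathtt{A}^\Gamma)$ has barycenter $\mu$ if $\mu(f)=\int\nu(f)\,\mathfrak{p}(d\nu)$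 for all continuous $f$. The ergodic decomposition of $\mu\in\operatorname{Prob}^\Gamma(\mathtt{A}^\Gamma)$ is the unique $\theta\in\operatorname{Prob}(\operatorname{Prob}^\Gamma(\mathtt{A}^\Gamma))$ with barycenter $\mu$ giving measure zero to every measurable set containing no ergodic measures. $\Sigma$ is good if $\mathrm{h}_\Sigma(\mu)\le\int\mathrm{h}_\Sigma(\nu)\,\theta(d\nu)$ for every $\mu\in\operatorname{Prob}^\Gamma(\mathtt{A}^\Gamma)$ with ergodic decomposition $\theta$. *)

theory Defs
  imports "HOL-Probability.Probability" "HOL-Combinatorics.Permutations"
    "HOL-Probability.Discrete_Topology"
begin

text \<open>
  The group \<open>\<Gamma>\<close> is a type \<open>'g\<close> of class \<^class>\<open>group_add\<close>: this class is not commutative, and its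
  operations \<open>+\<close>, \<open>-\<close>, \<open>0\<close> stand for the product, inverse and unit of \<open>\<Gamma>\<close>.
  Configurations are functions \<open>'g \<Rightarrow> 'a\<close> with the product topology; the finite alphabet will be
  instantiated by \<open>'a discrete\<close> with \<open>'a\<close> of class \<^class>\<open>finite\<close>, so that the configuration space
  is compact and every continuous real function on it is bounded.
\<close>

instance discrete :: (finite) finite
proof
  have "(UNIV :: 'a discrete set) = range discrete"
    by (metis of_discrete_inverse surjI)
  then show "finite (UNIV :: 'a discrete set)"
    by (metis finite finite_imageI)
qed


section \<open>Shift, subshifts and spaces of measures\<close>

definition shift :: "'g::group_add \<Rightarrow> ('g \<Rightarrow> 'a) \<Rightarrow> 'g \<Rightarrow> 'a" where
  "shift g x = (\<lambda>h. x (h + g))"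

definition subshift :: "('g::group_add \<Rightarrow> 'a::topological_space) set \<Rightarrow> bool" where
  "subshift X \<longleftrightarrow> closed X \<and> (\<forall>g. \<forall>x\<in>X. shift g x \<in> X)"

definition prob_measures :: "'x::topological_space measure set" where
  "prob_measures = {\<mu>. prob_space \<mu> \<and> sets \<mu> = sets borel}"

text \<open>
  The weak* topology is the initial topology of the integration maps of continuous functions.
  Boundedness of the functions is not requested, since it is only used on compact spaces.
\<close>

definition weak_star :: "'x::topological_space measure topology" where
  "weak_star = topology_generated_by
     {{\<mu> \<in> prob_measures. (\<integral>x. f x \<partial>\<mu>) \<in> S} | f S. continuous_on UNIV f \<and> open (S :: real set)}"

text \<open>
  Borel probability measures on \<open>X\<close> are regarded as measures on the full shift that give full mass
  to \<open>X\<close>.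
\<close>

definition inv_measures :: "('g::group_add \<Rightarrow> 'a::topological_space) set \<Rightarrow> ('g \<Rightarrow> 'a) measure set"
  where "inv_measures X =
    {\<mu> \<in> prob_measures. measure \<mu> X = 1 \<and> (\<forall>g. distr \<mu> borel (shift g) = \<mu>)}"

definition ergodic :: "('g::group_add \<Rightarrow> 'a::topological_space) measure \<Rightarrow> bool" where
  "ergodic \<mu> \<longleftrightarrow> \<mu> \<in> inv_measures UNIV \<and>
     (\<forall>E \<in> sets borel. (\<forall>g. shift g -` E = E) \<longrightarrow> measure \<mu> E = 0 \<or> measure \<mu> E = 1)"

definition borel_probs_of :: "'x topology \<Rightarrow> 'x measure set" where
  "borel_probs_of T =
     {\<pp>. prob_space \<pp> \<and> sets \<pp> = sets (sigma (topspace T) {S. openin T S})}"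

definition prob_on :: "'x::topological_space measure set \<Rightarrow> 'x measure measure set" where
  "prob_on K = borel_probs_of (subtopology weak_star K)"

definition has_barycenter :: "'x::topological_space measure measure \<Rightarrow> 'x measure \<Rightarrow> bool" where
  "has_barycenter \<pp> \<mu> \<longleftrightarrow> (\<forall>f :: 'x \<Rightarrow> real. continuous_on UNIV f \<longrightarrow>
     (\<integral>x. f x \<partial>\<mu>) = (\<integral>\<nu>. (\<integral>x. f x \<partial>\<nu>) \<partial>\<pp>))"

definition ergodic_decomposition ::
  "('g::group_add \<Rightarrow> 'a::topological_space) measure measure \<Rightarrow> ('g \<Rightarrow> 'a) measure \<Rightarrow> bool" where
  "ergodic_decomposition \<theta> \<mu> \<longleftrightarrow>
     \<theta> \<in> prob_on (inv_measures UNIV) \<and> has_barycenter \<theta> \<mu> \<and>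
     (\<forall>S \<in> sets \<theta>. (\<forall>\<nu> \<in> S. \<not> ergodic \<nu>) \<longrightarrow> emeasure \<theta> S = 0)"


section \<open>Sofic approximations\<close>

definition sofic_map ::
  "'v set \<Rightarrow> ('g::group_add \<Rightarrow> 'v \<Rightarrow> 'v) \<Rightarrow> 'g set \<Rightarrow> real \<Rightarrow> bool" where
  "sofic_map V \<sigma> F \<delta> \<longleftrightarrow>
     real (card {v \<in> V. \<forall>\<gamma> \<in> F - {0}. \<sigma> \<gamma> v \<noteq> v}) / real (card V) > 1 - \<delta> \<and>
     real (card {v \<in> V. \<forall>\<gamma>\<^sub>1 \<in> F. \<forall>\<gamma>\<^sub>2 \<in> F. \<sigma> (\<gamma>\<^sub>1 + \<gamma>\<^sub>2) v = \<sigma> \<gamma>\<^sub>1 (\<sigma> \<gamma>\<^sub>2 v)}) / real (card V) > 1 - \<delta>"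

definition sofic_approximation ::
  "(nat \<Rightarrow> 'v set) \<Rightarrow> (nat \<Rightarrow> 'g::group_add \<Rightarrow> 'v \<Rightarrow> 'v) \<Rightarrow> bool" where
  "sofic_approximation V \<sigma> \<longleftrightarrow>
     (\<forall>n. finite (V n)) \<and> (\<forall>n \<gamma>. \<sigma> n \<gamma> permutes V n) \<and>
     filterlim (\<lambda>n. card (V n)) at_top sequentially \<and>
     (\<forall>F \<delta>. finite F \<longrightarrow> \<delta> > 0 \<longrightarrow> (\<forall>\<^sub>F n in sequentially. sofic_map (V n) (\<sigma> n) F \<delta>))"

text \<open>Every finite set is in bijection with a set of natural numbers, so \<open>V\<^sub>n \<subseteq> \<nat>\<close> is no restriction.\<close>

definition sofic_group :: "'g::group_add itself \<Rightarrow> bool" where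
  "sofic_group _ \<longleftrightarrow>
     (\<exists>(V :: nat \<Rightarrow> nat set) (\<sigma> :: nat \<Rightarrow> 'g \<Rightarrow> nat \<Rightarrow> nat). sofic_approximation V \<sigma>)"

text \<open>
  The random map \<open>\<sigma>\<^sub>n\<close> is a random variable \<open>\<omega> \<mapsto> \<sigma> n \<omega>\<close> on a probability space \<open>M n\<close>, measurable
  for the product \<open>\<sigma>\<close>-algebra on \<open>Sym(V\<^sub>n)\<^sup>\<Gamma>\<close>, i.e. every \<open>\<sigma> n \<omega> \<gamma> v\<close> is measurable in \<open>\<omega>\<close>.
\<close>

definition random_sofic_approximation ::
  "(nat \<Rightarrow> 'w measure) \<Rightarrow> (nat \<Rightarrow> 'v set) \<Rightarrow> (nat \<Rightarrow> 'w \<Rightarrow> 'g::group_add \<Rightarrow> 'v \<Rightarrow> 'v) \<Rightarrow> bool" where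
  "random_sofic_approximation M V \<sigma> \<longleftrightarrow>
     (\<forall>n. prob_space (M n)) \<and> (\<forall>n. finite (V n)) \<and>
     (\<forall>n. \<forall>\<omega> \<in> space (M n). \<forall>\<gamma>. \<sigma> n \<omega> \<gamma> permutes V n) \<and>
     (\<forall>n \<gamma>. \<forall>v \<in> V n. (\<lambda>\<omega>. \<sigma> n \<omega> \<gamma> v) \<in> measurable (M n) (count_space (V n))) \<and>
     filterlim (\<lambda>n. card (V n)) at_top sequentially \<and>
     (\<forall>F \<delta> c. finite F \<longrightarrow> \<delta> > 0 \<longrightarrow> c > 0 \<longrightarrow>
        (\<forall>\<^sub>F n in sequentially.
           measure (M n) {\<omega> \<in> space (M n). sofic_map (V n) (\<sigma> n \<omega>) F \<delta>}
             > 1 - exp (- c * real (card (V n)))))"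


section \<open>Empirical distributions\<close>

text \<open>
  Elements of \<open>A\<^sup>V\<close> are the extensional functions in \<open>V \<rightarrow>\<^sub>E UNIV\<close>, and probability measures on
  \<open>A\<^sup>V\<close> are values of type \<open>('v \<Rightarrow> 'a) pmf\<close> supported there.
\<close>

definition pullback_name :: "('g \<Rightarrow> 'v \<Rightarrow> 'v) \<Rightarrow> ('v \<Rightarrow> 'a) \<Rightarrow> 'v \<Rightarrow> 'g \<Rightarrow> 'a" where
  "pullback_name \<sigma> x v = (\<lambda>\<gamma>. x (\<sigma> \<gamma> v))"

definition empirical ::
  "'v set \<Rightarrow> ('g \<Rightarrow> 'v \<Rightarrow> 'v) \<Rightarrow> ('v \<Rightarrow> 'a::topological_space) \<Rightarrow> ('g \<Rightarrow> 'a) measure" where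
  "empirical V \<sigma> x = distr (measure_pmf (pmf_of_set V)) borel (pullback_name \<sigma> x)"

definition good_models ::
  "'v set \<Rightarrow> ('g \<Rightarrow> 'v \<Rightarrow> 'v) \<Rightarrow> ('g \<Rightarrow> 'a::topological_space) measure set \<Rightarrow> ('v \<Rightarrow> 'a) set" where
  "good_models V \<sigma> \<O> = {x \<in> V \<rightarrow>\<^sub>E UNIV. empirical V \<sigma> x \<in> \<O>}"

definition empirical_mean ::
  "'v set \<Rightarrow> ('g \<Rightarrow> 'v \<Rightarrow> 'v) \<Rightarrow> ('v \<Rightarrow> 'a::topological_space) pmf \<Rightarrow> ('g \<Rightarrow> 'a) measure" where
  "empirical_mean V \<sigma> \<zeta> = measure_pmf \<zeta> \<bind> empirical V \<sigma>"

definition good_states ::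
  "'v set \<Rightarrow> ('g \<Rightarrow> 'v \<Rightarrow> 'v) \<Rightarrow> ('g \<Rightarrow> 'a::topological_space) measure set \<Rightarrow> ('v \<Rightarrow> 'a) pmf set" where
  "good_states V \<sigma> \<O> = {\<zeta>. set_pmf \<zeta> \<subseteq> V \<rightarrow>\<^sub>E UNIV \<and> empirical_mean V \<sigma> \<zeta> \<in> \<O>}"


section \<open>Entropy, pressure and equilibrium measures\<close>

definition elog :: "real \<Rightarrow> ereal" where
  "elog r = (if r \<le> 0 then -\<infinity> else ereal (ln r))"

definition growth_rate :: "(nat \<Rightarrow> 'v set) \<Rightarrow> (nat \<Rightarrow> real) \<Rightarrow> ereal" where
  "growth_rate V a = limsup (\<lambda>n. ereal (1 / real (card (V n))) * elog (a n))"

definition sofic_entropy ::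
  "(nat \<Rightarrow> 'w measure) \<Rightarrow> (nat \<Rightarrow> 'v set) \<Rightarrow> (nat \<Rightarrow> 'w \<Rightarrow> 'g \<Rightarrow> 'v \<Rightarrow> 'v) \<Rightarrow>
   ('g \<Rightarrow> 'a::topological_space) measure \<Rightarrow> ereal" where
  "sofic_entropy M V \<sigma> \<mu> = (INF \<O> \<in> {\<O>. openin weak_star \<O> \<and> \<mu> \<in> \<O>}.
     growth_rate V (\<lambda>n. \<integral>\<omega>. real (card (good_models (V n) (\<sigma> n \<omega>) \<O>)) \<partial>(M n)))"

definition pressure ::
  "(nat \<Rightarrow> 'w measure) \<Rightarrow> (nat \<Rightarrow> 'v set) \<Rightarrow> (nat \<Rightarrow> 'w \<Rightarrow> 'g \<Rightarrow> 'v \<Rightarrow> 'v) \<Rightarrow>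
   ('g \<Rightarrow> 'a::topological_space) set \<Rightarrow> (('g \<Rightarrow> 'a) \<Rightarrow> real) \<Rightarrow> ('g \<Rightarrow> 'a) measure \<Rightarrow> ereal" where
  "pressure M V \<sigma> X u \<mu> = sofic_entropy M V \<sigma> \<mu> - ereal (LINT x:X|\<mu>. u x)"

definition equilibrium ::
  "(nat \<Rightarrow> 'w measure) \<Rightarrow> (nat \<Rightarrow> 'v set) \<Rightarrow> (nat \<Rightarrow> 'w \<Rightarrow> 'g::group_add \<Rightarrow> 'v \<Rightarrow> 'v) \<Rightarrow>
   ('g \<Rightarrow> 'a::topological_space) set \<Rightarrow> (('g \<Rightarrow> 'a) \<Rightarrow> real) \<Rightarrow> ('g \<Rightarrow> 'a) measure \<Rightarrow> bool" where
  "equilibrium M V \<sigma> X u \<mu> \<longleftrightarrow> \<mu> \<in> inv_measures X \<and>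
     (\<forall>\<nu> \<in> inv_measures X. pressure M V \<sigma> X u \<nu> \<le> pressure M V \<sigma> X u \<mu>)"

text \<open>
  Positive part minus negative part. It is used below for the entropy, which takes values in
  \<open>[-\<infinity>, ln |A|]\<close>; the integral of the positive part is then finite, so \<open>\<infinity> - \<infinity>\<close> does not occur.
\<close>

definition ereal_integral :: "'x measure \<Rightarrow> ('x \<Rightarrow> ereal) \<Rightarrow> ereal" where
  "ereal_integral M f =
     enn2ereal (\<integral>\<^sup>+x. e2ennreal (f x) \<partial>M) - enn2ereal (\<integral>\<^sup>+x. e2ennreal (- f x) \<partial>M)"

text \<open>The alphabet enters goodness only through its type, which is why it is passed as a type token.\<close>

definition good_approximation ::
  "'a::topological_space itself \<Rightarrow>
   (nat \<Rightarrow> 'w measure) \<Rightarrow> (nat \<Rightarrow> 'v set) \<Rightarrow> (nat \<Rightarrow> 'w \<Rightarrow> 'g::group_add \<Rightarrow> 'v \<Rightarrow> 'v) \<Rightarrow> bool" where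
  "good_approximation _ M V \<sigma> \<longleftrightarrow>
     (\<forall>(\<mu> :: ('g \<Rightarrow> 'a) measure) \<theta>. \<mu> \<in> inv_measures UNIV \<longrightarrow> ergodic_decomposition \<theta> \<mu> \<longrightarrow>
        sofic_entropy M V \<sigma> \<mu> \<le> ereal_integral \<theta> (sofic_entropy M V \<sigma>))"


section \<open>Finitary Gibbs states\<close>

definition energy ::
  "'v set \<Rightarrow> ('g \<Rightarrow> 'v \<Rightarrow> 'v) \<Rightarrow> (('g \<Rightarrow> 'a) \<Rightarrow> real) \<Rightarrow> ('v \<Rightarrow> 'a) \<Rightarrow> real" where
  "energy V \<sigma> u x = (\<Sum>v\<in>V. u (pullback_name \<sigma> x v))"

definition shannon_entropy :: "'v set \<Rightarrow> ('v \<Rightarrow> 'a) pmf \<Rightarrow> real" where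
  "shannon_entropy V \<zeta> = - (\<Sum>x \<in> V \<rightarrow>\<^sub>E UNIV. pmf \<zeta> x * ln (pmf \<zeta> x))"

definition finitary_pressure ::
  "'v set \<Rightarrow> ('g \<Rightarrow> 'v \<Rightarrow> 'v) \<Rightarrow> (('g \<Rightarrow> 'a) \<Rightarrow> real) \<Rightarrow> ('v \<Rightarrow> 'a) pmf \<Rightarrow> real" where
  "finitary_pressure V \<sigma> u \<zeta> =
     shannon_entropy V \<zeta> - measure_pmf.expectation \<zeta> (energy V \<sigma> u)"

text \<open>The value \<^const>\<open>None\<close> means that the restricted Gibbs state is undefined.\<close>

definition gibbs_state ::
  "'v set \<Rightarrow> ('g \<Rightarrow> 'v \<Rightarrow> 'v) \<Rightarrow> (('g \<Rightarrow> 'a::topological_space) \<Rightarrow> real) \<Rightarrow> ('g \<Rightarrow> 'a) measure set \<Rightarrow>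
   ('v \<Rightarrow> 'a) pmf option" where
  "gibbs_state V \<sigma> u \<U> =
     (if good_models V \<sigma> \<U> = {} then None
      else Some (embed_pmf (\<lambda>x. indicator (good_models V \<sigma> \<U>) x * exp (- energy V \<sigma> u x) /
                                 (\<Sum>y \<in> good_models V \<sigma> \<U>. exp (- energy V \<sigma> u y)))))"

definition gibbs_in ::
  "'v set \<Rightarrow> ('g \<Rightarrow> 'v \<Rightarrow> 'v) \<Rightarrow> (('g \<Rightarrow> 'a::topological_space) \<Rightarrow> real) \<Rightarrow> ('g \<Rightarrow> 'a) measure set \<Rightarrow>
   ('g \<Rightarrow> 'a) measure set \<Rightarrow> bool" where
  "gibbs_in V \<sigma> u \<U> \<O> \<longleftrightarrow>
     (case gibbs_state V \<sigma> u \<U> of None \<Rightarrow> False | Some \<xi> \<Rightarrow> \<xi> \<in> good_states V \<sigma> \<O>)"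

definition exp_gibbs_pressure ::
  "'v set \<Rightarrow> ('g \<Rightarrow> 'v \<Rightarrow> 'v) \<Rightarrow> (('g \<Rightarrow> 'a::topological_space) \<Rightarrow> real) \<Rightarrow> ('g \<Rightarrow> 'a) measure set \<Rightarrow>
   real" where
  "exp_gibbs_pressure V \<sigma> u \<U> =
     (case gibbs_state V \<sigma> u \<U> of None \<Rightarrow> 0 | Some \<xi> \<Rightarrow> exp (finitary_pressure V \<sigma> u \<xi>))"


section \<open>The local weak limit\<close>

text \<open>
  The section filter of the open neighbourhoods of \<open>K\<close>, directed by reverse inclusion:
  \<^const>\<open>Limsup\<close> and \<^const>\<open>filterlim\<close> along it are the limits for \<open>\<U> \<down> K\<close>.
\<close>

definition open_nbhds :: "'x::topological_space measure set \<Rightarrow> 'x measure set filter" where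
  "open_nbhds K = (INF \<U> \<in> {\<U>. openin weak_star \<U> \<and> K \<subseteq> \<U>}.
     principal {\<U>'. openin weak_star \<U>' \<and> K \<subseteq> \<U>' \<and> \<U>' \<subseteq> \<U>})"

definition lwlim ::
  "(nat \<Rightarrow> 'w measure) \<Rightarrow> (nat \<Rightarrow> 'v set) \<Rightarrow> (nat \<Rightarrow> 'w \<Rightarrow> 'g::group_add \<Rightarrow> 'v \<Rightarrow> 'v) \<Rightarrow>
   ('g \<Rightarrow> 'a::topological_space) set \<Rightarrow> (('g \<Rightarrow> 'a) \<Rightarrow> real) \<Rightarrow> ('g \<Rightarrow> 'a) measure \<Rightarrow> bool" where
  "lwlim M V \<sigma> X u \<mu> \<longleftrightarrow> \<mu> \<in> prob_measures \<and>
     (\<forall>\<O>. openin weak_star \<O> \<longrightarrow> \<mu> \<in> \<O> \<longrightarrow>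
        Limsup (open_nbhds (inv_measures X)) (\<lambda>\<U>.
          growth_rate V (\<lambda>n.
            measure (M n) {\<omega> \<in> space (M n). \<not> gibbs_in (V n) (\<sigma> n \<omega>) u \<U> \<O>})) = -\<infinity>)"

end

(* For the full shift over a countable group, a measure is determined by its values on cylinders,
   and these values embed the space of probability measures with the weak* topology as a compact
   subset of a countable product of intervals.

   The finite variational principle turns the quantity in (2) into the growth rate of the expected
   partition function Z over models with empirical measure in U. Pressure is an infimum of such
   growth rates over neighbourhoods, hence upper semicontinuous, and a finite cover of the compact
   set of invariant measures gives (2). If W contains the equilibrium measures, then the models
   with empirical measure near an invariant measure outside W have exponentially smaller partition
   function than Z, while states far from the local weak limit occur with superexponentially small
   probability; so some Gibbs state has mean empirical measure close to the limit and almost all its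
   mass on models with empirical measure in W. A weak limit of the laws of these empirical measures
   is the measure p in (1).

   For (3), suitable convex averages of translates, chosen for mu by a mean ergodic argument,
   converge almost surely for mu, hence for almost every measure under any decomposition of mu.
   Their limit kernel decomposes almost every equilibrium measure given by (1) into ergodic ones.
   Since the pressure is maximal, goodness forces almost all of these components to be equilibrium
   measures, and on ergodic components of mu the kernel is the component itself. *)

theory Submission
  imports Defs
begin

section \<open>Cylinders and the weak* topology\<close>

text \<open>Since the group need not be amenable, there are no Folner sets to average over. What
  remains are finitely supported convex combinations of translates, selected by minimising an L2
  norm at a rate fast enough for almost sure convergence.

  Goodness cannot be applied to \<mu> directly: \<mu> is only known to be a mixture of equilibrium
  measures. It is applied to almost every measure of that mixture, with averages chosen for \<mu>,
  and the conclusion returns to \<mu> and from there to its ergodic decomposition as a Borel set of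
  points of full measure.

  The superexponential bound is what makes the Gibbs states usable. On an exceptional map the
  partition function is controlled only by a fixed exponential in |V n|, so the probability of such
  maps has to beat that exponential, whatever its rate.

  Weak limits of laws of measures are taken through binary digits: reading digits off is
  discontinuous, but evaluating them is continuous, and compactness is needed only on the side of
  the digits.\<close>

definition cyl :: "('i \<times> 'b) list \<Rightarrow> ('i \<Rightarrow> 'b) set" where
  "cyl l = {x. \<forall>(i, a) \<in> set l. x i = a}"

definition cylval :: "('i \<Rightarrow> 'b) measure \<Rightarrow> ('i \<times> 'b) list \<Rightarrow> real" where
  "cylval \<nu> l = measure \<nu> (cyl l)"

text \<open>Lists of constraints turn intersection into append and form a countable type, so unions
  and almost-everywhere statements may range over all cylinders. Contradictory lists are allowed and
  give the empty set.\<close>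

lemma cyl_Nil [simp]: "cyl [] = UNIV"
  and cyl_Cons: "cyl ((i, a) # l) = (\<lambda>x. x i) -` {a} \<inter> cyl l"
  and cyl_append: "cyl (l @ l') = cyl l \<inter> cyl l'"
  by (auto simp: cyl_def ball_Un)

lemma clopen_cyl: "open (cyl l) \<and> closed (cyl l)" for l :: "('i \<times> 'b discrete) list"
proof (induction l)
  case (Cons p l)
  obtain i a where p: "p = (i, a)" by force
  have "continuous_on UNIV (\<lambda>x :: 'i \<Rightarrow> 'b discrete. x i)"
    by (rule continuous_on_product_coordinates)
  moreover have "closed {a}" by simp
  moreover have "open {a}" by (rule open_discrete)
  ultimately have "open ((\<lambda>x. x i) -` {a})" "closed ((\<lambda>x. x i) -` {a})"
    by (simp_all add: open_vimage closed_vimage)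
  with Cons show ?case
    by (auto simp: p cyl_Cons intro!: open_Int closed_Int)
qed auto

lemma cyl_borel [measurable, simp]: "cyl l \<in> sets borel" for l :: "('i \<times> 'b discrete) list"
  using clopen_cyl[of l] by (simp add: borel_open)

lemma continuous_on_indicator_clopen:
  assumes "open S" "closed S"
  shows "continuous_on UNIV (indicator S :: _ \<Rightarrow> real)"
  unfolding continuous_on_open_vimage[OF open_UNIV]
proof (intro allI impI)
  fix B :: "real set"
  have "indicator S -` B = (if 1 \<in> B then S else {}) \<union> (if 0 \<in> B then - S else {})"
    by (auto simp: indicator_def of_bool_def split: if_splits)
  then show "open (indicator S -` B \<inter> UNIV)" using assms by (auto simp: open_Compl)
qed

lemma compact_UNIV_fun: "compact (UNIV :: ('i \<Rightarrow> 'b::finite discrete) set)"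
proof -
  have "compact (UNIV :: 'b discrete set)"
    by (simp add: finite_imp_compact)
  then have "compact_space (euclidean :: 'b discrete topology)"
    by (simp add: compact_space_def)
  then have "compact_space (product_topology (\<lambda>i::'i. euclidean :: 'b discrete topology) UNIV)"
    by (simp add: compact_space_product_topology)
  then show ?thesis
    by (simp add: compact_space_def euclidean_product_topology)
qed

lemma cyl_subset_open:
  fixes U :: "('i \<Rightarrow> 'b discrete) set"
  assumes "open U" "x \<in> U"
  shows "\<exists>l. x \<in> cyl l \<and> cyl l \<subseteq> U"
proof -
  have "openin (product_topology (\<lambda>i::'i. euclidean :: 'b discrete topology) UNIV) U"
    using assms by (simp add: euclidean_product_topology)
  from product_topology_open_contains_basis[OF this \<open>x \<in> U\<close>]
  obtain Y where Y: "x \<in> Pi\<^sub>E UNIV Y" "finite {i. Y i \<noteq> UNIV}" "Pi\<^sub>E UNIV Y \<subseteq> U"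
    by auto
  obtain js where js: "set js = {i. Y i \<noteq> UNIV}"
    using finite_list[OF Y(2)] by auto
  have "cyl (map (\<lambda>i. (i, x i)) js) \<subseteq> Pi\<^sub>E UNIV Y"
  proof
    fix y assume y: "y \<in> cyl (map (\<lambda>i. (i, x i)) js)"
    have "y i \<in> Y i" for i
      using y Y(1) js by (cases "Y i = UNIV") (auto simp: cyl_def PiE_iff)
    then show "y \<in> Pi\<^sub>E UNIV Y" by auto
  qed
  with Y(3) show ?thesis
    by (intro exI[of _ "map (\<lambda>i. (i, x i)) js"]) (auto simp: cyl_def)
qed

lemma open_eq_Union_cyl:
  fixes U :: "('i \<Rightarrow> 'b discrete) set"
  assumes "open U"
  shows "U = (\<Union>l \<in> {l. cyl l \<subseteq> U}. cyl l)"
  using cyl_subset_open[OF assms] by auto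

text \<open>An open set is the union of the cylinders that it contains, and there are only countably
  many lists.\<close>

lemma sets_borel_eq_cyl:
  "sets (borel :: ('i::countable \<Rightarrow> 'b::finite discrete) measure) = sigma_sets UNIV (range cyl)"
proof
  show "sets borel \<subseteq> sigma_sets UNIV (range (cyl :: ('i \<times> 'b discrete) list \<Rightarrow> _))"
  proof -
    have "U \<in> sigma_sets UNIV (range cyl)" if "open U" for U :: "('i \<Rightarrow> 'b discrete) set"
    proof -
      interpret sigma_algebra UNIV "sigma_sets UNIV (range (cyl :: ('i \<times> 'b discrete) list \<Rightarrow> _))"
        by (rule sigma_algebra_sigma_sets) auto
      show ?thesis
        by (subst open_eq_Union_cyl[OF that]) (intro countable_UN'', auto)
    qed
    then show ?thesis
      unfolding borel_def by (auto intro!: sigma_sets_mono)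
  qed
  show "sigma_sets UNIV (range cyl) \<subseteq> sets (borel :: ('i \<Rightarrow> 'b discrete) measure)"
    using sets.sigma_sets_subset[of "range cyl" "borel :: ('i \<Rightarrow> 'b discrete) measure"]
    by (simp add: image_subset_iff)
qed

text \<open>Cylinders are closed under intersection and include the whole space, so they are a
  generator on which finite measures are determined.\<close>

lemma measure_eqI_cyl:
  fixes M N :: "('i::countable \<Rightarrow> 'b::finite discrete) measure"
  assumes "sets M = sets borel" "sets N = sets borel" "finite_measure M"
    and "\<And>l. emeasure M (cyl l) = emeasure N (cyl l)"
  shows "M = N"
proof (rule measure_eqI_generator_eq[where E = "range cyl" and \<Omega> = UNIV and A = "\<lambda>_. UNIV"])
  show "Int_stable (range (cyl :: ('i \<times> 'b discrete) list \<Rightarrow> _))"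
    by (auto simp: Int_stable_def cyl_append[symmetric])
  show "range (\<lambda>_::nat. UNIV) \<subseteq> range (cyl :: ('i \<times> 'b discrete) list \<Rightarrow> _)"
    using cyl_Nil by (metis image_subset_iff rangeI)
  interpret finite_measure M by fact
  show "emeasure M UNIV \<noteq> \<infinity>" by simp
qed (use assms in \<open>auto simp: sets_borel_eq_cyl\<close>)

lemma prob_measuresD:
  assumes "\<nu> \<in> prob_measures"
  shows "prob_space \<nu>" "sets \<nu> = sets borel" "space \<nu> = UNIV"
proof -
  show "prob_space \<nu>" and s: "sets \<nu> = sets borel"
    using assms by (auto simp: prob_measures_def)
  then show "space \<nu> = UNIV"
    using sets_eq_imp_space_eq[OF s] by simp
qed

lemma prob_measures_eqI:
  fixes \<mu> \<nu> :: "('i::countable \<Rightarrow> 'b::finite discrete) measure"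
  assumes "\<mu> \<in> prob_measures" "\<nu> \<in> prob_measures" "\<And>l. cylval \<mu> l = cylval \<nu> l"
  shows "\<mu> = \<nu>"
proof (rule measure_eqI_cyl)
  interpret \<mu>: prob_space \<mu> using assms prob_measuresD by blast
  interpret \<nu>: prob_space \<nu> using assms prob_measuresD by blast
  show "finite_measure \<mu>" by unfold_locales
  show "emeasure \<mu> (cyl l) = emeasure \<nu> (cyl l)" for l
    using assms(3)[of l] by (simp add: cylval_def \<mu>.emeasure_eq_measure \<nu>.emeasure_eq_measure)
qed (use assms prob_measuresD in auto)

lemma continuous_bounded:
  fixes f :: "('i \<Rightarrow> 'b::finite discrete) \<Rightarrow> real"
  assumes "continuous_on UNIV f"
  obtains B where "0 < B" "\<And>x. \<bar>f x\<bar> \<le> B"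
proof -
  have "bounded (range f)"
    using compact_continuous_image[OF assms compact_UNIV_fun] by (rule compact_imp_bounded)
  then show ?thesis
    using that by (auto simp: bounded_pos)
qed

lemma continuous_integrable:
  fixes f :: "('i::countable \<Rightarrow> 'b::finite discrete) \<Rightarrow> real"
  assumes "continuous_on UNIV f" "\<nu> \<in> prob_measures"
  shows "integrable \<nu> f"
proof -
  interpret prob_space \<nu> using assms prob_measuresD by blast
  obtain B where "\<And>x. \<bar>f x\<bar> \<le> B" using continuous_bounded[OF assms(1)] by blast
  moreover have "f \<in> borel_measurable \<nu>"
    using borel_measurable_continuous_onI[OF assms(1)]
    by (simp add: measurable_cong_sets[OF prob_measuresD(2)[OF assms(2)] refl])
  ultimately show ?thesis
    by (intro integrable_const_bound[of _ B]) auto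
qed

text \<open>By compactness finitely many cylinders on which \<open>f\<close> stays within
  \<epsilon>/2 of a fixed value cover the space. They mention only finitely many coordinates, and
  two points with the same pattern on these lie in a common cylinder of the cover, so
  \<open>f\<close> varies by less than \<epsilon> between them.\<close>

lemma continuous_approx_cyl:
  fixes f :: "('i \<Rightarrow> 'b::finite discrete) \<Rightarrow> real"
  assumes f: "continuous_on UNIV f" and "\<epsilon> > 0"
  obtains L c where "finite L" "\<And>x. \<bar>f x - (\<Sum>l\<in>L. c l * indicator (cyl l) x)\<bar> \<le> \<epsilon>"
proof -
  have "\<exists>l. z \<in> cyl l \<and> (\<forall>y\<in>cyl l. \<bar>f y - f z\<bar> < \<epsilon>/2)" for z
  proof -
    have "open (f -` ball (f z) (\<epsilon>/2))"
      using f by (intro open_vimage) auto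
    from cyl_subset_open[OF this, of z] \<open>\<epsilon> > 0\<close>
    obtain l where "z \<in> cyl l" "cyl l \<subseteq> f -` ball (f z) (\<epsilon>/2)" by auto
    then show ?thesis
      by (intro exI[of _ l]) (auto simp: dist_real_def abs_minus_commute)
  qed
  then obtain lz where lz: "\<And>z. z \<in> cyl (lz z)" "\<And>z y. y \<in> cyl (lz z) \<Longrightarrow> \<bar>f y - f z\<bar> < \<epsilon>/2"
    by metis
  obtain Z where Z: "finite Z" "UNIV = (\<Union>z\<in>Z. cyl (lz z))"
  proof (rule compactE_image[OF compact_UNIV_fun, of UNIV "\<lambda>z. cyl (lz z)"])
    show "UNIV \<subseteq> (\<Union>z. cyl (lz z))" using lz(1) by blast
  qed (use clopen_cyl in auto)
  have "finite (\<Union>z\<in>Z. fst ` set (lz z))" using Z by auto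
  then obtain js where js: "set js = (\<Union>z\<in>Z. fst ` set (lz z))" using finite_list by metis
  define pat where "pat p = map (\<lambda>i. (i, p i)) js" for p :: "'i \<Rightarrow> 'b discrete"
  \<comment> \<open>All patterns are listed in the fixed order of \<open>js\<close>, so different
    lists in \<open>L\<close> have disjoint cylinders and the approximating sum has a single nonzero
    term at each point.\<close>
  define L where "L = pat ` (PiE (set js) (\<lambda>_. UNIV))"
  define c where "c l = f (SOME y. y \<in> cyl l)" for l
  have "finite L" unfolding L_def by (intro finite_imageI finite_PiE) auto
  moreover have "\<bar>f x - (\<Sum>l\<in>L. c l * indicator (cyl l) x)\<bar> \<le> \<epsilon>" for x
  proof -
    define q where "q = pat x"
    have qL: "q \<in> L"
      unfolding L_def q_def pat_def by (intro image_eqI[of _ _ "restrict x (set js)"]) auto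
    have xq: "x \<in> cyl q" by (auto simp: cyl_def q_def pat_def)
    have uniq: "l = q" if "l \<in> L" "x \<in> cyl l" for l
      using that by (auto simp: L_def q_def pat_def cyl_def)
    have "(\<Sum>l\<in>L. c l * indicator (cyl l) x) = (\<Sum>l\<in>L. if l = q then c q else 0)"
      by (intro sum.cong refl) (auto simp: xq indicator_def dest: uniq)
    also have "\<dots> = c q" using qL \<open>finite L\<close> by simp
    finally have s: "(\<Sum>l\<in>L. c l * indicator (cyl l) x) = c q" .
    define y where "y = (SOME y. y \<in> cyl q)"
    have "y \<in> cyl q" unfolding y_def using xq by (rule someI[of "\<lambda>y. y \<in> cyl q"])
    then have agree: "y i = x i" if "i \<in> set js" for i
      using that by (auto simp: cyl_def q_def pat_def)
    obtain z where z: "z \<in> Z" "x \<in> cyl (lz z)" using Z(2) by blast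
    have "y \<in> cyl (lz z)"
      using z agree js by (force simp: cyl_def)
    then have "\<bar>f y - f z\<bar> < \<epsilon>/2" "\<bar>f x - f z\<bar> < \<epsilon>/2" using lz(2) z by auto
    moreover have "c q = f y" by (simp add: c_def y_def)
    ultimately show ?thesis unfolding s by linarith
  qed
  ultimately show ?thesis using that by blast
qed

text \<open>The set \<open>L\<close> and the coefficients serve all probability measures at once,
  because the approximation of \<open>f\<close> is uniform.\<close>

lemma integral_approx_cyl:
  fixes f :: "('i::countable \<Rightarrow> 'b::finite discrete) \<Rightarrow> real"
  assumes f: "continuous_on UNIV f" and "\<epsilon> > 0"
  obtains L c where "finite L"
    "\<And>\<nu>. \<nu> \<in> prob_measures \<Longrightarrow> \<bar>(\<integral>x. f x \<partial>\<nu>) - (\<Sum>l\<in>L. c l * cylval \<nu> l)\<bar> \<le> \<epsilon>"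
proof -
  obtain L c where L: "finite L" "\<And>x. \<bar>f x - (\<Sum>l\<in>L. c l * indicator (cyl l) x)\<bar> \<le> \<epsilon>"
    using continuous_approx_cyl[OF assms] by blast
  have "\<bar>(\<integral>x. f x \<partial>\<nu>) - (\<Sum>l\<in>L. c l * cylval \<nu> l)\<bar> \<le> \<epsilon>" if \<nu>: "\<nu> \<in> prob_measures" for \<nu>
  proof -
    interpret prob_space \<nu> using \<nu> prob_measuresD by blast
    have [measurable_cong]: "sets \<nu> = sets borel" using \<nu> prob_measuresD by blast
    have int: "integrable \<nu> (\<lambda>x. c l * indicator (cyl l) x)" for l
      by (intro integrable_mult_right integrable_real_indicator)
        (auto simp: emeasure_eq_measure)
    have "(\<integral>x. f x - (\<Sum>l\<in>L. c l * indicator (cyl l) x) \<partial>\<nu>)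
        = (\<integral>x. f x \<partial>\<nu>) - (\<Sum>l\<in>L. c l * cylval \<nu> l)"
      using continuous_integrable[OF f \<nu>] int
      by (simp add: Bochner_Integration.integral_sum prob_measuresD(3)[OF \<nu>] cylval_def)
    moreover have "\<bar>\<integral>x. f x - (\<Sum>l\<in>L. c l * indicator (cyl l) x) \<partial>\<nu>\<bar> \<le> (\<integral>x. \<epsilon> \<partial>\<nu>)"
      using continuous_integrable[OF f \<nu>] int L(2)
      by (intro order_trans[OF integral_abs_bound] integral_mono) auto
    ultimately show ?thesis by (simp add: prob_space)
  qed
  with L(1) show ?thesis using that by blast
qed

lemma integral_tendsto_cyl:
  fixes f :: "('i::countable \<Rightarrow> 'b::finite discrete) \<Rightarrow> real"
  assumes f: "continuous_on UNIV f" and \<nu>: "\<And>k. \<nu> k \<in> prob_measures" "\<nu>' \<in> prob_measures"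
    and lim: "\<And>l. ((\<lambda>k. cylval (\<nu> k) l) \<longlongrightarrow> cylval \<nu>' l) F"
  shows "((\<lambda>k. \<integral>x. f x \<partial>\<nu> k) \<longlongrightarrow> (\<integral>x. f x \<partial>\<nu>')) F"
proof (rule tendstoI)
  fix \<epsilon> :: real assume "\<epsilon> > 0"
  obtain L c where L: "finite L"
    "\<And>\<nu>. \<nu> \<in> prob_measures \<Longrightarrow> \<bar>(\<integral>x. f x \<partial>\<nu>) - (\<Sum>l\<in>L. c l * cylval \<nu> l)\<bar> \<le> \<epsilon>/3"
    using integral_approx_cyl[OF f, of "\<epsilon>/3"] \<open>\<epsilon> > 0\<close> by auto
  have "((\<lambda>k. \<Sum>l\<in>L. c l * cylval (\<nu> k) l) \<longlongrightarrow> (\<Sum>l\<in>L. c l * cylval \<nu>' l)) F"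
    using lim by (intro tendsto_intros)
  then have "\<forall>\<^sub>F k in F. dist (\<Sum>l\<in>L. c l * cylval (\<nu> k) l) (\<Sum>l\<in>L. c l * cylval \<nu>' l) < \<epsilon>/3"
    by (rule tendstoD) (use \<open>\<epsilon> > 0\<close> in simp)
  then show "\<forall>\<^sub>F k in F. dist (\<integral>x. f x \<partial>\<nu> k) (\<integral>x. f x \<partial>\<nu>') < \<epsilon>"
  proof eventually_elim
    case (elim k)
    with L(2)[OF \<nu>(1)[of k]] L(2)[OF \<nu>(2)] show ?case unfolding dist_real_def by linarith
  qed
qed

text \<open>Kolmogorov extension: by compactness a decreasing sequence of clopen sets with empty
  intersection is eventually empty, so finite additivity on clopen sets suffices.\<close>

lemma cylval_limit:
  fixes \<nu> :: "nat \<Rightarrow> ('i::countable \<Rightarrow> 'b::finite discrete) measure"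
  assumes \<nu>: "\<And>k. \<nu> k \<in> prob_measures" and lim: "\<And>l. (\<lambda>k. cylval (\<nu> k) l) \<longlonglongrightarrow> t l"
  obtains \<nu>' where "\<nu>' \<in> prob_measures" "\<And>l. cylval \<nu>' l = t l"
proof -
  define C where "C = {S :: ('i \<Rightarrow> 'b discrete) set. open S \<and> closed S}"
  define m where "m S = lim (\<lambda>k. measure (\<nu> k) S)" for S
  have Cb: "S \<in> sets borel" if "S \<in> C" for S using that by (auto simp: C_def)
  \<comment> \<open>The hypothesis speaks of cylinders only. The indicator of a clopen set is
    continuous, hence uniformly close to cylinder sums, which makes the measures of the set a Cauchy
    sequence.\<close>
  have conv: "(\<lambda>k. measure (\<nu> k) S) \<longlonglongrightarrow> m S" if "S \<in> C" for S
  proof -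
    have cont: "continuous_on UNIV (indicator S :: _ \<Rightarrow> real)"
      using that by (intro continuous_on_indicator_clopen) (auto simp: C_def)
    have eq: "(\<integral>x. indicator S x \<partial>\<nu> k) = measure (\<nu> k) S" for k
      using prob_measuresD[OF \<nu>] Cb[OF that] by simp
    have "Cauchy (\<lambda>k. measure (\<nu> k) S)"
    proof (rule metric_CauchyI)
      fix \<epsilon> :: real assume "\<epsilon> > 0"
      obtain L c where L: "finite L"
        "\<And>\<nu>. \<nu> \<in> prob_measures \<Longrightarrow> \<bar>(\<integral>x. indicator S x \<partial>\<nu>) - (\<Sum>l\<in>L. c l * cylval \<nu> l)\<bar> \<le> \<epsilon>/4"
        using integral_approx_cyl[OF cont, of "\<epsilon>/4"] \<open>\<epsilon> > 0\<close> by auto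
      have "Cauchy (\<lambda>k. \<Sum>l\<in>L. c l * cylval (\<nu> k) l)"
        by (rule LIMSEQ_imp_Cauchy[OF tendsto_sum[OF tendsto_mult_left[OF lim]]])
      from metric_CauchyD[OF this, of "\<epsilon>/4"] \<open>\<epsilon> > 0\<close>
      obtain K where K: "\<forall>i\<ge>K. \<forall>j\<ge>K.
          dist (\<Sum>l\<in>L. c l * cylval (\<nu> i) l) (\<Sum>l\<in>L. c l * cylval (\<nu> j) l) < \<epsilon>/4"
        by auto
      show "\<exists>K. \<forall>i\<ge>K. \<forall>j\<ge>K. dist (measure (\<nu> i) S) (measure (\<nu> j) S) < \<epsilon>"
      proof (intro exI[of _ K] allI impI)
        fix i j assume "i \<ge> K" "j \<ge> K"
        with K have "dist (\<Sum>l\<in>L. c l * cylval (\<nu> i) l) (\<Sum>l\<in>L. c l * cylval (\<nu> j) l) < \<epsilon>/4"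
          by blast
        with L(2)[OF \<nu>[of i]] L(2)[OF \<nu>[of j]] \<open>\<epsilon> > 0\<close>
        show "dist (measure (\<nu> i) S) (measure (\<nu> j) S) < \<epsilon>"
          unfolding eq dist_real_def by linarith
      qed
    qed
    then show ?thesis
      unfolding m_def by (simp add: Cauchy_convergent_iff convergent_LIMSEQ_iff)
  qed
  have nn: "0 \<le> m S" if "S \<in> C" for S
    using conv[OF that] by (rule LIMSEQ_le_const) auto
  have m_empty: "m {} = 0" by (simp add: m_def)
  interpret C: algebra UNIV C
    by (rule algebra_iff_Un[THEN iffD2]) (auto simp: C_def open_Un closed_Un open_closed)
  have "\<exists>\<mu> :: _ \<Rightarrow> ennreal. (\<forall>S \<in> C. \<mu> S = ennreal (m S)) \<and> measure_space UNIV (sigma_sets UNIV C) \<mu>"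
  proof (rule C.caratheodory_empty_continuous)
    show "positive C (\<lambda>S. ennreal (m S))" by (simp add: positive_def m_empty)
    show "additive C (\<lambda>S. ennreal (m S))"
    proof (unfold additive_def, intro ballI impI)
      fix S T assume ST: "S \<in> C" "T \<in> C" "S \<inter> T = {}"
      have "(\<lambda>k. measure (\<nu> k) (S \<union> T)) \<longlonglongrightarrow> m S + m T"
      proof -
        have "measure (\<nu> k) (S \<union> T) = measure (\<nu> k) S + measure (\<nu> k) T" for k
        proof -
          interpret prob_space "\<nu> k" using \<nu> prob_measuresD by blast
          show ?thesis using ST Cb prob_measuresD[OF \<nu>] by (intro finite_measure_Union) auto
        qed
        then show ?thesis using conv[OF ST(1)] conv[OF ST(2)] by (simp add: tendsto_add)
      qed
      moreover have "(\<lambda>k. measure (\<nu> k) (S \<union> T)) \<longlonglongrightarrow> m (S \<union> T)"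
        using ST by (intro conv) auto
      ultimately have "m (S \<union> T) = m S + m T" using LIMSEQ_unique by blast
      then show "ennreal (m (S \<union> T)) = ennreal (m S) + ennreal (m T)"
        using nn ST by (simp add: ennreal_plus)
    qed
    show "(\<lambda>i. ennreal (m (A i))) \<longlonglongrightarrow> 0"
      if A: "range A \<subseteq> C" "decseq A" "(\<Inter>i. A i) = {}" for A
    proof -
      have "\<exists>n. A n = {}"
      proof (rule ccontr)
        assume *: "\<nexists>n. A n = {}"
        have "UNIV \<inter> (\<Inter>i\<in>UNIV. A i) \<noteq> {}"
        proof (rule compact_imp_fip_image[OF compact_UNIV_fun])
          show "closed (A i)" for i using A(1) by (auto simp: C_def)
          fix I :: "nat set" assume I: "finite I"
          obtain n where n: "\<And>i. i \<in> I \<Longrightarrow> i \<le> n" using I by (meson finite_nat_set_iff_bounded_le)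
          have "A n \<subseteq> (\<Inter>i\<in>I. A i)" using n A(2) by (auto simp: decseq_def)
          then show "UNIV \<inter> (\<Inter>i\<in>I. A i) \<noteq> {}" using * by auto
        qed
        with A(3) show False by simp
      qed
      then obtain n where n: "A n = {}" by blast
      have "\<forall>\<^sub>F i in sequentially. ennreal (m (A i)) = 0"
        using eventually_ge_at_top[of n]
      proof eventually_elim
        case (elim i)
        with A(2) n have "A i = {}" by (auto simp: decseq_def)
        then show ?case by (simp add: m_empty)
      qed
      then show ?thesis by (rule tendsto_eventually)
    qed
  qed auto
  then obtain \<mu>' :: "_ \<Rightarrow> ennreal" where \<mu>': "\<And>S. S \<in> C \<Longrightarrow> \<mu>' S = ennreal (m S)"
    "measure_space UNIV (sigma_sets UNIV C) \<mu>'" by blast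
  have cC: "cyl l \<in> C" for l using clopen_cyl[of l] by (simp add: C_def)
  have sC: "sigma_sets UNIV C = sets borel"
  proof
    show "sigma_sets UNIV C \<subseteq> sets borel"
      using sets.sigma_sets_subset[of C borel] Cb by auto
    show "sets borel \<subseteq> sigma_sets UNIV C"
      unfolding sets_borel_eq_cyl using cC by (intro sigma_sets_mono') auto
  qed
  define N where "N = measure_of UNIV (sets borel) \<mu>'"
  have sN: "sets N = sets borel" unfolding N_def
    by (metis sets.sigma_sets_eq sets_measure_of_conv space_borel sets.space_closed)
  have eN: "emeasure N S = \<mu>' S" if "S \<in> sets borel" for S
    unfolding N_def using \<mu>'(2) that unfolding sC measure_space_def
    by (intro emeasure_measure_of_sigma) (auto simp: sC)
  have t: "m (cyl l) = t l" for l
    using LIMSEQ_unique[OF conv[OF cC] lim[of l, unfolded cylval_def]] .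
  have eNc: "emeasure N (cyl l) = ennreal (t l)" for l
    using eN[OF cyl_borel] \<mu>'(1)[OF cC] t by metis
  have "t [] = 1"
  proof (rule LIMSEQ_unique[OF lim])
    have "cylval (\<nu> k) [] = 1" for k
      using prob_space.prob_space[of "\<nu> k"] prob_measuresD[OF \<nu>, of k] by (simp add: cylval_def)
    then show "(\<lambda>k. cylval (\<nu> k) []) \<longlonglongrightarrow> 1" by simp
  qed
  then have "emeasure N (space N) = 1"
    using eNc[of "[]"] sets_eq_imp_space_eq[OF sN] by simp
  then have "prob_space N" by (rule prob_spaceI)
  then have "N \<in> prob_measures" by (simp add: prob_measures_def sN)
  moreover have "cylval N l = t l" for l
    using eNc[of l] nn[OF cC] by (simp add: cylval_def measure_def t)
  ultimately show ?thesis using that by blast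
qed

section \<open>The weak* topology in cylinder coordinates\<close>

lemma topspace_weak_star [simp]: "topspace weak_star = prob_measures"
proof
  show "topspace weak_star \<subseteq> prob_measures"
    by (auto simp: weak_star_def topology_generated_by_topspace)
  have "openin weak_star {\<mu> \<in> prob_measures. (\<integral>x. 0 \<partial>\<mu>) \<in> (UNIV :: real set)}"
    unfolding weak_star_def
    by (rule topology_generated_by_Basis) (blast intro: continuous_on_const open_UNIV)
  then show "prob_measures \<subseteq> topspace weak_star"
    using openin_subset by auto
qed

lemma openin_prob_measures: "openin weak_star prob_measures"
  using openin_topspace[of weak_star] by simp

lemma continuous_map_cylval:
  "continuous_map weak_star euclidean
    (cylval :: ('i::countable \<Rightarrow> 'b::finite discrete) measure \<Rightarrow> _)"
proof -
  have "continuous_map weak_star euclideanreal (\<lambda>\<nu>. cylval \<nu> l)" for l :: "('i \<times> 'b discrete) list"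
  proof (unfold continuous_map_def, intro conjI allI impI)
    fix S :: "real set" assume "openin euclidean S"
    then have S: "open S" by simp
    have c: "continuous_on UNIV (indicator (cyl l) :: _ \<Rightarrow> real)"
      using clopen_cyl[of l] by (intro continuous_on_indicator_clopen) auto
    have "openin weak_star {\<nu> \<in> prob_measures. (\<integral>x. indicator (cyl l) x \<partial>\<nu>) \<in> S}"
      unfolding weak_star_def by (rule topology_generated_by_Basis) (use c S in blast)
    also have "{\<nu> \<in> prob_measures. (\<integral>x. indicator (cyl l) x \<partial>\<nu>) \<in> S}
      = {\<nu> \<in> topspace weak_star. cylval \<nu> l \<in> S}"
      by (auto simp: cylval_def prob_measuresD)
    finally show "openin weak_star {\<nu> \<in> topspace weak_star. cylval \<nu> l \<in> S}" .
  qed auto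
  then have "continuous_map weak_star (product_topology (\<lambda>_. euclideanreal) UNIV)
    (cylval :: ('i \<Rightarrow> 'b discrete) measure \<Rightarrow> _)"
    by (simp add: continuous_map_componentwise_UNIV)
  then show ?thesis by (simp add: euclidean_product_topology)
qed

text \<open>The weak* topology is thus induced by \<open>cylval\<close> from a metrisable product,
  where the later topological arguments take place. For a subbasic set the neighbourhoods come from
  the uniform approximation of integrals by cylinder sums.\<close>

lemma openin_weak_star_iff:
  fixes \<O> :: "('i::countable \<Rightarrow> 'b::finite discrete) measure set"
  shows "openin weak_star \<O> \<longleftrightarrow> (\<exists>S. open S \<and> \<O> = prob_measures \<inter> cylval -` S)"
proof
  assume "\<exists>S. open S \<and> \<O> = prob_measures \<inter> cylval -` S"
  then obtain S where S: "open S" "\<O> = {\<nu> \<in> topspace weak_star. cylval \<nu> \<in> S}" by auto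
  then show "openin weak_star \<O>"
    using openin_continuous_map_preimage[OF continuous_map_cylval, of S] by simp
next
  assume "openin weak_star \<O>"
  then have "generate_topology_on {{\<mu> \<in> prob_measures. (\<integral>x. f x \<partial>\<mu>) \<in> S} | f S.
     continuous_on UNIV f \<and> open (S :: real set)} \<O>"
    by (simp add: weak_star_def openin_topology_generated_by_iff)
  then show "\<exists>S. open S \<and> \<O> = prob_measures \<inter> cylval -` S"
  proof induction
    case Empty
    then show ?case by (intro exI[of _ "{}"]) auto
  next
    case (Int a b)
    then obtain S T where "open S" "a = prob_measures \<inter> cylval -` S"
      "open T" "b = prob_measures \<inter> cylval -` T" by blast
    then show ?case by (intro exI[of _ "S \<inter> T"]) auto
  next
    case (UN K)
    then obtain S where "\<And>k. k \<in> K \<Longrightarrow> open (S k) \<and> k = prob_measures \<inter> cylval -` S k" by metis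
    then show ?case by (intro exI[of _ "\<Union>k\<in>K. S k"]) blast
  next
    case (Basis B)
    then obtain f and S :: "real set" where B: "B = {\<mu> \<in> prob_measures. (\<integral>x. f x \<partial>\<mu>) \<in> S}"
      and f: "continuous_on UNIV f" and S: "open S" by blast
    have "\<exists>T. open T \<and> cylval \<nu> \<in> T \<and> prob_measures \<inter> cylval -` T \<subseteq> B" if "\<nu> \<in> B" for \<nu>
    proof -
      have \<nu>: "\<nu> \<in> prob_measures" "(\<integral>x. f x \<partial>\<nu>) \<in> S" using that B by auto
      obtain \<epsilon> where \<epsilon>: "\<epsilon> > 0" "ball (\<integral>x. f x \<partial>\<nu>) \<epsilon> \<subseteq> S" using S \<nu>(2) by (meson open_contains_ball)
      obtain L c where L: "finite L"
        "\<And>\<nu>. \<nu> \<in> prob_measures \<Longrightarrow> \<bar>(\<integral>x. f x \<partial>\<nu>) - (\<Sum>l\<in>L. c l * cylval \<nu> l)\<bar> \<le> \<epsilon>/3"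
        using integral_approx_cyl[OF f, of "\<epsilon>/3"] \<epsilon> by auto
      define T where "T = (\<lambda>t. \<Sum>l\<in>L. c l * t l) -` ball (\<Sum>l\<in>L. c l * cylval \<nu> l) (\<epsilon>/3)"
      have "open T" unfolding T_def
        by (intro open_vimage open_ball continuous_intros continuous_on_product_coordinates)
      moreover have "cylval \<nu> \<in> T" using \<epsilon> by (simp add: T_def)
      moreover have "prob_measures \<inter> cylval -` T \<subseteq> B"
      proof
        fix \<nu>' assume "\<nu>' \<in> prob_measures \<inter> cylval -` T"
        then have \<nu>': "\<nu>' \<in> prob_measures"
          "dist (\<Sum>l\<in>L. c l * cylval \<nu> l) (\<Sum>l\<in>L. c l * cylval \<nu>' l) < \<epsilon>/3" by (auto simp: T_def)
        from \<nu>'(2) L(2)[OF \<nu>(1)] L(2)[OF \<nu>'(1)]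
        have "(\<integral>x. f x \<partial>\<nu>') \<in> ball (\<integral>x. f x \<partial>\<nu>) \<epsilon>"
          unfolding dist_real_def mem_ball by linarith
        with \<epsilon>(2) \<nu>'(1) show "\<nu>' \<in> B" by (auto simp: B)
      qed
      ultimately show ?thesis by blast
    qed
    then obtain T where T: "\<And>\<nu>. \<nu> \<in> B \<Longrightarrow> open (T \<nu>) \<and> cylval \<nu> \<in> T \<nu> \<and> prob_measures \<inter> cylval -` T \<nu> \<subseteq> B"
      by metis
    then show ?case
      by (intro exI[of _ "\<Union>\<nu>\<in>B. T \<nu>"]) (auto simp: B)
  qed
qed

text \<open>Sequences suffice in a countable product, and a coordinatewise limit of cylinder values
  again belongs to a measure by \<open>cylval_limit\<close>.\<close>

lemma closed_cylval_image:
  "closed (cylval ` (prob_measures :: ('i::countable \<Rightarrow> 'b::finite discrete) measure set))"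
  unfolding closed_sequential_limits
proof (intro allI impI, elim conjE)
  fix x t assume x: "\<forall>n. x n \<in> cylval ` (prob_measures :: ('i \<Rightarrow> 'b discrete) measure set)" and "x \<longlonglongrightarrow> t"
  from x have "\<forall>n. \<exists>\<nu> :: ('i \<Rightarrow> 'b discrete) measure. \<nu> \<in> prob_measures \<and> x n = cylval \<nu>" by auto
  from choice[OF this] obtain \<nu> :: "nat \<Rightarrow> ('i \<Rightarrow> 'b discrete) measure"
    where \<nu>: "\<And>n. \<nu> n \<in> prob_measures" "\<And>n. x n = cylval (\<nu> n)" by auto
  have "(\<lambda>k. cylval (\<nu> k) l) \<longlonglongrightarrow> t l" for l
    using continuous_on_tendsto_compose[OF continuous_on_product_coordinates \<open>x \<longlonglongrightarrow> t\<close>, of l] \<nu>(2) by simp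
  from cylval_limit[OF \<nu>(1) this] obtain \<nu>' where "\<nu>' \<in> prob_measures" "\<And>l. cylval \<nu>' l = t l" by blast
  then show "t \<in> cylval ` (prob_measures :: ('i \<Rightarrow> 'b discrete) measure set)" by (intro image_eqI[of _ _ \<nu>'] ext) auto
qed

lemma compact_cylval_image:
  "compact (cylval ` (prob_measures :: ('i::countable \<Rightarrow> 'b::finite discrete) measure set))"
proof -
  have "compact_space (product_topology (\<lambda>_::('i \<times> 'b discrete) list. top_of_set {0..1::real}) UNIV)"
    by (simp add: compact_space_product_topology compact_space_subtopology)
  then have "compactin (product_topology (\<lambda>_. euclideanreal) UNIV)
      (PiE (UNIV :: ('i \<times> 'b discrete) list set) (\<lambda>_. {0..1::real}))"
    by (subst compactin_PiE) auto
  then have "compact (PiE (UNIV :: ('i \<times> 'b discrete) list set) (\<lambda>_. {0..1::real}))"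
    by (simp add: euclidean_product_topology)
  moreover have "cylval ` (prob_measures :: ('i \<Rightarrow> 'b discrete) measure set) \<subseteq> PiE UNIV (\<lambda>_. {0..1::real})"
    by (auto simp: cylval_def prob_measuresD(1) prob_space.prob_le_1)
  ultimately show ?thesis
    using closed_cylval_image by (metis compact_Int_closed inf.absorb_iff2)
qed

text \<open>Closed sets of measures are handled throughout as preimages of closed sets under
  \<open>cylval\<close>; their images are closed pieces of the compact image of
  \<open>prob_measures\<close>.\<close>

lemma compact_cylval_closed:
  fixes K :: "('i::countable \<Rightarrow> 'b::finite discrete) measure set"
  assumes "closed C" "K = prob_measures \<inter> cylval -` C"
  shows "compact (cylval ` K)"
proof -
  have "cylval ` K = cylval ` prob_measures \<inter> C" using assms by auto
  then show ?thesis using compact_Int_closed[OF compact_cylval_image assms(1)] by simp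
qed

lemma compactin_weak_star:
  fixes K :: "('i::countable \<Rightarrow> 'b::finite discrete) measure set"
  assumes "closed C" "K = prob_measures \<inter> cylval -` C"
  shows "compactin weak_star K"
  unfolding compactin_def
proof (intro conjI allI impI)
  show "K \<subseteq> topspace weak_star" using assms by auto
  fix \<U> assume \<U>': "Ball \<U> (openin weak_star) \<and> K \<subseteq> \<Union>\<U>"
  then have \<U>: "K \<subseteq> \<Union>\<U>" by blast
  from \<U>'
  have "\<forall>U\<in>\<U>. \<exists>S. open S \<and> U = prob_measures \<inter> cylval -` S"
    by (simp add: openin_weak_star_iff)
  from bchoice[OF this] obtain S where S: "\<forall>U\<in>\<U>. open (S U) \<and> U = prob_measures \<inter> cylval -` S U"
    by (rule exE)
  then have So: "\<And>U. U \<in> \<U> \<Longrightarrow> open (S U)"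
    and Sv: "\<And>U \<nu>. U \<in> \<U> \<Longrightarrow> \<nu> \<in> U \<longleftrightarrow> \<nu> \<in> prob_measures \<and> cylval \<nu> \<in> S U"
    by fastforce+
  have "cylval ` K \<subseteq> (\<Union>U\<in>\<U>. S U)" using \<U> Sv by blast
  from compactE_image[OF compact_cylval_closed[OF assms] _ this] So
  obtain \<F> where \<F>: "\<F> \<subseteq> \<U>" "finite \<F>" "cylval ` K \<subseteq> (\<Union>U\<in>\<F>. S U)" by blast
  have "K \<subseteq> \<Union>\<F>"
  proof
    fix \<nu> assume \<nu>: "\<nu> \<in> K"
    then obtain U where "U \<in> \<F>" "cylval \<nu> \<in> S U" using \<F>(3) by blast
    moreover have "\<nu> \<in> prob_measures" using \<nu> assms by auto
    ultimately show "\<nu> \<in> \<Union>\<F>" using Sv \<F>(1) by blast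
  qed
  with \<F> show "\<exists>\<F>. finite \<F> \<and> \<F> \<subseteq> \<U> \<and> K \<subseteq> \<Union>\<F>" by blast
qed

section \<open>Barycenters and tightness on the space of measures\<close>

text \<open>Carries the \<sigma>-algebra prescribed by \<open>prob_on K\<close>, so that
  measurability can be stated before any law on \<open>K\<close> is given.\<close>

definition weak_borel :: "'x::topological_space measure set \<Rightarrow> 'x measure measure" where
  "weak_borel K = sigma (topspace (subtopology weak_star K)) {S. openin (subtopology weak_star K) S}"

lemma openin_sub_weak_star: "openin (subtopology weak_star K) S \<Longrightarrow> S \<subseteq> prob_measures \<inter> K"
  using openin_subset[of "subtopology weak_star K" S] by simp

lemma prob_on_iff: "\<pp> \<in> prob_on K \<longleftrightarrow> prob_space \<pp> \<and> sets \<pp> = sets (weak_borel K)"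
  by (simp add: prob_on_def borel_probs_of_def weak_borel_def)

lemma space_weak_borel [simp]: "space (weak_borel K) = prob_measures \<inter> K"
  unfolding weak_borel_def by (subst space_measure_of) (use openin_sub_weak_star in auto)

lemma prob_onD:
  assumes "\<pp> \<in> prob_on K"
  shows "prob_space \<pp>" "sets \<pp> = sets (weak_borel K)" "space \<pp> = prob_measures \<inter> K"
  using assms sets_eq_imp_space_eq[of \<pp> "weak_borel K"] by (auto simp: prob_on_iff)

lemma sets_weak_borel_eq:
  "sets (weak_borel K) = sigma_sets (prob_measures \<inter> K) {S. openin (subtopology weak_star K) S}"
  unfolding weak_borel_def by (subst sets_measure_of) (use openin_sub_weak_star in auto)

lemma cylval_measurable [measurable]:
  "(cylval :: ('i::countable \<Rightarrow> 'b::finite discrete) measure \<Rightarrow> _) \<in> weak_borel K \<rightarrow>\<^sub>M borel"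
proof (rule borel_measurableI)
  fix S :: "(('i \<times> 'b discrete) list \<Rightarrow> real) set" assume "open S"
  then have "openin weak_star (prob_measures \<inter> cylval -` S)"
    by (auto simp: openin_weak_star_iff)
  then have "openin (subtopology weak_star K) (cylval -` S \<inter> space (weak_borel K))"
    by (auto simp: openin_subtopology)
  then show "cylval -` S \<inter> space (weak_borel K) \<in> sets (weak_borel K)"
    unfolding sets_weak_borel_eq by (intro sigma_sets.Basic) auto
qed

lemma cylval_measurable_at [measurable]:
  "(\<lambda>\<nu> :: ('i::countable \<Rightarrow> 'b::finite discrete) measure. cylval \<nu> l) \<in> borel_measurable (weak_borel K)"
proof -
  have "(\<lambda>t. t l) \<in> borel_measurable borel"
    by (intro borel_measurable_continuous_onI continuous_on_product_coordinates)
  from measurable_compose[OF cylval_measurable this] show ?thesis .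
qed

text \<open>Relatively open sets are preimages of open sets of a countable product under
  \<open>cylval\<close>, and maps into that product are measurable as soon as each coordinate
  is.\<close>

lemma measurable_weak_borelI:
  fixes f :: "'x \<Rightarrow> ('i::countable \<Rightarrow> 'b::finite discrete) measure"
  assumes "\<And>x. x \<in> space M \<Longrightarrow> f x \<in> K" "K \<subseteq> prob_measures"
    and "\<And>l. (\<lambda>x. cylval (f x) l) \<in> borel_measurable M"
  shows "f \<in> M \<rightarrow>\<^sub>M weak_borel K"
  unfolding weak_borel_def
proof (rule measurable_measure_of)
  show "f \<in> space M \<rightarrow> topspace (subtopology weak_star K)" using assms by auto
  show "{S. openin (subtopology weak_star K) S} \<subseteq> Pow (topspace (subtopology weak_star K))"
    by (use openin_sub_weak_star in auto)
  fix y assume "y \<in> {S. openin (subtopology weak_star K) S}"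
  then obtain S where S: "open S" "y = prob_measures \<inter> cylval -` S \<inter> K"
    by (auto simp: openin_subtopology openin_weak_star_iff)
  have "(\<lambda>x. cylval (f x)) \<in> M \<rightarrow>\<^sub>M borel"
    by (rule measurable_coordinatewise_then_product) (rule assms(3))
  then have "(\<lambda>x. cylval (f x)) -` S \<inter> space M \<in> sets M"
    using S by (intro measurable_sets) auto
  also have "(\<lambda>x. cylval (f x)) -` S \<inter> space M = f -` y \<inter> space M"
    using S(2) assms(1,2) by auto
  finally show "f -` y \<inter> space M \<in> sets M" .
qed

text \<open>Cylinders are an intersection-stable generator. This passes from coordinates to kernels
  in the sense of \<open>prob_algebra\<close>, for which \<open>bind\<close> is available.\<close>

lemma measurable_prob_algebra_cylI:
  fixes f :: "'x \<Rightarrow> ('i::countable \<Rightarrow> 'b::finite discrete) measure"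
  assumes "\<And>x. x \<in> space M \<Longrightarrow> f x \<in> prob_measures"
    and "\<And>l. (\<lambda>x. cylval (f x) l) \<in> borel_measurable M"
  shows "f \<in> M \<rightarrow>\<^sub>M prob_algebra borel"
proof (rule measurable_prob_algebra_generated[OF sets_borel_eq_cyl])
  show "Int_stable (range (cyl :: ('i \<times> 'b discrete) list \<Rightarrow> _))"
    by (auto simp: Int_stable_def cyl_append[symmetric])
  show "(\<lambda>a. emeasure (f a) A) \<in> borel_measurable M" if A: "A \<in> range cyl" for A
  proof -
    obtain l where l: "A = cyl l" using A by blast
    have "(\<lambda>a. ennreal (cylval (f a) l)) \<in> borel_measurable M"
      using assms(2)[of l] by measurable
    also have "?this \<longleftrightarrow> ?thesis"
    proof (rule measurable_cong)
      fix a assume "a \<in> space M"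
      then interpret prob_space "f a" using assms(1) prob_measuresD by blast
      show "ennreal (cylval (f a) l) = emeasure (f a) A"
        by (simp add: emeasure_eq_measure l cylval_def)
    qed
    finally show ?thesis .
  qed
  show "prob_space (f a)" "sets (f a) = sets borel" if "a \<in> space M" for a
    using prob_measuresD[OF assms(1)[OF that]] by auto
qed auto

lemma id_measurable_prob_algebra [measurable]:
  "(\<lambda>\<nu>. \<nu>) \<in> weak_borel K \<rightarrow>\<^sub>M prob_algebra (borel :: ('i::countable \<Rightarrow> 'b::finite discrete) measure)"
  by (rule measurable_prob_algebra_cylI) auto

lemma prob_measures_bind:
  assumes "prob_space L" "\<kappa> \<in> L \<rightarrow>\<^sub>M prob_algebra borel"
  shows "L \<bind> \<kappa> \<in> prob_measures"
  using prob_space_bind'[of L L \<kappa> borel] sets_bind'[of L L \<kappa> borel] assms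
  by (auto simp: prob_measures_def space_prob_algebra)

lemma kernel_prob_measures:
  assumes "\<kappa> \<in> L \<rightarrow>\<^sub>M prob_algebra borel" "x \<in> space L"
  shows "\<kappa> x \<in> prob_measures"
  using measurable_space[OF assms] by (auto simp: space_prob_algebra prob_measures_def)

lemma integral_bind_prob:
  fixes f :: "_ \<Rightarrow> real"
  assumes L: "prob_space L" and \<kappa>: "\<kappa> \<in> L \<rightarrow>\<^sub>M prob_algebra borel"
    and f: "f \<in> borel_measurable borel" "\<And>x. \<bar>f x\<bar> \<le> B"
  shows "(\<integral>x. f x \<partial>(L \<bind> \<kappa>)) = (\<integral>y. (\<integral>x. f x \<partial>\<kappa> y) \<partial>L)"
proof (rule integral_bind[where K = borel and B = B and B' = 1])
  show "\<kappa> \<in> L \<rightarrow>\<^sub>M subprob_algebra borel" using \<kappa> by (rule measurable_prob_algebraD)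
  show "finite_measure L" using L by (rule prob_space.finite_measure)
  show "AE x in L. emeasure (\<kappa> x) (space (\<kappa> x)) \<le> ennreal 1"
    using kernel_prob_measures[OF \<kappa>]
    by (intro AE_I2) (auto simp: prob_measures_def prob_space.emeasure_space_1)
qed (use f in auto)

lemma measure_bind_prob:
  assumes L: "prob_space L" and \<kappa>: "\<kappa> \<in> L \<rightarrow>\<^sub>M prob_algebra borel" and "A \<in> sets borel"
  shows "measure (L \<bind> \<kappa>) A = (\<integral>y. measure (\<kappa> y) A \<partial>L)"
proof -
  have "(\<integral>x. indicat_real A x \<partial>(L \<bind> \<kappa>)) = (\<integral>y. (\<integral>x. indicat_real A x \<partial>\<kappa> y) \<partial>L)"
    using assms(3) by (intro integral_bind_prob[OF L \<kappa>, where B = 1]) (auto simp: indicator_def)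
  moreover have "(\<integral>y. (\<integral>x. indicat_real A x \<partial>\<kappa> y) \<partial>L) = (\<integral>y. measure (\<kappa> y) A \<partial>L)"
    using kernel_prob_measures[OF \<kappa>] prob_measuresD(3)
    by (intro Bochner_Integration.integral_cong refl) fastforce
  ultimately show ?thesis
    using prob_measuresD(3)[OF prob_measures_bind[OF L \<kappa>]] by simp
qed

lemma eq_bindI:
  fixes \<mu> :: "('i::countable \<Rightarrow> 'b::finite discrete) measure"
  assumes L: "prob_space L" and \<kappa>: "\<kappa> \<in> L \<rightarrow>\<^sub>M prob_algebra borel"
    and \<mu>: "\<mu> \<in> prob_measures" "\<And>l. cylval \<mu> l = (\<integral>y. cylval (\<kappa> y) l \<partial>L)"
  shows "\<mu> = L \<bind> \<kappa>"
  using \<mu> prob_measures_bind[OF L \<kappa>] measure_bind_prob[OF L \<kappa> cyl_borel]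
  by (intro prob_measures_eqI) (auto simp: cylval_def)

lemma cylval_eq_integral:
  "\<nu> \<in> prob_measures \<Longrightarrow> cylval \<nu> l = (\<integral>x. indicator (cyl l) x \<partial>\<nu>)"
  by (simp add: cylval_def prob_measuresD)

lemma continuous_indicator_cyl:
  "continuous_on UNIV (indicator (cyl l :: ('i \<Rightarrow> 'b discrete) set) :: _ \<Rightarrow> real)"
  using clopen_cyl[of l] by (intro continuous_on_indicator_clopen) auto

text \<open>Cylinder indicators are continuous, so the barycenter fixes cylinder values; conversely
  these values identify \<mu> with the mixture of the measures under \<pp>, and mixtures integrate
  all bounded Borel functions. Writing \<mu> as a \<open>bind\<close> also lets null sets pass
  between \<mu> and almost all components.\<close>

lemma has_barycenter_iff:
  fixes \<mu> :: "('i::countable \<Rightarrow> 'b::finite discrete) measure"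
  assumes \<pp>: "\<pp> \<in> prob_on K" and \<mu>: "\<mu> \<in> prob_measures"
  shows "has_barycenter \<pp> \<mu> \<longleftrightarrow> (\<forall>l. cylval \<mu> l = (\<integral>\<nu>. cylval \<nu> l \<partial>\<pp>))"
    and "has_barycenter \<pp> \<mu> \<Longrightarrow> \<mu> = \<pp> \<bind> (\<lambda>\<nu>. \<nu>)"
proof -
  have id: "(\<lambda>\<nu>. \<nu>) \<in> \<pp> \<rightarrow>\<^sub>M prob_algebra borel"
    using id_measurable_prob_algebra[of K] measurable_cong_sets[OF prob_onD(2)[OF \<pp>] refl] by blast
  have eq: "\<mu> = \<pp> \<bind> (\<lambda>\<nu>. \<nu>)" if "\<forall>l. cylval \<mu> l = (\<integral>\<nu>. cylval \<nu> l \<partial>\<pp>)"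
    using that by (intro eq_bindI[OF prob_onD(1)[OF \<pp>] id \<mu>]) auto
  have ind: "cylval \<mu> l = (\<integral>\<nu>. cylval \<nu> l \<partial>\<pp>)" if "has_barycenter \<pp> \<mu>" for l
  proof -
    have "(\<integral>x. indicat_real (cyl l) x \<partial>\<mu>) = (\<integral>\<nu>. (\<integral>x. indicat_real (cyl l) x \<partial>\<nu>) \<partial>\<pp>)"
      using that[unfolded has_barycenter_def, rule_format, OF continuous_indicator_cyl[of l]] .
    also have "\<dots> = (\<integral>\<nu>. cylval \<nu> l \<partial>\<pp>)"
      by (intro Bochner_Integration.integral_cong refl) (auto simp: cylval_eq_integral prob_onD(3)[OF \<pp>])
    finally show ?thesis by (simp add: cylval_eq_integral[OF \<mu>])
  qed
  show "has_barycenter \<pp> \<mu> \<longleftrightarrow> (\<forall>l. cylval \<mu> l = (\<integral>\<nu>. cylval \<nu> l \<partial>\<pp>))"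
  proof
    assume *: "\<forall>l. cylval \<mu> l = (\<integral>\<nu>. cylval \<nu> l \<partial>\<pp>)"
    show "has_barycenter \<pp> \<mu>"
      unfolding has_barycenter_def
    proof (intro allI impI)
      fix f :: "('i \<Rightarrow> 'b discrete) \<Rightarrow> real" assume f: "continuous_on UNIV f"
      obtain B where B: "\<And>x. \<bar>f x\<bar> \<le> B" using continuous_bounded[OF f] by blast
      show "(\<integral>x. f x \<partial>\<mu>) = (\<integral>\<nu>. (\<integral>x. f x \<partial>\<nu>) \<partial>\<pp>)"
        unfolding eq[OF *]
        by (rule integral_bind_prob[OF prob_onD(1)[OF \<pp>] id _ B])
          (rule borel_measurable_continuous_onI[OF f])
    qed
  qed (use ind in auto)
  show "\<mu> = \<pp> \<bind> (\<lambda>\<nu>. \<nu>)" if "has_barycenter \<pp> \<mu>"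
    using eq ind[OF that] by blast
qed

section \<open>Binary coding of cylinder values and weak limits of laws of measures\<close>

fun greedy_rem :: "real \<Rightarrow> nat \<Rightarrow> real" where
  "greedy_rem t 0 = t"
| "greedy_rem t (Suc n) = 2 * greedy_rem t n - of_bool (1/2 \<le> greedy_rem t n)"

text \<open>\<open>greedy_rem t n\<close> is the remainder after n greedy digits, rescaled by 2^n.
  It stays in [0, 1]; the value 1 reproduces itself, so t = 1 is expanded into digits that are all
  one.\<close>

lemma binary_expansion:
  assumes "0 \<le> t" "t \<le> 1"
  shows "(\<lambda>j. of_bool (1/2 \<le> greedy_rem t j) * (1/2)^Suc j) sums t"
proof -
  have r: "0 \<le> greedy_rem t n \<and> greedy_rem t n \<le> 1" for n
    using assms by (induction n) auto
  have s: "(\<Sum>j<n. of_bool (1/2 \<le> greedy_rem t j) * (1/2)^Suc j) = t - greedy_rem t n * (1/2)^n" for n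
    by (induction n) (auto simp: field_simps)
  have "(\<lambda>n. greedy_rem t n * (1/2)^n) \<longlonglongrightarrow> 0"
  proof (rule Lim_null_comparison)
    show "\<forall>\<^sub>F n in sequentially. norm (greedy_rem t n * (1/2)^n) \<le> (1/2)^n"
      using r by (intro always_eventually) (auto simp: abs_mult intro!: mult_left_le_one_le)
    show "(\<lambda>n. (1/2)^n :: real) \<longlonglongrightarrow> 0" by (rule LIMSEQ_power_zero) simp
  qed
  then show ?thesis
    unfolding sums_def s by (auto intro: tendsto_eq_intros)
qed

text \<open>Binary digits of the values \<open>cylval \<nu> l\<close> turn laws of random measures into measures on a Cantor
  cube, where \<open>cylval_limit\<close> provides weak limits.\<close>

definition decode :: "('c \<times> nat \<Rightarrow> bool discrete) \<Rightarrow> 'c \<Rightarrow> real" where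
  "decode y l = (\<Sum>j. of_bool (of_discrete (y (l, j))) * (1/2)^Suc j)"

text \<open>Each digit depends on one coordinate, and the series converges uniformly. The greedy
  encoding has no such continuity, so limits are taken on the digit cube and only then
  decoded.\<close>

lemma continuous_on_decode: "continuous_on UNIV (decode :: ('c::countable \<times> nat \<Rightarrow> bool discrete) \<Rightarrow> _)"
proof (rule continuous_on_coordinatewise_then_product)
  fix l :: 'c
  have c: "continuous_on UNIV (\<lambda>y :: 'c \<times> nat \<Rightarrow> bool discrete. of_bool (of_discrete (y (l, j))) :: real)" for j
  proof -
    have "continuous_on UNIV (\<lambda>b. of_bool (of_discrete b) :: real)"
      by (simp add: continuous_on_open_vimage open_discrete)
    from continuous_on_compose2[OF this continuous_on_product_coordinates[of "(l, j)"]] show ?thesis by simp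
  qed
  have "uniform_limit UNIV
      (\<lambda>n y. \<Sum>j<n. of_bool (of_discrete (y (l, j))) * (1/2)^Suc j :: real)
      (\<lambda>y. \<Sum>j. of_bool (of_discrete (y (l, j))) * (1/2)^Suc j) sequentially"
  proof (rule Weierstrass_m_test)
    show "summable (\<lambda>j. (1/2)^Suc j :: real)"
      by (simp add: summable_geometric)
  qed auto
  then show "continuous_on UNIV (\<lambda>y. decode y l)"
    unfolding decode_def
  proof (rule uniform_limit_theorem[rotated])
    show "\<forall>\<^sub>F n in sequentially. continuous_on UNIV
        (\<lambda>y. \<Sum>j<n. of_bool (of_discrete (y (l, j))) * (1/2)^Suc j :: real)"
      by (intro always_eventually allI continuous_on_sum continuous_on_mult c continuous_on_const)
  qed auto
qed

lemma decode_surj: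
  assumes "\<And>l. 0 \<le> t l \<and> t l \<le> 1"
  shows "decode (\<lambda>(l, j). discrete (1/2 \<le> greedy_rem (t l) j)) = t"
  using assms binary_expansion[THEN sums_unique]
  by (auto simp: decode_def fun_eq_iff discrete_inverse)

lemma cylval_bounds: "\<nu> \<in> prob_measures \<Longrightarrow> 0 \<le> cylval \<nu> l \<and> cylval \<nu> l \<le> 1"
  by (auto simp: cylval_def prob_measuresD(1) prob_space.prob_le_1)

text \<open>The laws \<open>q k\<close> are coded as measures on the digit cube, where a subsequence
  has a limit \<eta>; decoding \<eta> yields \<pp>. The hypothesis \<open>conc\<close> forces \<eta>
  to live on codes of elements of \<open>E\<close>, and continuity of \<open>decode\<close>
  preserves the barycenters.\<close>

lemma limit_barycenter_measure:
  fixes q :: "nat \<Rightarrow> ('i::countable \<Rightarrow> 'b::finite discrete) measure pmf"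
  assumes q: "\<And>k. set_pmf (q k) \<subseteq> prob_measures" and \<mu>: "\<mu> \<in> prob_measures"
    and lim: "\<And>l. (\<lambda>k. \<integral>\<nu>. cylval \<nu> l \<partial>q k) \<longlonglongrightarrow> cylval \<mu> l"
    and C: "closed C" "E = prob_measures \<inter> cylval -` C" "E \<subseteq> K" "K \<subseteq> prob_measures"
    and conc: "\<And>W. openin weak_star W \<Longrightarrow> E \<subseteq> W \<Longrightarrow> (\<lambda>k. measure (q k) W) \<longlonglongrightarrow> 1"
  obtains \<pp> where "\<pp> \<in> prob_on K" "has_barycenter \<pp> \<mu>" "AE \<nu> in \<pp>. \<nu> \<in> E"
proof -
  define \<beta> :: "('i \<Rightarrow> 'b discrete) measure \<Rightarrow> (('i \<times> 'b discrete) list \<times> nat \<Rightarrow> bool discrete)"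
    where "\<beta> \<nu> = (\<lambda>(l, j). discrete (1/2 \<le> greedy_rem (cylval \<nu> l) j))" for \<nu>
  have \<beta>: "decode (\<beta> \<nu>) = cylval \<nu>" if "\<nu> \<in> prob_measures" for \<nu>
    unfolding \<beta>_def using cylval_bounds[OF that] by (intro decode_surj) auto
  define \<Lambda> where "\<Lambda> k = distr (measure_pmf (q k)) borel \<beta>" for k
  have \<Lambda>: "\<Lambda> k \<in> prob_measures" for k
    unfolding \<Lambda>_def prob_measures_def by (auto intro!: prob_space.prob_space_distr prob_space_measure_pmf)
  obtain t r where tr: "t \<in> cylval ` (prob_measures :: (_ \<Rightarrow> bool discrete) measure set)" "strict_mono r"
    "((\<lambda>k. cylval (\<Lambda> k)) \<circ> r) \<longlonglongrightarrow> t"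
    using compact_cylval_image[unfolded compact_def] \<Lambda> by (metis (no_types, lifting) imageI)
  then obtain \<eta> where \<eta>: "\<eta> \<in> prob_measures" "t = cylval \<eta>" by blast
  have lc: "(\<lambda>k. cylval (\<Lambda> (r k)) w) \<longlonglongrightarrow> cylval \<eta> w" for w
    using continuous_on_tendsto_compose[OF continuous_on_product_coordinates tr(3), of w] \<eta>(2) by simp
  interpret \<eta>: prob_space \<eta> using \<eta> prob_measuresD by blast
  have [measurable_cong]: "sets \<eta> = sets borel" using \<eta> prob_measuresD by blast
  have cE: "compact (cylval ` E)" using compact_cylval_closed[OF C(1,2)] .
  define G where "G = (decode -` (cylval ` E) :: (('i \<times> 'b discrete) list \<times> nat \<Rightarrow> bool discrete) set)"
  have "closed G" unfolding G_def
    using compact_imp_closed[OF cE] continuous_on_decode by (rule closed_vimage)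
  then have G [measurable]: "G \<in> sets borel" by simp
  \<comment> \<open>A cylinder of digits that misses \<open>G\<close> decodes to a compact set
    \<open>D\<close> disjoint from the coordinates of \<open>E\<close>. The complement of
    \<open>D\<close> gives a weak* neighbourhood \<open>W\<close> of \<open>E\<close>, and the coded
    law charges the cylinder by at most the mass that \<open>q k\<close> leaves outside
    \<open>W\<close>.\<close>
  have null: "emeasure \<eta> (cyl w) = 0" if w: "cyl w \<subseteq> - G" for w
  proof -
    define D where "D = decode ` (cyl w :: (('i \<times> 'b discrete) list \<times> nat \<Rightarrow> bool discrete) set)"
    have "compact D" unfolding D_def
      using clopen_cyl[of w] compact_Int_closed[OF compact_UNIV_fun, of "cyl w"]
      by (intro compact_continuous_image continuous_on_subset[OF continuous_on_decode]) auto
    define W where "W = prob_measures \<inter> cylval -` (- D)"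
    have "openin weak_star W"
      unfolding W_def openin_weak_star_iff using compact_imp_closed[OF \<open>compact D\<close>] by blast
    moreover have "E \<subseteq> W"
    proof
      fix \<nu> assume \<nu>: "\<nu> \<in> E"
      have "cylval \<nu> \<notin> D"
      proof
        assume "cylval \<nu> \<in> D"
        then obtain y where y: "cylval \<nu> = decode y" "y \<in> cyl w" unfolding D_def by (rule imageE)
        then have "y \<in> G" using \<nu> unfolding G_def by (metis imageI vimageI)
        with y(2) w show False by blast
      qed
      with \<nu> C show "\<nu> \<in> W" by (auto simp: W_def)
    qed
    ultimately have qW: "(\<lambda>k. measure (q k) W) \<longlonglongrightarrow> 1" by (rule conc)
    have le: "cylval (\<Lambda> k) w \<le> 1 - measure (q k) W" for k
    proof -
      have "cylval (\<Lambda> k) w = measure (q k) (\<beta> -` cyl w)"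
        by (simp add: cylval_def \<Lambda>_def measure_distr)
      also have "\<dots> = measure (q k) (\<beta> -` cyl w \<inter> set_pmf (q k))"
        by (rule measure_Int_set_pmf[symmetric])
      also have "\<dots> \<le> measure (q k) (- W)"
      proof (rule measure_pmf.finite_measure_mono)
        show "\<beta> -` cyl w \<inter> set_pmf (q k) \<subseteq> - W"
        proof safe
          fix \<nu> assume \<nu>: "\<beta> \<nu> \<in> cyl w" "\<nu> \<in> set_pmf (q k)" "\<nu> \<in> W"
          then have "decode (\<beta> \<nu>) = cylval \<nu>" using q by (intro \<beta>) auto
          then have "cylval \<nu> \<in> D" unfolding D_def using \<nu>(1) by (metis imageI)
          with \<nu>(3) show False by (simp add: W_def)
        qed
      qed auto
      also have "\<dots> = 1 - measure (q k) W"
        using measure_pmf.prob_compl[of W "q k"] by (simp add: Compl_eq_Diff_UNIV)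
      finally show ?thesis .
    qed
    have "(\<lambda>k. 1 - measure (q (r k)) W) \<longlonglongrightarrow> 1 - 1"
      using LIMSEQ_subseq_LIMSEQ[OF qW tr(2)] by (intro tendsto_intros) (simp add: o_def)
    then have "cylval \<eta> w \<le> 1 - 1"
      by (rule LIMSEQ_le[OF lc]) (use le in auto)
    then have "measure \<eta> (cyl w) = 0" by (simp add: cylval_def measure_le_0_iff)
    then show ?thesis by (simp add: \<eta>.emeasure_eq_measure)
  qed
  have "- G = (\<Union>w\<in>{w. cyl w \<subseteq> - G}. cyl w)"
    using \<open>closed G\<close> by (intro open_eq_Union_cyl) auto
  moreover have "(\<Union>w\<in>{w. cyl w \<subseteq> - G}. cyl w) \<in> null_sets \<eta>"
    by (rule null_sets_UN') (use null in \<open>auto simp: null_sets_def\<close>)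
  ultimately have "- G \<in> null_sets \<eta>" by simp
  then have AEG: "AE y in \<eta>. y \<in> G" by (rule AE_I') auto
  have "E \<noteq> {}"
  proof
    assume "E = {}"
    then have "(\<lambda>k. measure (q k) {}) \<longlonglongrightarrow> 1" by (intro conc) auto
    then show False by (simp add: LIMSEQ_const_iff)
  qed
  then obtain \<nu>0 where \<nu>0: "\<nu>0 \<in> E" by blast
  \<comment> \<open>\<open>\<nu>0\<close> is a default value off \<open>G\<close>, a null set of
    \<eta>; it keeps all values of \<open>f\<close> in \<open>E\<close>, hence in
    \<open>K\<close>.\<close>
  define f where "f y = (if y \<in> G then inv_into E cylval (decode y) else \<nu>0)" for y
  have fE: "f y \<in> E" for y
    using \<nu>0 by (auto simp: f_def G_def intro: inv_into_into)
  have fG: "cylval (f y) = decode y" if "y \<in> G" for y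
    using that by (auto simp: f_def G_def intro!: f_inv_into_f)
  have dm [measurable]: "(\<lambda>y. decode y l) \<in> borel_measurable borel" for l :: "('i \<times> 'b discrete) list"
    using continuous_on_product_then_coordinatewise[OF continuous_on_decode]
    by (intro borel_measurable_continuous_onI) blast
  have "(\<lambda>y. cylval (f y) l) \<in> borel_measurable \<eta>" for l
  proof -
    have "(\<lambda>y. if y \<in> G then decode y l else cylval \<nu>0 l) \<in> borel_measurable \<eta>" by measurable
    also have "(\<lambda>y. if y \<in> G then decode y l else cylval \<nu>0 l) = (\<lambda>y. cylval (f y) l)"
      using fG by (auto simp: f_def fun_eq_iff)
    finally show ?thesis .
  qed
  then have fm [measurable]: "f \<in> \<eta> \<rightarrow>\<^sub>M weak_borel K"
    using fE C by (intro measurable_weak_borelI) auto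
  define \<pp> where "\<pp> = distr \<eta> (weak_borel K) f"
  have \<pp>: "\<pp> \<in> prob_on K"
    unfolding \<pp>_def prob_on_iff by (auto intro!: \<eta>.prob_space_distr fm)
  moreover have "has_barycenter \<pp> \<mu>"
    unfolding has_barycenter_iff(1)[OF \<pp> \<mu>]
  proof
    fix l :: "('i \<times> 'b discrete) list"
    have cd: "continuous_on UNIV (\<lambda>y. decode y l)"
      using continuous_on_product_then_coordinatewise[OF continuous_on_decode] by blast
    \<comment> \<open>Only here is \<open>decode\<close> integrated against the converging laws, and
      continuity makes the limit legitimate.\<close>
    have "(\<lambda>k. \<integral>y. decode y l \<partial>\<Lambda> (r k)) \<longlonglongrightarrow> (\<integral>y. decode y l \<partial>\<eta>)"
      by (rule integral_tendsto_cyl[OF cd \<Lambda> \<eta>(1) lc])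
    moreover have "(\<integral>y. decode y l \<partial>\<Lambda> k) = (\<integral>\<nu>. cylval \<nu> l \<partial>q k)" for k
    proof -
      have "(\<integral>y. decode y l \<partial>\<Lambda> k) = (\<integral>\<nu>. decode (\<beta> \<nu>) l \<partial>q k)"
        unfolding \<Lambda>_def by (rule integral_distr) auto
      also have "\<dots> = (\<integral>\<nu>. cylval \<nu> l \<partial>q k)"
        using q by (intro integral_cong_AE) (auto simp: AE_measure_pmf_iff \<beta> subset_iff)
      finally show ?thesis .
    qed
    moreover have "(\<lambda>k. \<integral>\<nu>. cylval \<nu> l \<partial>q (r k)) \<longlonglongrightarrow> cylval \<mu> l"
      using LIMSEQ_subseq_LIMSEQ[OF lim tr(2)] by (simp add: o_def)
    ultimately have "cylval \<mu> l = (\<integral>y. decode y l \<partial>\<eta>)"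
      using LIMSEQ_unique by (simp add: LIMSEQ_unique)
    also have "\<dots> = (\<integral>y. cylval (f y) l \<partial>\<eta>)"
      using AEG by (intro integral_cong_AE) (auto simp: fG)
    also have "\<dots> = (\<integral>\<nu>. cylval \<nu> l \<partial>\<pp>)"
      unfolding \<pp>_def by (rule integral_distr[symmetric]) auto
    finally show "cylval \<mu> l = (\<integral>\<nu>. cylval \<nu> l \<partial>\<pp>)" .
  qed
  moreover have "AE \<nu> in \<pp>. \<nu> \<in> E"
  proof -
    have "{\<nu> \<in> space (weak_borel K). \<nu> \<in> E} = cylval -` C \<inter> space (weak_borel K)"
      using C by auto
    also have "\<dots> \<in> sets (weak_borel K)"
      using C(1) by (intro measurable_sets[OF cylval_measurable]) auto
    finally have "{\<nu> \<in> space (weak_borel K). \<nu> \<in> E} \<in> sets (weak_borel K)" .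
    then show ?thesis
      unfolding \<pp>_def by (subst AE_distr_iff) (auto simp: fE)
  qed
  ultimately show ?thesis using that by blast
qed

section \<open>Growth rates\<close>

context
  fixes V :: "nat \<Rightarrow> 'v set"
  assumes card_lim: "filterlim (\<lambda>n. card (V n)) at_top sequentially"
begin

lemma card_eventually_ge: fixes c :: real shows "\<forall>\<^sub>F n in sequentially. real (card (V n)) \<ge> c"
  using filterlim_compose[OF filterlim_real_sequentially card_lim]
  by (simp add: filterlim_at_top)

lemma card_eventually_pos: "\<forall>\<^sub>F n in sequentially. card (V n) > 0"
  using card_eventually_ge[of 1] by eventually_elim simp

text \<open>With \<open>growth_rate_leI\<close> it trades arithmetic of extended reals for eventual
  exponential bounds. Nonpositive terms, where \<open>elog\<close> is minus infinity, satisfy every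
  such bound.\<close>

lemma growth_rate_lessD:
  fixes t :: real
  assumes "growth_rate V a < ereal t"
  shows "\<forall>\<^sub>F n in sequentially. a n < exp (t * card (V n))"
  using Limsup_lessD[OF assms[unfolded growth_rate_def]] card_eventually_pos
proof eventually_elim
  case (elim n)
  show ?case
  proof (cases "a n \<le> 0")
    case False
    with elim have "ln (a n) < t * card (V n)" by (simp add: elog_def field_simps)
    then show ?thesis using False by (metis exp_less_mono exp_ln not_le)
  qed (auto intro: le_less_trans)
qed

lemma growth_rate_leI:
  fixes t :: real
  assumes "\<forall>\<^sub>F n in sequentially. a n \<le> exp (t * card (V n))"
  shows "growth_rate V a \<le> ereal t"
  unfolding growth_rate_def
proof (rule Limsup_bounded)
  show "\<forall>\<^sub>F n in sequentially. ereal (1 / real (card (V n))) * elog (a n) \<le> ereal t"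
    using assms card_eventually_pos
  proof eventually_elim
    case (elim n)
    show ?case
    proof (cases "a n \<le> 0")
      case False
      then have "ln (a n) \<le> ln (exp (t * card (V n)))" using elim by (subst ln_le_cancel_iff) auto
      then have "ln (a n) \<le> t * card (V n)" by simp
      with False elim show ?thesis by (simp add: elog_def field_simps)
    qed (use elim in \<open>simp add: elog_def\<close>)
  qed
qed

lemma growth_rate_leI':
  assumes "\<And>t::real. x < ereal t \<Longrightarrow> \<forall>\<^sub>F n in sequentially. a n \<le> exp (t * card (V n))"
  shows "growth_rate V a \<le> x"
proof (rule ccontr)
  assume "\<not> growth_rate V a \<le> x"
  then have "x < growth_rate V a" by simp
  from ereal_dense2[OF this] obtain t where t: "x < ereal t" "ereal t < growth_rate V a" by blast
  with growth_rate_leI[OF assms[OF t(1)]] show False by simp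
qed

lemma growth_rate_mono:
  assumes "\<forall>\<^sub>F n in sequentially. a n \<le> b n"
  shows "growth_rate V a \<le> growth_rate V b"
proof (rule growth_rate_leI')
  fix t assume "growth_rate V b < ereal t"
  from growth_rate_lessD[OF this] assms
  show "\<forall>\<^sub>F n in sequentially. a n \<le> exp (t * card (V n))" by eventually_elim simp
qed

lemma growth_rate_mult_exp:
  fixes c :: real shows
  "growth_rate V (\<lambda>n. a n * exp (c * card (V n))) \<le> growth_rate V a + ereal c"
proof (rule growth_rate_leI')
  fix t assume "growth_rate V a + ereal c < ereal t"
  then have "growth_rate V a < ereal (t - c)"
    by (cases "growth_rate V a") (auto simp: algebra_simps)
  from growth_rate_lessD[OF this]
  show "\<forall>\<^sub>F n in sequentially. a n * exp (c * card (V n)) \<le> exp (t * card (V n))"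
  proof eventually_elim
    case (elim n)
    then have "a n * exp (c * card (V n)) \<le> exp ((t - c) * card (V n)) * exp (c * card (V n))"
      by (intro mult_right_mono) auto
    then show ?case by (simp add: exp_add[symmetric] algebra_simps)
  qed
qed

text \<open>A finite sum exceeds its largest term by a constant factor at most, and an arbitrarily
  small increase of the exponential rate absorbs constants.\<close>

lemma growth_rate_sum_less:
  fixes t :: real
  assumes "finite I" "\<And>i. i \<in> I \<Longrightarrow> growth_rate V (a i) < ereal t"
  shows "growth_rate V (\<lambda>n. \<Sum>i\<in>I. a i n) < ereal t"
  using assms
proof (induction I)
  case empty
  have "growth_rate V (\<lambda>n. 0) \<le> ereal (t - 1)"
    by (rule growth_rate_leI) simp
  then show ?case by (simp add: le_less_trans)
next
  case (insert i I)
  then have "max (growth_rate V (a i)) (growth_rate V (\<lambda>n. \<Sum>i\<in>I. a i n)) < ereal t" by simp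
  from ereal_dense2[OF this] obtain s where s: "growth_rate V (a i) < ereal s"
    "growth_rate V (\<lambda>n. \<Sum>i\<in>I. a i n) < ereal s" "s < t" by auto
  \<comment> \<open>The gap between \<open>s\<close> and \<open>r\<close> absorbs the factor 2 as
    soon as |V n| reaches ln 2 / (r - s).\<close>
  define r where "r = (s + t) / 2"
  have r: "s < r" "r < t" using s by (auto simp: r_def)
  have "\<forall>\<^sub>F n in sequentially. real (card (V n)) \<ge> ln 2 / (r - s)" by (rule card_eventually_ge)
  with growth_rate_lessD[OF s(1)] growth_rate_lessD[OF s(2)]
  have "\<forall>\<^sub>F n in sequentially. a i n + (\<Sum>i\<in>I. a i n) \<le> exp (r * card (V n))"
  proof eventually_elim
    case (elim n)
    then have "ln 2 \<le> (r - s) * card (V n)" using r by (simp add: field_simps)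
    then have "exp (ln 2) \<le> exp ((r - s) * card (V n))" by (simp only: exp_le_cancel_iff)
    then have "2 * exp (s * card (V n)) \<le> exp ((r - s) * card (V n)) * exp (s * card (V n))"
      by (intro mult_right_mono) auto
    also have "\<dots> = exp (r * card (V n))" by (simp add: exp_add[symmetric] algebra_simps)
    finally show ?case using elim by linarith
  qed
  then have "growth_rate V (\<lambda>n. a i n + (\<Sum>i\<in>I. a i n)) \<le> ereal r" by (rule growth_rate_leI)
  then have "growth_rate V (\<lambda>n. a i n + (\<Sum>i\<in>I. a i n)) < ereal t" using r by (simp add: le_less_trans)
  then show ?case using insert by simp
qed

end

section \<open>Partition functions\<close>

text \<open>The normalising constant of the restricted Gibbs state; for the zero potential it counts
  the good models.\<close>

definition partition_sum ::
  "'v set \<Rightarrow> ('g \<Rightarrow> 'v \<Rightarrow> 'v) \<Rightarrow> (('g \<Rightarrow> 'a::topological_space) \<Rightarrow> real) \<Rightarrow> ('g \<Rightarrow> 'a) measure set \<Rightarrow> real" where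
  "partition_sum V \<sigma> f \<O> = (\<Sum>x\<in>good_models V \<sigma> \<O>. exp (- energy V \<sigma> f x))"

lemma finite_PiE_UNIV: "finite V \<Longrightarrow> finite (V \<rightarrow>\<^sub>E (UNIV :: 'a::finite set))"
  by (intro finite_PiE) auto

lemma good_models_subset: "good_models V \<sigma> \<O> \<subseteq> V \<rightarrow>\<^sub>E UNIV"
  by (auto simp: good_models_def)

lemma finite_good_models:
  "finite V \<Longrightarrow> finite (good_models V \<sigma> (\<O> :: ('g \<Rightarrow> 'a::finite discrete) measure set))"
  by (rule finite_subset[OF good_models_subset finite_PiE_UNIV])

lemma empirical_prob_measures: "empirical V \<sigma> x \<in> prob_measures"
  unfolding empirical_def prob_measures_def
  by (auto intro!: prob_space.prob_space_distr prob_space_measure_pmf)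

lemma partition_sum_nonneg: "0 \<le> partition_sum V \<sigma> f \<O>"
  unfolding partition_sum_def by (intro sum_nonneg) auto

lemma partition_sum_mono:
  fixes \<O> :: "('g \<Rightarrow> 'a::finite discrete) measure set"
  assumes "finite V" "\<O> \<subseteq> \<O>'"
  shows "partition_sum V \<sigma> f \<O> \<le> partition_sum V \<sigma> f \<O>'"
  unfolding partition_sum_def using assms
  by (intro sum_mono2 finite_good_models) (auto simp: good_models_def)

lemma partition_sum_UN:
  fixes \<O> :: "'i \<Rightarrow> ('g \<Rightarrow> 'a::finite discrete) measure set"
  assumes "finite V" "finite I"
  shows "partition_sum V \<sigma> f (\<Union>i\<in>I. \<O> i) \<le> (\<Sum>i\<in>I. partition_sum V \<sigma> f (\<O> i))"
  using assms(2)
proof induction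
  case empty
  show ?case by (simp add: partition_sum_def good_models_def)
next
  case (insert i I)
  let ?e = "\<lambda>x. exp (- energy V \<sigma> f x)"
  let ?A = "good_models V \<sigma> (\<O> i)" and ?B = "good_models V \<sigma> (\<Union>i\<in>I. \<O> i)"
  have "good_models V \<sigma> (\<Union>i\<in>insert i I. \<O> i) = ?A \<union> ?B"
    by (auto simp: good_models_def)
  moreover have "sum ?e (?A \<union> ?B) = sum ?e ?A + sum ?e ?B - sum ?e (?A \<inter> ?B)"
    using finite_good_models[OF assms(1)] by (intro sum_Un) auto
  moreover have "0 \<le> sum ?e (?A \<inter> ?B)" by (intro sum_nonneg) auto
  ultimately have "partition_sum V \<sigma> f (\<Union>i\<in>insert i I. \<O> i)
      \<le> partition_sum V \<sigma> f (\<O> i) + partition_sum V \<sigma> f (\<Union>i\<in>I. \<O> i)"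
    by (simp add: partition_sum_def)
  with insert show ?case by simp
qed

lemma partition_sum_0: "partition_sum V \<sigma> (\<lambda>x. 0) \<O> = real (card (good_models V \<sigma> \<O>))"
  by (simp add: partition_sum_def energy_def)

lemma energy_eq_empirical:
  fixes f :: "('g::countable \<Rightarrow> 'a::finite discrete) \<Rightarrow> real"
  assumes "finite V" "V \<noteq> {}" "continuous_on UNIV f"
  shows "energy V \<sigma> f x = card V * (\<integral>y. f y \<partial>empirical V \<sigma> x)"
proof -
  have "(\<integral>y. f y \<partial>empirical V \<sigma> x) = (\<integral>v. f (pullback_name \<sigma> x v) \<partial>measure_pmf (pmf_of_set V))"
    unfolding empirical_def
    by (rule integral_distr) (use borel_measurable_continuous_onI[OF assms(3)] in auto)
  then show ?thesis
    using assms by (simp add: integral_pmf_of_set energy_def)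
qed

lemma partition_sum_pos:
  fixes \<O> :: "('g \<Rightarrow> 'a::finite discrete) measure set"
  assumes "finite V" "good_models V \<sigma> \<O> \<noteq> {}"
  shows "0 < partition_sum V \<sigma> f \<O>"
  unfolding partition_sum_def using assms by (intro sum_pos finite_good_models) auto

lemma gibbs_state_props:
  fixes \<U> :: "('g \<Rightarrow> 'a::finite discrete) measure set"
  assumes V: "finite V" and "gibbs_state V \<sigma> f \<U> = Some \<xi>"
  shows "good_models V \<sigma> \<U> \<noteq> {}"
    and "pmf \<xi> x = indicator (good_models V \<sigma> \<U>) x * exp (- energy V \<sigma> f x) / partition_sum V \<sigma> f \<U>"
    and "set_pmf \<xi> = good_models V \<sigma> \<U>"
proof -
  let ?G = "good_models V \<sigma> \<U>" and ?Z = "partition_sum V \<sigma> f \<U>"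
  define p where "p x = indicator ?G x * exp (- energy V \<sigma> f x) / ?Z" for x
  show G: "?G \<noteq> {}" using assms(2) by (auto simp: gibbs_state_def split: if_splits)
  have \<xi>: "\<xi> = embed_pmf p"
    using assms(2) by (auto simp: gibbs_state_def p_def[abs_def] partition_sum_def split: if_splits)
  have Z: "0 < ?Z" using partition_sum_pos[OF V G] .
  have nn: "0 \<le> p x" for x using Z by (simp add: p_def)
  have "(\<integral>\<^sup>+x. ennreal (p x) \<partial>count_space UNIV) = (\<Sum>x\<in>?G. ennreal (p x))"
    using finite_good_models[OF V] by (intro nn_integral_count_space') (auto simp: p_def)
  also have "\<dots> = ennreal (\<Sum>x\<in>?G. p x)" using nn by (simp add: sum_ennreal)
  also have "(\<Sum>x\<in>?G. p x) = 1"
    using Z by (simp add: p_def sum_divide_distrib[symmetric] partition_sum_def)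
  finally have one: "(\<integral>\<^sup>+x. ennreal (p x) \<partial>count_space UNIV) = 1" by simp
  show px: "pmf \<xi> x = indicator ?G x * exp (- energy V \<sigma> f x) / ?Z" for x
  proof -
    have "pmf \<xi> x = p x" unfolding \<xi> by (rule pmf_embed_pmf[OF nn one])
    then show ?thesis by (simp add: p_def)
  qed
  show "set_pmf \<xi> = ?G"
    using px Z by (auto simp: set_pmf_eq indicator_def)
qed

lemma gibbs_state_None_iff: "gibbs_state V \<sigma> f \<U> = None \<longleftrightarrow> good_models V \<sigma> \<U> = {}"
  by (simp add: gibbs_state_def)

text \<open>On the support, \<open>ln (pmf \<xi> x)\<close> is minus the energy minus the logarithm
  of the partition function. In entropy minus mean energy the energies cancel and only that
  logarithm remains. The value 0 for an undefined state matches the empty sum.\<close>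

lemma exp_gibbs_pressure_eq:
  fixes \<U> :: "('g \<Rightarrow> 'a::finite discrete) measure set"
  assumes V: "finite V"
  shows "exp_gibbs_pressure V \<sigma> f \<U> = partition_sum V \<sigma> f \<U>"
proof (cases "gibbs_state V \<sigma> f \<U>")
  case None
  then have "good_models V \<sigma> \<U> = {}" by (simp add: gibbs_state_None_iff)
  then show ?thesis using None by (simp add: exp_gibbs_pressure_def partition_sum_def)
next
  case (Some \<xi>)
  let ?G = "good_models V \<sigma> \<U>" and ?Z = "partition_sum V \<sigma> f \<U>"
  note \<xi> = gibbs_state_props[OF V Some]
  have Z: "0 < ?Z" using partition_sum_pos[OF V \<xi>(1)] .
  have G: "?G \<subseteq> V \<rightarrow>\<^sub>E UNIV" by (auto simp: good_models_def)
  have fG: "finite ?G" by (rule finite_good_models[OF V])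
  have "(\<Sum>x\<in>V \<rightarrow>\<^sub>E UNIV. pmf \<xi> x * ln (pmf \<xi> x)) = (\<Sum>x\<in>?G. pmf \<xi> x * ln (pmf \<xi> x))"
    using G by (intro sum.mono_neutral_right finite_PiE_UNIV V) (auto simp: \<xi>)
  also have "\<dots> = (\<Sum>x\<in>?G. - (energy V \<sigma> f x * pmf \<xi> x) - pmf \<xi> x * ln ?Z)"
  proof (intro sum.cong refl)
    fix x assume "x \<in> ?G"
    then have "ln (pmf \<xi> x) = - energy V \<sigma> f x - ln ?Z" using Z by (simp add: \<xi>(2) ln_div)
    then show "pmf \<xi> x * ln (pmf \<xi> x) = - (energy V \<sigma> f x * pmf \<xi> x) - pmf \<xi> x * ln ?Z"
      by (simp only: right_diff_distrib) simp
  qed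
  also have "\<dots> = - (\<Sum>x\<in>?G. energy V \<sigma> f x * pmf \<xi> x) - (\<Sum>x\<in>?G. pmf \<xi> x) * ln ?Z"
    by (simp add: sum_subtractf sum_negf sum_distrib_right)
  also have "(\<Sum>x\<in>?G. pmf \<xi> x) = 1"
    using sum_pmf_eq_1[OF fG] \<xi>(3) by simp
  also have "(\<Sum>x\<in>?G. energy V \<sigma> f x * pmf \<xi> x) = measure_pmf.expectation \<xi> (energy V \<sigma> f)"
    using fG \<xi>(3) by (intro integral_measure_pmf_real[symmetric]) auto
  finally have "finitary_pressure V \<sigma> f \<xi> = ln ?Z"
    by (simp add: finitary_pressure_def shannon_entropy_def)
  then show ?thesis using Z Some by (simp add: exp_gibbs_pressure_def)
qed

lemma measurable_empirical_pmf: "empirical V \<sigma> \<in> measure_pmf \<xi> \<rightarrow>\<^sub>M prob_algebra borel"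
  using empirical_prob_measures[of V \<sigma>]
  by (auto simp: measurable_def space_prob_algebra prob_measures_def)

lemma cylval_empirical_mean:
  fixes \<xi> :: "('v \<Rightarrow> 'a::finite discrete) pmf"
  shows "cylval (empirical_mean V \<sigma> \<xi> :: ('g::countable \<Rightarrow> _) measure) l = (\<integral>x. cylval (empirical V \<sigma> x) l \<partial>\<xi>)"
  using measure_bind_prob[OF prob_space_measure_pmf measurable_empirical_pmf[of V \<sigma> \<xi>] cyl_borel[of l]]
  by (simp add: cylval_def empirical_mean_def)

lemma empirical_mean_prob_measures:
  "empirical_mean V \<sigma> (\<xi> :: ('v \<Rightarrow> 'a::finite discrete) pmf) \<in> prob_measures"
  unfolding empirical_mean_def
  by (rule prob_measures_bind[OF prob_space_measure_pmf measurable_empirical_pmf])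

lemma gibbs_in_iff:
  fixes \<U> :: "('g \<Rightarrow> 'a::finite discrete) measure set"
  assumes "finite V"
  shows "gibbs_in V \<sigma> f \<U> \<O> \<longleftrightarrow>
    (\<exists>\<xi>. gibbs_state V \<sigma> f \<U> = Some \<xi> \<and> empirical_mean V \<sigma> \<xi> \<in> \<O>)"
  using gibbs_state_props(3)[OF assms, of \<sigma> f \<U>] good_models_subset[of V \<sigma> \<U>]
  by (auto simp: gibbs_in_def good_states_def split: option.splits)

section \<open>Expected partition functions of random maps, and pressure as tilted entropy\<close>

locale random_maps =
  fixes M :: "nat \<Rightarrow> 'w measure"
    and V :: "nat \<Rightarrow> 'v set"
    and \<sigma> :: "nat \<Rightarrow> 'w \<Rightarrow> 'g::{countable, group_add} \<Rightarrow> 'v \<Rightarrow> 'v"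
  assumes prob_M: "\<And>n. prob_space (M n)"
    and finite_V: "\<And>n. finite (V n)"
    and meas_\<sigma>: "\<And>n \<gamma> v. v \<in> V n \<Longrightarrow> (\<lambda>\<omega>. \<sigma> n \<omega> \<gamma> v) \<in> measurable (M n) (count_space (V n))"
    and card_V: "filterlim (\<lambda>n. card (V n)) at_top sequentially"
begin

lemma measurable_pullback:
  assumes "v \<in> V n"
  shows "(\<lambda>\<omega>. pullback_name (\<sigma> n \<omega>) (x :: 'v \<Rightarrow> 'a::finite discrete) v) \<in> M n \<rightarrow>\<^sub>M borel"
proof (rule measurable_coordinatewise_then_product)
  show "(\<lambda>\<omega>. pullback_name (\<sigma> n \<omega>) x v \<gamma>) \<in> borel_measurable (M n)" for \<gamma>
    unfolding pullback_name_def
    by (rule measurable_compose[OF meas_\<sigma>[OF assms], of x borel \<gamma>]) auto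
qed

lemma measurable_energy:
  fixes f :: "('g \<Rightarrow> 'a::finite discrete) \<Rightarrow> real"
  assumes "continuous_on UNIV f"
  shows "(\<lambda>\<omega>. energy (V n) (\<sigma> n \<omega>) f x) \<in> borel_measurable (M n)"
  unfolding energy_def
  by (intro borel_measurable_sum measurable_compose[OF measurable_pullback]
      borel_measurable_continuous_onI[OF assms])

lemma measurable_cylval_empirical:
  fixes l :: "('g \<times> 'a::finite discrete) list"
  assumes "V n \<noteq> {}"
  shows "(\<lambda>\<omega>. cylval (empirical (V n) (\<sigma> n \<omega>) x) l) \<in> borel_measurable (M n)"
proof -
  have "(\<lambda>\<omega>. indicator (cyl l) (pullback_name (\<sigma> n \<omega>) x v) :: real) \<in> borel_measurable (M n)"
    if "v \<in> V n" for v
    using measurable_compose[OF measurable_pullback[OF that] borel_measurable_indicator[OF cyl_borel[of l]]] .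
  then have "(\<lambda>\<omega>. (\<Sum>v\<in>V n. indicator (cyl l) (pullback_name (\<sigma> n \<omega>) x v)) / card (V n)) \<in> borel_measurable (M n)"
    by measurable
  moreover have "cylval (empirical (V n) (\<sigma> n \<omega>) x) l
      = (\<Sum>v\<in>V n. indicator (cyl l) (pullback_name (\<sigma> n \<omega>) x v)) / card (V n)" for \<omega>
    using energy_eq_empirical[OF finite_V assms continuous_indicator_cyl[of l], of "\<sigma> n \<omega>" x] assms finite_V[of n]
    by (simp add: cylval_eq_integral[OF empirical_prob_measures] energy_def)
  ultimately show ?thesis by simp
qed

lemma measurable_empirical:
  assumes "V n \<noteq> {}"
  shows "(\<lambda>\<omega>. empirical (V n) (\<sigma> n \<omega>) (x :: 'v \<Rightarrow> 'a::finite discrete)) \<in> M n \<rightarrow>\<^sub>M weak_borel prob_measures"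
  by (rule measurable_weak_borelI) (auto simp: empirical_prob_measures measurable_cylval_empirical[OF assms])

lemma sets_weak_borel_openin:
  assumes "openin weak_star \<O>"
  shows "\<O> \<in> sets (weak_borel prob_measures)"
proof -
  have "openin (subtopology weak_star prob_measures) \<O>"
    using assms openin_subset[OF assms] by (auto simp: openin_subtopology)
  then show ?thesis unfolding sets_weak_borel_eq by (intro sigma_sets.Basic) auto
qed

text \<open>The range of summation is random; an indicator moves the randomness into the summands
  over the fixed finite set of all labellings.\<close>

lemma measurable_sum_good:
  fixes h :: "'w \<Rightarrow> ('v \<Rightarrow> 'a::finite discrete) \<Rightarrow> real"
  assumes "V n \<noteq> {}" "openin weak_star \<O>" "\<And>x. (\<lambda>\<omega>. h \<omega> x) \<in> borel_measurable (M n)"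
  shows "(\<lambda>\<omega>. \<Sum>x\<in>good_models (V n) (\<sigma> n \<omega>) \<O>. h \<omega> x) \<in> borel_measurable (M n)"
proof -
  have "(\<Sum>x\<in>good_models (V n) (\<sigma> n \<omega>) \<O>. h \<omega> x)
      = (\<Sum>x\<in>V n \<rightarrow>\<^sub>E UNIV. indicator \<O> (empirical (V n) (\<sigma> n \<omega>) x) * h \<omega> x)" for \<omega>
    unfolding good_models_def
    by (intro sum.mono_neutral_cong_left finite_PiE_UNIV finite_V) auto
  moreover have "(\<lambda>\<omega>. indicator \<O> (empirical (V n) (\<sigma> n \<omega>) x) :: real) \<in> borel_measurable (M n)" for x
    using measurable_compose[OF measurable_empirical[OF assms(1)]
        borel_measurable_indicator[OF sets_weak_borel_openin[OF assms(2)]]] .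
  ultimately show ?thesis using assms(3) by simp
qed

lemma measurable_partition_sum:
  fixes f :: "('g \<Rightarrow> 'a::finite discrete) \<Rightarrow> real"
  assumes "V n \<noteq> {}" "openin weak_star \<O>" "continuous_on UNIV f"
  shows "(\<lambda>\<omega>. partition_sum (V n) (\<sigma> n \<omega>) f \<O>) \<in> borel_measurable (M n)"
  unfolding partition_sum_def
  using measurable_energy[OF assms(3)] by (intro measurable_sum_good assms) auto

text \<open>All labellings are counted and each weight is bounded separately. Being uniform in
  \<omega>, the bound gives integrability and controls the contribution of exceptional maps.\<close>

lemma partition_sum_le:
  fixes f :: "('g \<Rightarrow> 'a::finite discrete) \<Rightarrow> real"
  assumes "\<And>x. \<bar>f x\<bar> \<le> B"
  shows "partition_sum (V n) (\<sigma> n \<omega>) f \<O> \<le> exp ((ln CARD('a discrete) + B) * card (V n))"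
proof -
  have e: "exp (- energy (V n) (\<sigma> n \<omega>) f x) \<le> exp (B * card (V n))" for x
  proof -
    have "- energy (V n) (\<sigma> n \<omega>) f x \<le> (\<Sum>v\<in>V n. B)"
      unfolding energy_def sum_negf[symmetric]
      using assms by (intro sum_mono) (metis abs_le_D2)
    then show ?thesis by (simp add: mult.commute)
  qed
  have "partition_sum (V n) (\<sigma> n \<omega>) f \<O> \<le> (\<Sum>x\<in>V n \<rightarrow>\<^sub>E UNIV. exp (- energy (V n) (\<sigma> n \<omega>) f x))"
    unfolding partition_sum_def good_models_def
    by (intro sum_mono2 finite_PiE_UNIV finite_V) auto
  also have "\<dots> \<le> (\<Sum>x\<in>V n \<rightarrow>\<^sub>E (UNIV :: 'a discrete set). exp (B * card (V n)))"
    using e by (intro sum_mono)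
  also have "\<dots> = real (CARD('a discrete)) ^ card (V n) * exp (B * card (V n))"
    by (simp add: card_PiE finite_V)
  also have "\<dots> = exp (ln CARD('a discrete) * card (V n)) * exp (B * card (V n))"
    by (simp add: exp_of_nat_mult mult.commute[of _ "real (card (V n))"])
  finally show ?thesis by (simp add: exp_add[symmetric] algebra_simps)
qed

lemma integrable_partition_sum:
  fixes f :: "('g \<Rightarrow> 'a::finite discrete) \<Rightarrow> real"
  assumes "V n \<noteq> {}" "openin weak_star \<O>" "continuous_on UNIV f"
  shows "integrable (M n) (\<lambda>\<omega>. partition_sum (V n) (\<sigma> n \<omega>) f \<O>)"
proof -
  interpret prob_space "M n" by (rule prob_M)
  obtain B where B: "\<And>x. \<bar>f x\<bar> \<le> B" using continuous_bounded[OF assms(3)] by blast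
  show ?thesis
  proof (rule integrable_const_bound)
    show "AE \<omega> in M n. norm (partition_sum (V n) (\<sigma> n \<omega>) f \<O>) \<le> exp ((ln CARD('a discrete) + B) * card (V n))"
      using partition_sum_le[of f B, OF B] by (intro AE_I2) (simp add: abs_of_nonneg[OF partition_sum_nonneg])
  qed (rule measurable_partition_sum[OF assms])
qed

definition mean_sum :: "(('g \<Rightarrow> 'a::finite discrete) \<Rightarrow> real) \<Rightarrow> ('g \<Rightarrow> 'a discrete) measure set \<Rightarrow> nat \<Rightarrow> real" where
  "mean_sum f \<O> n = (\<integral>\<omega>. partition_sum (V n) (\<sigma> n \<omega>) f \<O> \<partial>M n)"

text \<open>Pressure in disguise (\<open>tilted_eq_entropy\<close>): weighting the models inside the
  infimum lets semicontinuity and covering arguments treat entropy and energy together.\<close>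

definition tilted :: "(('g \<Rightarrow> 'a::finite discrete) \<Rightarrow> real) \<Rightarrow> ('g \<Rightarrow> 'a discrete) measure \<Rightarrow> ereal" where
  "tilted f \<nu> = (INF \<O> \<in> {\<O>. openin weak_star \<O> \<and> \<nu> \<in> \<O>}. growth_rate V (mean_sum f \<O>))"

lemma eventually_V_nonempty: "\<forall>\<^sub>F n in sequentially. V n \<noteq> {}"
  using card_eventually_pos[OF card_V] by eventually_elim auto

lemma mean_sum_mono:
  fixes f :: "('g \<Rightarrow> 'a::finite discrete) \<Rightarrow> real"
  assumes "continuous_on UNIV f" "openin weak_star \<O>" "openin weak_star \<O>'" "\<O> \<subseteq> \<O>'"
  shows "growth_rate V (mean_sum f \<O>) \<le> growth_rate V (mean_sum f \<O>')"
proof (rule growth_rate_mono[OF card_V])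
  show "\<forall>\<^sub>F n in sequentially. mean_sum f \<O> n \<le> mean_sum f \<O>' n"
    using eventually_V_nonempty
  proof eventually_elim
    case (elim n)
    then show ?case
      unfolding mean_sum_def using assms
      by (intro integral_mono integrable_partition_sum partition_sum_mono finite_V) auto
  qed
qed

lemma sofic_entropy_eq_tilted: "sofic_entropy M V \<sigma> = tilted (\<lambda>x :: 'g \<Rightarrow> 'a::finite discrete. 0)"
  by (simp add: fun_eq_iff sofic_entropy_def tilted_def mean_sum_def[abs_def] partition_sum_0)

lemma tilted_le_growth: "openin weak_star \<O> \<Longrightarrow> \<nu> \<in> \<O> \<Longrightarrow> tilted f \<nu> \<le> growth_rate V (mean_sum f \<O>)"
  unfolding tilted_def by (intro INF_lower) auto

lemma openin_integral_less:
  fixes g :: "('x::topological_space) \<Rightarrow> real"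
  assumes "continuous_on UNIV g" "open S"
  shows "openin weak_star {\<nu> \<in> prob_measures. (\<integral>x. g x \<partial>\<nu>) \<in> S}"
  unfolding weak_star_def by (rule topology_generated_by_Basis) (use assms in blast)

text \<open>Near \<nu> the empirical integral of \<open>g - f\<close> is at most its value at \<nu>
  plus \<epsilon>, so passing from the weights of \<open>g\<close> to those of \<open>f\<close>
  costs a factor of that exponential rate. Taking the zero potential for \<open>f\<close> and then
  for \<open>g\<close> identifies \<open>tilted\<close> with entropy minus energy.\<close>

lemma tilted_le:
  fixes f g :: "('g \<Rightarrow> 'a::finite discrete) \<Rightarrow> real"
  assumes f: "continuous_on UNIV f" and g: "continuous_on UNIV g" and \<nu>: "\<nu> \<in> prob_measures"
  shows "tilted f \<nu> \<le> tilted g \<nu> + ereal ((\<integral>x. g x \<partial>\<nu>) - (\<integral>x. f x \<partial>\<nu>))"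
proof -
  define c where "c = (\<integral>x. g x \<partial>\<nu>) - (\<integral>x. f x \<partial>\<nu>)"
  have gf: "continuous_on UNIV (\<lambda>x. g x - f x)" using f g by (intro continuous_intros)
  have c: "(\<integral>x. g x - f x \<partial>\<nu>) = c"
    using continuous_integrable[OF f \<nu>] continuous_integrable[OF g \<nu>] by (simp add: c_def)
  have "tilted f \<nu> - ereal c \<le> growth_rate V (mean_sum g \<O>)" if O: "openin weak_star \<O>" "\<nu> \<in> \<O>" for \<O>
  proof (rule ereal_le_epsilon2)
    fix \<epsilon> :: real assume "\<epsilon> > 0"
    define \<O>' where "\<O>' = \<O> \<inter> {\<nu>' \<in> prob_measures. (\<integral>x. g x - f x \<partial>\<nu>') \<in> {..<c + \<epsilon>}}"
    have O': "openin weak_star \<O>'" "\<nu> \<in> \<O>'"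
      unfolding \<O>'_def using O openin_integral_less[OF gf, of "{..<c + \<epsilon>}"] \<nu> c \<open>\<epsilon> > 0\<close> by auto
    have "\<forall>\<^sub>F n in sequentially. mean_sum f \<O>' n \<le> mean_sum g \<O> n * exp ((c + \<epsilon>) * card (V n))"
      using eventually_V_nonempty
    proof eventually_elim
      case (elim n)
      have "partition_sum (V n) (\<sigma> n \<omega>) f \<O>' \<le> partition_sum (V n) (\<sigma> n \<omega>) g \<O> * exp ((c + \<epsilon>) * card (V n))" for \<omega>
      proof -
        have "partition_sum (V n) (\<sigma> n \<omega>) f \<O>'
            \<le> (\<Sum>x\<in>good_models (V n) (\<sigma> n \<omega>) \<O>'. exp (- energy (V n) (\<sigma> n \<omega>) g x) * exp ((c + \<epsilon>) * card (V n)))"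
          unfolding partition_sum_def
        proof (rule sum_mono)
          fix x assume "x \<in> good_models (V n) (\<sigma> n \<omega>) \<O>'"
          then have "(\<integral>y. g y - f y \<partial>empirical (V n) (\<sigma> n \<omega>) x) < c + \<epsilon>"
            by (auto simp: good_models_def \<O>'_def)
          then have "card (V n) * (\<integral>y. g y - f y \<partial>empirical (V n) (\<sigma> n \<omega>) x) \<le> card (V n) * (c + \<epsilon>)"
            by (intro mult_left_mono) auto
          moreover have "card (V n) * (\<integral>y. g y - f y \<partial>empirical (V n) (\<sigma> n \<omega>) x)
              = energy (V n) (\<sigma> n \<omega>) g x - energy (V n) (\<sigma> n \<omega>) f x"
            using energy_eq_empirical[OF finite_V elim gf, of "\<sigma> n \<omega>" x]
            by (simp add: energy_def sum_subtractf)
          ultimately show "exp (- energy (V n) (\<sigma> n \<omega>) f x)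
              \<le> exp (- energy (V n) (\<sigma> n \<omega>) g x) * exp ((c + \<epsilon>) * card (V n))"
            by (simp add: exp_add[symmetric] algebra_simps)
        qed
        also have "\<dots> = partition_sum (V n) (\<sigma> n \<omega>) g \<O>' * exp ((c + \<epsilon>) * card (V n))"
          by (simp add: partition_sum_def sum_distrib_right)
        also have "\<dots> \<le> partition_sum (V n) (\<sigma> n \<omega>) g \<O> * exp ((c + \<epsilon>) * card (V n))"
          by (intro mult_right_mono partition_sum_mono finite_V) (auto simp: \<O>'_def)
        finally show ?thesis .
      qed
      then have "mean_sum f \<O>' n \<le> (\<integral>\<omega>. partition_sum (V n) (\<sigma> n \<omega>) g \<O> * exp ((c + \<epsilon>) * card (V n)) \<partial>M n)"
        unfolding mean_sum_def using f g O O' elim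
        by (intro integral_mono integrable_partition_sum integrable_mult_left) auto
      then show ?case by (simp add: mean_sum_def)
    qed
    then have "growth_rate V (mean_sum f \<O>') \<le> growth_rate V (\<lambda>n. mean_sum g \<O> n * exp ((c + \<epsilon>) * card (V n)))"
      by (rule growth_rate_mono[OF card_V])
    also have "\<dots> \<le> growth_rate V (mean_sum g \<O>) + ereal (c + \<epsilon>)"
      by (rule growth_rate_mult_exp[OF card_V])
    finally have "tilted f \<nu> \<le> growth_rate V (mean_sum g \<O>) + ereal (c + \<epsilon>)"
      using tilted_le_growth[OF O'] by (rule order_trans[rotated])
    then show "tilted f \<nu> - ereal c \<le> growth_rate V (mean_sum g \<O>) + ereal \<epsilon>"
      by (simp add: ereal_minus_le add.assoc) (simp add: add.commute)
  qed
  then have "tilted f \<nu> - ereal c \<le> tilted g \<nu>"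
    unfolding tilted_def[of g] by (intro INF_greatest) auto
  then show ?thesis by (simp add: ereal_minus_le c_def)
qed

lemma tilted_eq_entropy:
  fixes f :: "('g \<Rightarrow> 'a::finite discrete) \<Rightarrow> real"
  assumes f: "continuous_on UNIV f" and \<nu>: "\<nu> \<in> prob_measures"
  shows "tilted f \<nu> = sofic_entropy M V \<sigma> \<nu> - ereal (\<integral>x. f x \<partial>\<nu>)"
proof (rule antisym)
  have 0: "continuous_on UNIV (\<lambda>x :: 'g \<Rightarrow> 'a discrete. 0 :: real)" by simp
  show "tilted f \<nu> \<le> sofic_entropy M V \<sigma> \<nu> - ereal (\<integral>x. f x \<partial>\<nu>)"
    using tilted_le[OF f 0 \<nu>] by (simp add: sofic_entropy_eq_tilted minus_ereal_def)
  show "sofic_entropy M V \<sigma> \<nu> - ereal (\<integral>x. f x \<partial>\<nu>) \<le> tilted f \<nu>"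
    using tilted_le[OF 0 f \<nu>] by (simp add: sofic_entropy_eq_tilted ereal_minus_le)
qed

lemma growth_less_of_tilted_less:
  fixes f :: "('g \<Rightarrow> 'a::finite discrete) \<Rightarrow> real"
  assumes "tilted f \<nu> < x"
  obtains \<O> where "openin weak_star \<O>" "\<nu> \<in> \<O>" "growth_rate V (mean_sum f \<O>) < x"
  using assms unfolding tilted_def INF_less_iff by auto

text \<open>Upper semicontinuity: a neighbourhood that brings the infimum at \<nu> below
  \<open>x\<close> does so at each of its points.\<close>

lemma openin_tilted_less:
  fixes f :: "('g \<Rightarrow> 'a::finite discrete) \<Rightarrow> real"
  shows "openin weak_star {\<nu> \<in> prob_measures. tilted f \<nu> < x}"
proof (subst openin_subopen, intro ballI)
  fix \<nu> assume "\<nu> \<in> {\<nu> \<in> prob_measures. tilted f \<nu> < x}"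
  then have "tilted f \<nu> < x" by simp
  then obtain \<O> where O: "openin weak_star \<O>" "\<nu> \<in> \<O>" "growth_rate V (mean_sum f \<O>) < x"
    by (rule growth_less_of_tilted_less)
  have "\<O> \<subseteq> {\<nu> \<in> prob_measures. tilted f \<nu> < x}"
  proof
    fix \<nu>' assume "\<nu>' \<in> \<O>"
    with tilted_le_growth[OF O(1) this, of f] O(3) openin_subset[OF O(1)]
    show "\<nu>' \<in> {\<nu> \<in> prob_measures. tilted f \<nu> < x}" by auto
  qed
  with O show "\<exists>T. openin weak_star T \<and> \<nu> \<in> T \<and> T \<subseteq> {\<nu> \<in> prob_measures. tilted f \<nu> < x}" by blast
qed

text \<open>Pointwise bounds become uniform: finitely many of the witnessing neighbourhoods cover
  \<open>C\<close>, and the partition function of their union is at most the sum of theirs. The real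
  \<open>r\<close> records a definite gap below \<open>x\<close>.\<close>

lemma growth_compact_less:
  fixes f :: "('g \<Rightarrow> 'a::finite discrete) \<Rightarrow> real"
  assumes f: "continuous_on UNIV f" and C: "compactin weak_star C" and x: "x \<noteq> -\<infinity>"
    and less: "\<And>\<nu>. \<nu> \<in> C \<Longrightarrow> tilted f \<nu> < x"
  obtains r W where "ereal r < x" "openin weak_star W" "C \<subseteq> W" "growth_rate V (mean_sum f W) < ereal r"
proof -
  have "\<exists>r \<O>. ereal r < x \<and> openin weak_star \<O> \<and> \<nu> \<in> \<O> \<and> growth_rate V (mean_sum f \<O>) < ereal r"
    if \<nu>: "\<nu> \<in> C" for \<nu>
  proof -
    from ereal_dense2[OF less[OF \<nu>]] obtain r where r: "tilted f \<nu> < ereal r" "ereal r < x" by blast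
    then show ?thesis using growth_less_of_tilted_less[OF r(1)] by blast
  qed
  then obtain r \<O> where rO: "\<And>\<nu>. \<nu> \<in> C \<Longrightarrow> ereal (r \<nu>) < x" "\<And>\<nu>. \<nu> \<in> C \<Longrightarrow> openin weak_star (\<O> \<nu>)"
    "\<And>\<nu>. \<nu> \<in> C \<Longrightarrow> \<nu> \<in> \<O> \<nu>" "\<And>\<nu>. \<nu> \<in> C \<Longrightarrow> growth_rate V (mean_sum f (\<O> \<nu>)) < ereal (r \<nu>)"
    by metis
  have "Ball (\<O> ` C) (openin weak_star) \<and> C \<subseteq> \<Union> (\<O> ` C)" using rO(2,3) by auto
  then obtain \<F> where \<F>: "finite \<F>" "\<F> \<subseteq> \<O> ` C" "C \<subseteq> \<Union>\<F>"
    using C unfolding compactin_def by meson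
  obtain I where I: "I \<subseteq> C" "finite I" "\<F> = \<O> ` I" using finite_subset_image[OF \<F>(1,2)] by blast
  \<comment> \<open>A bound for the case that \<open>C\<close>, and with it the finite cover, is
    empty; it keeps the set under \<open>Max\<close> nonempty.\<close>
  obtain r0 where r0: "ereal r0 < x" using x using ereal_dense2[of "-\<infinity>" x] by auto
  define s where "s = Max (insert r0 (r ` I))"
  have "s \<in> insert r0 (r ` I)" unfolding s_def by (rule Max_in) (use I in auto)
  then have sx: "ereal s < x" using r0 rO(1) I by auto
  have le: "r i \<le> s" if "i \<in> I" for i unfolding s_def using that I by (intro Max_ge) auto
  define W where "W = (\<Union>i\<in>I. \<O> i)"
  have oI: "openin weak_star (\<O> i)" if "i \<in> I" for i using that I(1) rO(2) by blast
  have oW: "openin weak_star W" unfolding W_def using oI by (intro openin_Union) auto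
  have "growth_rate V (\<lambda>n. \<Sum>i\<in>I. mean_sum f (\<O> i) n) < ereal s"
    using rO(4) le I by (intro growth_rate_sum_less[OF card_V]) (fastforce intro: less_le_trans)+
  moreover have "growth_rate V (mean_sum f W) \<le> growth_rate V (\<lambda>n. \<Sum>i\<in>I. mean_sum f (\<O> i) n)"
  proof (rule growth_rate_mono[OF card_V])
    show "\<forall>\<^sub>F n in sequentially. mean_sum f W n \<le> (\<Sum>i\<in>I. mean_sum f (\<O> i) n)"
      using eventually_V_nonempty
    proof eventually_elim
      case (elim n)
      have int: "integrable (M n) (\<lambda>\<omega>. partition_sum (V n) (\<sigma> n \<omega>) f (\<O> i))" if "i \<in> I" for i
        using integrable_partition_sum[OF elim oI[OF that] f] .
      have intW: "integrable (M n) (\<lambda>\<omega>. partition_sum (V n) (\<sigma> n \<omega>) f (\<Union>i\<in>I. \<O> i))"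
        using integrable_partition_sum[OF elim oW f] by (simp add: W_def)
      have "mean_sum f W n \<le> (\<integral>\<omega>. (\<Sum>i\<in>I. partition_sum (V n) (\<sigma> n \<omega>) f (\<O> i)) \<partial>M n)"
        unfolding mean_sum_def W_def
        using int I(2) intW
        by (intro integral_mono Bochner_Integration.integrable_sum partition_sum_UN finite_V) auto
      also have "\<dots> = (\<Sum>i\<in>I. mean_sum f (\<O> i) n)"
        unfolding mean_sum_def using int by (simp add: Bochner_Integration.integral_sum)
      finally show ?case .
    qed
  qed
  ultimately show ?thesis
    using that[OF sx oW] \<F>(3) I(3) by (auto simp: W_def)
qed

text \<open>If the supremum were not attained, every value would lie strictly below it, and
  compactness would give a common bound strictly below it.\<close>

lemma tilted_attains_max:
  fixes f :: "('g \<Rightarrow> 'a::finite discrete) \<Rightarrow> real"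
  assumes f: "continuous_on UNIV f" and K: "compactin weak_star K" "K \<noteq> {}"
  obtains \<nu> where "\<nu> \<in> K" "\<And>\<nu>'. \<nu>' \<in> K \<Longrightarrow> tilted f \<nu>' \<le> tilted f \<nu>"
proof -
  have "\<exists>\<nu>\<in>K. \<forall>\<nu>'\<in>K. tilted f \<nu>' \<le> tilted f \<nu>"
  proof (rule ccontr)
    assume *: "\<not> (\<exists>\<nu>\<in>K. \<forall>\<nu>'\<in>K. tilted f \<nu>' \<le> tilted f \<nu>)"
    define s where "s = (SUP \<nu>\<in>K. tilted f \<nu>)"
    have less: "tilted f \<nu> < s" if "\<nu> \<in> K" for \<nu>
    proof -
      obtain \<nu>' where "\<nu>' \<in> K" "tilted f \<nu> < tilted f \<nu>'" using * \<open>\<nu> \<in> K\<close> by fastforce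
      then show ?thesis unfolding s_def by (simp add: less_SUP_iff) blast
    qed
    have "s \<noteq> -\<infinity>" using less K(2) by force
    from growth_compact_less[OF f K(1) this less]
    obtain r W where W: "ereal r < s" "openin weak_star W" "K \<subseteq> W" "growth_rate V (mean_sum f W) < ereal r" .
    have "tilted f \<nu> \<le> ereal r" if "\<nu> \<in> K" for \<nu>
      using tilted_le_growth[OF W(2), of \<nu> f] W(3,4) that by (auto intro: order_trans less_imp_le)
    then have "s \<le> ereal r" unfolding s_def by (rule SUP_least)
    with W(1) show False by simp
  qed
  then show ?thesis using that by blast
qed

end

section \<open>Equilibrium measures as limits of Gibbs states\<close>

lemma continuous_on_shift: "continuous_on UNIV (shift g :: ('g::group_add \<Rightarrow> 'a::topological_space) \<Rightarrow> _)"
  unfolding shift_def by (intro continuous_on_coordinatewise_then_product continuous_on_product_coordinates)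

lemma shift_measurable [measurable]:
  "(shift g :: ('g::{countable, group_add} \<Rightarrow> 'a::finite discrete) \<Rightarrow> _) \<in> borel \<rightarrow>\<^sub>M borel"
  by (rule borel_measurable_continuous_onI[OF continuous_on_shift])

lemma shift_vimage_cyl: "shift g -` cyl l = cyl (map (\<lambda>(i, a). (i + g, a)) l)"
  by (simp add: cyl_def shift_def vimage_def case_prod_beta)

lemma shift_measurable_prob:
  fixes \<nu> :: "('g::{countable, group_add} \<Rightarrow> 'a::finite discrete) measure"
  assumes "\<nu> \<in> prob_measures"
  shows "shift g \<in> \<nu> \<rightarrow>\<^sub>M borel"
  using shift_measurable[of g] measurable_cong_sets[OF prob_measuresD(2)[OF assms] refl] by blast

lemma cylval_distr_shift:
  fixes \<nu> :: "('g::{countable, group_add} \<Rightarrow> 'a::finite discrete) measure"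
  assumes "\<nu> \<in> prob_measures"
  shows "cylval (distr \<nu> borel (shift g)) l = cylval \<nu> (map (\<lambda>(i, a). (i + g, a)) l)"
  using shift_measurable_prob[OF assms, of g] prob_measuresD(3)[OF assms]
  by (simp add: cylval_def measure_distr shift_vimage_cyl)

lemma distr_shift_prob_measures:
  fixes \<nu> :: "('g::{countable, group_add} \<Rightarrow> 'a::finite discrete) measure"
  assumes "\<nu> \<in> prob_measures"
  shows "distr \<nu> borel (shift g) \<in> prob_measures"
  using prob_space.prob_space_distr[OF prob_measuresD(1)[OF assms] shift_measurable_prob[OF assms]]
  by (simp add: prob_measures_def)

lemma invariant_iff_cylval:
  fixes \<nu> :: "('g::{countable, group_add} \<Rightarrow> 'a::finite discrete) measure"
  assumes "\<nu> \<in> prob_measures"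
  shows "distr \<nu> borel (shift g) = \<nu> \<longleftrightarrow> (\<forall>l. cylval \<nu> (map (\<lambda>(i, a). (i + g, a)) l) = cylval \<nu> l)"
  using assms by (metis cylval_distr_shift distr_shift_prob_measures prob_measures_eqI)

text \<open>The open complement is a countable union of cylinders, so it is null exactly when each
  of them is.\<close>

lemma full_measure_iff_cylval:
  fixes \<nu> :: "('i::countable \<Rightarrow> 'b::finite discrete) measure"
  assumes "closed X" and \<nu>: "\<nu> \<in> prob_measures"
  shows "measure \<nu> X = 1 \<longleftrightarrow> (\<forall>l. cyl l \<subseteq> - X \<longrightarrow> cylval \<nu> l = 0)"
proof -
  interpret prob_space \<nu> using \<nu> prob_measuresD by blast
  have [simp]: "sets \<nu> = sets borel" "space \<nu> = UNIV" using \<nu> prob_measuresD by blast+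
  have X: "X \<in> sets \<nu>" using assms by simp
  then have "measure \<nu> X = 1 \<longleftrightarrow> measure \<nu> (- X) = 0"
    using prob_compl[OF X] by (simp add: Compl_eq_Diff_UNIV)
  also have "\<dots> \<longleftrightarrow> (\<forall>l. cyl l \<subseteq> - X \<longrightarrow> cylval \<nu> l = 0)"
  proof
    assume "measure \<nu> (- X) = 0"
    then show "\<forall>l. cyl l \<subseteq> - X \<longrightarrow> cylval \<nu> l = 0"
      using finite_measure_mono[of _ "- X"] X
      by (metis cylval_def measure_le_0_iff sets.compl_sets Compl_eq_Diff_UNIV \<open>space \<nu> = UNIV\<close>)
  next
    assume *: "\<forall>l. cyl l \<subseteq> - X \<longrightarrow> cylval \<nu> l = 0"
    have "(\<Union>l\<in>{l. cyl l \<subseteq> - X}. cyl l) \<in> null_sets \<nu>"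
      using * by (intro null_sets_UN') (auto simp: null_sets_def emeasure_eq_measure cylval_def)
    moreover have "- X = (\<Union>l\<in>{l. cyl l \<subseteq> - X}. cyl l)"
      using assms by (intro open_eq_Union_cyl) auto
    ultimately show "measure \<nu> (- X) = 0"
      by (metis measure_eq_0_null_sets)
  qed
  finally show ?thesis .
qed

text \<open>Invariance is a family of equations between coordinates, and full mass on
  \<open>X\<close> is the vanishing of some coordinates; both define closed sets in the
  product.\<close>

lemma closed_inv_measures:
  fixes X :: "('g::{countable, group_add} \<Rightarrow> 'a::finite discrete) set"
  assumes X: "closed X"
  obtains C where "closed C" "inv_measures X = prob_measures \<inter> cylval -` C"
proof
  have c: "continuous_on UNIV (\<lambda>t. t l)" for l :: "('g \<times> 'a discrete) list"
    by (rule continuous_on_product_coordinates)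
  define C where "C = (\<Inter>g l. {t. t (map (\<lambda>(i, a). (i + g, a)) l) = t l}) \<inter>
    (\<Inter>l\<in>{l :: ('g \<times> 'a discrete) list. cyl l \<subseteq> - X}. {t. t l = (0::real)})"
  show "closed C"
    unfolding C_def by (intro closed_Int closed_INT ballI closed_Collect_eq c continuous_on_const)
  show "inv_measures X = prob_measures \<inter> cylval -` C"
    by (auto simp: inv_measures_def C_def invariant_iff_cylval full_measure_iff_cylval[OF X])
qed

text \<open>Intersections make the neighbourhoods a filter base, and \<open>prob_measures\<close> is
  one of them, so the infimum of principal filters can be read off a single neighbourhood.\<close>

lemma eventually_open_nbhds:
  assumes "K \<subseteq> prob_measures"
  shows "eventually P (open_nbhds K) \<longleftrightarrow>
    (\<exists>\<U>. openin weak_star \<U> \<and> K \<subseteq> \<U> \<and> (\<forall>\<U>'. openin weak_star \<U>' \<longrightarrow> K \<subseteq> \<U>' \<longrightarrow> \<U>' \<subseteq> \<U> \<longrightarrow> P \<U>'))"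
proof -
  show ?thesis
    unfolding open_nbhds_def
  proof (subst eventually_INF_base)
    show "{\<U>. openin weak_star \<U> \<and> K \<subseteq> \<U>} \<noteq> {}" using assms openin_prob_measures by blast
    fix a b assume "a \<in> {\<U>. openin weak_star \<U> \<and> K \<subseteq> \<U>}" "b \<in> {\<U>. openin weak_star \<U> \<and> K \<subseteq> \<U>}"
    then show "\<exists>x\<in>{\<U>. openin weak_star \<U> \<and> K \<subseteq> \<U>}.
        principal {\<U>'. openin weak_star \<U>' \<and> K \<subseteq> \<U>' \<and> \<U>' \<subseteq> x}
        \<le> inf (principal {\<U>'. openin weak_star \<U>' \<and> K \<subseteq> \<U>' \<and> \<U>' \<subseteq> a})
              (principal {\<U>'. openin weak_star \<U>' \<and> K \<subseteq> \<U>' \<and> \<U>' \<subseteq> b})"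
      by (intro bexI[of _ "a \<inter> b"]) (auto simp: principal_le_iff)
  qed (auto simp: eventually_principal)
qed

section \<open>Maximal pressure and concentration of Gibbs states under a local weak limit\<close>

locale lwlim_maps = random_maps M V \<sigma>
  for M :: "nat \<Rightarrow> 'w measure" and V :: "nat \<Rightarrow> 'v set"
    and \<sigma> :: "nat \<Rightarrow> 'w \<Rightarrow> 'g::{countable, group_add} \<Rightarrow> 'v \<Rightarrow> 'v" +
  fixes X :: "('g \<Rightarrow> 'a::finite discrete) set"
    and f :: "('g \<Rightarrow> 'a discrete) \<Rightarrow> real"
    and \<mu> :: "('g \<Rightarrow> 'a discrete) measure"
  assumes closed_X: "closed X"
    and cont_f: "continuous_on UNIV f"
    and lwlim: "lwlim M V \<sigma> X f \<mu>"
begin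

abbreviation "K \<equiv> inv_measures X"

lemma mu_prob: "\<mu> \<in> prob_measures"
  using lwlim by (simp add: lwlim_def)

lemma K_prob: "K \<subseteq> prob_measures"
  by (auto simp: inv_measures_def)

lemma compactin_K: "compactin weak_star K"
  using closed_inv_measures[OF closed_X] compactin_weak_star by metis

definition bad_prob where
  "bad_prob \<U> \<O> n = measure (M n) {\<omega> \<in> space (M n). \<not> gibbs_in (V n) (\<sigma> n \<omega>) f \<U> \<O>}"

lemma bad_prob_growth:
  fixes c :: real
  assumes "openin weak_star \<O>" "\<mu> \<in> \<O>"
  shows "\<exists>\<U>. openin weak_star \<U> \<and> K \<subseteq> \<U> \<and>
    (\<forall>\<U>'. openin weak_star \<U>' \<longrightarrow> K \<subseteq> \<U>' \<longrightarrow> \<U>' \<subseteq> \<U> \<longrightarrow> growth_rate V (bad_prob \<U>' \<O>) < ereal c)"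
proof -
  have "Limsup (open_nbhds K) (\<lambda>\<U>. growth_rate V (bad_prob \<U> \<O>)) = -\<infinity>"
    using lwlim assms unfolding lwlim_def bad_prob_def by blast
  then have "Limsup (open_nbhds K) (\<lambda>\<U>. growth_rate V (bad_prob \<U> \<O>)) < ereal c" by simp
  from Limsup_lessD[OF this] show ?thesis
    unfolding eventually_open_nbhds[OF K_prob] .
qed

text \<open>Otherwise the empty set is an admissible neighbourhood. It carries no Gibbs state, so by
  the convention on undefined states failure would have probability one.\<close>

lemma K_nonempty: "K \<noteq> {}"
proof
  assume K: "K = {}"
  from bad_prob_growth[OF openin_prob_measures mu_prob, of "-1"]
  have "growth_rate V (bad_prob {} prob_measures) < ereal (-1)" unfolding K by auto
  from growth_rate_lessD[OF card_V this] card_eventually_pos[OF card_V]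
  have "\<forall>\<^sub>F n in sequentially. False"
  proof eventually_elim
    case (elim n)
    interpret prob_space "M n" by (rule prob_M)
    have "bad_prob {} prob_measures n = 1"
      by (simp add: bad_prob_def gibbs_in_def gibbs_state_def good_models_def prob_space)
    moreover have "exp (- 1 * real (card (V n))) \<le> 1" by simp
    ultimately show ?case using elim by linarith
  qed
  then show False by simp
qed

text \<open>The event depends on the Gibbs state through its mean empirical measure, whose
  coordinates are quotients of measurable sums.\<close>

lemma measurable_gibbs_in:
  assumes "V n \<noteq> {}" "openin weak_star \<U>" "openin weak_star \<O>"
  shows "{\<omega> \<in> space (M n). \<not> gibbs_in (V n) (\<sigma> n \<omega>) f \<U> \<O>} \<in> sets (M n)"
proof -
  define Z where "Z \<omega> = partition_sum (V n) (\<sigma> n \<omega>) f \<U>" for \<omega>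
  \<comment> \<open>The default \<mu> makes \<open>G\<close> total; maps without a Gibbs state are
    recognised by \<open>Z \<omega> = 0\<close> and added to the bad event separately.\<close>
  define G where "G \<omega> = (case gibbs_state (V n) (\<sigma> n \<omega>) f \<U> of None \<Rightarrow> \<mu>
      | Some \<xi> \<Rightarrow> empirical_mean (V n) (\<sigma> n \<omega>) \<xi>)" for \<omega>
  have Z [measurable]: "Z \<in> borel_measurable (M n)"
    unfolding Z_def using measurable_partition_sum[OF assms(1,2) cont_f] .
  have Z0: "Z \<omega> = 0 \<longleftrightarrow> gibbs_state (V n) (\<sigma> n \<omega>) f \<U> = None" for \<omega>
  proof (cases "good_models (V n) (\<sigma> n \<omega>) \<U> = {}")
    case True
    then show ?thesis by (simp add: Z_def gibbs_state_None_iff partition_sum_def)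
  next
    case False
    with partition_sum_pos[OF finite_V this, of f] show ?thesis by (simp add: Z_def gibbs_state_None_iff)
  qed
  have cG: "cylval (G \<omega>) l = (if Z \<omega> = 0 then cylval \<mu> l else
      (\<Sum>x\<in>good_models (V n) (\<sigma> n \<omega>) \<U>. exp (- energy (V n) (\<sigma> n \<omega>) f x) * cylval (empirical (V n) (\<sigma> n \<omega>) x) l) / Z \<omega>)" for \<omega> l
  proof (cases "gibbs_state (V n) (\<sigma> n \<omega>) f \<U>")
    case None
    then show ?thesis using Z0[of \<omega>] by (simp add: G_def)
  next
    case (Some \<xi>)
    note \<xi> = gibbs_state_props[OF finite_V Some]
    have "cylval (G \<omega>) l = (\<integral>x. cylval (empirical (V n) (\<sigma> n \<omega>) x) l \<partial>\<xi>)"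
      by (simp add: G_def Some cylval_empirical_mean)
    also have "\<dots> = (\<Sum>x\<in>good_models (V n) (\<sigma> n \<omega>) \<U>. cylval (empirical (V n) (\<sigma> n \<omega>) x) l * pmf \<xi> x)"
      using \<xi>(3) by (intro integral_measure_pmf_real finite_good_models finite_V) auto
    also have "\<dots> = (\<Sum>x\<in>good_models (V n) (\<sigma> n \<omega>) \<U>. exp (- energy (V n) (\<sigma> n \<omega>) f x) * cylval (empirical (V n) (\<sigma> n \<omega>) x) l) / Z \<omega>"
      by (simp add: \<xi>(2) Z_def sum_divide_distrib mult.commute)
    finally show ?thesis using Z0[of \<omega>] Some by simp
  qed
  have "(\<lambda>\<omega>. cylval (G \<omega>) l) \<in> borel_measurable (M n)" for l
  proof -
    have [measurable]: "(\<lambda>\<omega>. \<Sum>x\<in>good_models (V n) (\<sigma> n \<omega>) \<U>. exp (- energy (V n) (\<sigma> n \<omega>) f x) *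
        cylval (empirical (V n) (\<sigma> n \<omega>) x) l) \<in> borel_measurable (M n)"
      using measurable_energy[OF cont_f] measurable_cylval_empirical[OF assms(1)]
      by (intro measurable_sum_good assms borel_measurable_times) auto
    show ?thesis unfolding cG by measurable
  qed
  then have Gm: "G \<in> M n \<rightarrow>\<^sub>M weak_borel prob_measures"
    by (intro measurable_weak_borelI) (auto simp: G_def mu_prob empirical_mean_prob_measures split: option.split)
  have "{\<omega> \<in> space (M n). \<not> gibbs_in (V n) (\<sigma> n \<omega>) f \<U> \<O>}
      = {\<omega> \<in> space (M n). Z \<omega> = 0} \<union> (space (M n) - (G -` \<O> \<inter> space (M n)))"
    using Z0 by (auto simp: gibbs_in_iff[OF finite_V] G_def split: option.splits)
  also have "\<dots> \<in> sets (M n)"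
    using measurable_sets[OF Gm sets_weak_borel_openin[OF assms(3)]] by measurable
  finally show ?thesis .
qed

definition max_pressure :: ereal where
  "max_pressure = (SUP \<nu>\<in>K. tilted f \<nu>)"

definition maximizers :: "('g \<Rightarrow> 'a discrete) measure set" where
  "maximizers = {\<nu> \<in> K. tilted f \<nu> = max_pressure}"

lemma tilted_le_max: "\<nu> \<in> K \<Longrightarrow> tilted f \<nu> \<le> max_pressure"
  unfolding max_pressure_def by (rule SUP_upper)

lemma maximizers_nonempty: "maximizers \<noteq> {}"
proof -
  obtain \<nu> where \<nu>: "\<nu> \<in> K" "\<And>\<nu>'. \<nu>' \<in> K \<Longrightarrow> tilted f \<nu>' \<le> tilted f \<nu>"
    using tilted_attains_max[OF cont_f compactin_K K_nonempty] by blast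
  then have "max_pressure = tilted f \<nu>"
    unfolding max_pressure_def by (intro antisym SUP_least SUP_upper) auto
  with \<nu> show ?thesis by (auto simp: maximizers_def)
qed

lemma max_pressure_le_growth:
  assumes "openin weak_star \<U>" "K \<subseteq> \<U>"
  shows "max_pressure \<le> growth_rate V (mean_sum f \<U>)"
  unfolding max_pressure_def using tilted_le_growth[OF assms(1)] assms(2) by (intro SUP_least) auto

text \<open>Each neighbourhood of \<open>K\<close> is a neighbourhood of each of its points, which
  gives the lower bound. For the upper bound one neighbourhood from a finite cover suffices, and
  smaller ones inherit it by monotonicity.\<close>

lemma max_pressure_tendsto:
  "((\<lambda>\<U>. growth_rate V (mean_sum f \<U>)) \<longlongrightarrow> max_pressure) (open_nbhds K)"
proof (rule order_tendstoI)
  fix x assume "x < max_pressure"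
  then show "\<forall>\<^sub>F \<U> in open_nbhds K. x < growth_rate V (mean_sum f \<U>)"
    unfolding eventually_open_nbhds[OF K_prob]
    using max_pressure_le_growth K_prob openin_prob_measures
    by (intro exI[of _ prob_measures]) (auto intro: less_le_trans)
next
  fix x assume x: "max_pressure < x"
  have "tilted f \<nu> < x" if "\<nu> \<in> K" for \<nu>
    using tilted_le_max[OF that] x by (rule le_less_trans)
  moreover have "x \<noteq> -\<infinity>" using x by auto
  ultimately obtain r W where W: "ereal r < x" "openin weak_star W" "K \<subseteq> W" "growth_rate V (mean_sum f W) < ereal r"
    using growth_compact_less[OF cont_f compactin_K] by metis
  show "\<forall>\<^sub>F \<U> in open_nbhds K. growth_rate V (mean_sum f \<U>) < x"
    unfolding eventually_open_nbhds[OF K_prob]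
  proof (intro exI[of _ W] conjI allI impI)
    fix \<U> assume "openin weak_star \<U>" "\<U> \<subseteq> W"
    from mean_sum_mono[OF cont_f this(1) W(2) this(2)] W(1,4)
    show "growth_rate V (mean_sum f \<U>) < x" by (meson le_less_trans less_trans)
  qed (use W in auto)
qed

lemma max_pressure_less_PInf: "max_pressure < \<infinity>"
proof -
  obtain B where B: "\<And>x. \<bar>f x\<bar> \<le> B" using continuous_bounded[OF cont_f] by blast
  have "growth_rate V (mean_sum f prob_measures) \<le> ereal (ln CARD('a discrete) + B)"
  proof (rule growth_rate_leI[OF card_V])
    show "\<forall>\<^sub>F n in sequentially. mean_sum f prob_measures n \<le> exp ((ln CARD('a discrete) + B) * card (V n))"
      using eventually_V_nonempty
    proof eventually_elim
      case (elim n)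
      interpret prob_space "M n" by (rule prob_M)
      have "mean_sum f prob_measures n \<le> (\<integral>\<omega>. exp ((ln CARD('a discrete) + B) * card (V n)) \<partial>M n)"
        unfolding mean_sum_def
        using partition_sum_le[of f B, OF B] openin_prob_measures
        by (intro integral_mono integrable_partition_sum[OF elim] cont_f) auto
      then show ?case by (simp add: prob_space)
    qed
  qed
  moreover have "max_pressure \<le> growth_rate V (mean_sum f prob_measures)"
    by (rule max_pressure_le_growth[OF openin_prob_measures K_prob])
  ultimately show ?thesis using le_less_trans by fastforce
qed

text \<open>Were the maximum minus infinity, expected partition functions near \<open>K\<close>
  would decay at any prescribed rate. Yet with probability at least 1/2 a Gibbs state exists, hence
  at least one model, and its weight is at least exp (- B |V n|).\<close>

lemma max_pressure_greater_MInf: "-\<infinity> < max_pressure"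
proof (rule ccontr)
  assume "\<not> -\<infinity> < max_pressure"
  then have m: "max_pressure = -\<infinity>" by simp
  obtain B where B: "0 < B" "\<And>x. \<bar>f x\<bar> \<le> B" using continuous_bounded[OF cont_f] by blast
  from bad_prob_growth[OF openin_prob_measures mu_prob, of "-1"] obtain \<U>0 where U0: "openin weak_star \<U>0" "K \<subseteq> \<U>0"
    "\<And>\<U>'. openin weak_star \<U>' \<Longrightarrow> K \<subseteq> \<U>' \<Longrightarrow> \<U>' \<subseteq> \<U>0 \<Longrightarrow> growth_rate V (bad_prob \<U>' prob_measures) < ereal (-1)"
    by auto
  \<comment> \<open>The rate -B accounts for the weight of a single model, and the extra -1 beats
    the factor 1/2 lost to maps without a Gibbs state.\<close>
  have "tilted f \<nu> < ereal (- B - 1)" if "\<nu> \<in> K" for \<nu>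
    using tilted_le_max[OF that] m by simp
  then obtain r W where W: "ereal r < ereal (- B - 1)" "openin weak_star W" "K \<subseteq> W" "growth_rate V (mean_sum f W) < ereal r"
    using growth_compact_less[OF cont_f compactin_K, of "ereal (- B - 1)"] by (metis MInfty_neq_ereal(1))
  define \<U> where "\<U> = W \<inter> \<U>0"
  have U: "openin weak_star \<U>" "K \<subseteq> \<U>" "\<U> \<subseteq> \<U>0" "\<U> \<subseteq> W" unfolding \<U>_def using U0 W by auto
  have "growth_rate V (mean_sum f \<U>) < ereal r"
    using mean_sum_mono[OF cont_f U(1) W(2) U(4)] W(4) by (rule le_less_trans)
  from growth_rate_lessD[OF card_V this] growth_rate_lessD[OF card_V U0(3)[OF U(1-3)]]
    eventually_V_nonempty card_eventually_ge[OF card_V, of 1]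
  have "\<forall>\<^sub>F n in sequentially. False"
  proof eventually_elim
    case (elim n)
    interpret prob_space "M n" by (rule prob_M)
    let ?N = "real (card (V n))"
    let ?bad = "{\<omega> \<in> space (M n). \<not> gibbs_in (V n) (\<sigma> n \<omega>) f \<U> prob_measures}"
    have bad: "?bad \<in> events" by (rule measurable_gibbs_in[OF elim(3) U(1) openin_prob_measures])
    have "exp (- 1 * ?N) \<le> exp (- 1)" using elim(4) by simp
    also have "\<dots> \<le> 1 / (2::real)"
      using exp_ge_add_one_self[of 1] by (simp add: exp_minus field_simps)
    finally have e: "exp (- 1 * ?N) \<le> 1 / 2" .
    have p: "prob (space (M n) - ?bad) \<ge> 1 / 2"
      using elim(2) e prob_compl[OF bad] by (simp add: bad_prob_def)
    have ge: "indicator (space (M n) - ?bad) \<omega> * exp (- B * ?N) \<le> partition_sum (V n) (\<sigma> n \<omega>) f \<U>" for \<omega>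
    proof (cases "\<omega> \<in> space (M n) - ?bad")
      case True
      then have "good_models (V n) (\<sigma> n \<omega>) \<U> \<noteq> {}"
        using gibbs_state_None_iff[of "V n" "\<sigma> n \<omega>" f \<U>] by (auto simp: gibbs_in_iff[OF finite_V])
      then obtain x where x: "x \<in> good_models (V n) (\<sigma> n \<omega>) \<U>" by blast
      have "energy (V n) (\<sigma> n \<omega>) f x \<le> (\<Sum>v\<in>V n. B)"
        unfolding energy_def using B(2) by (intro sum_mono) (metis abs_le_D1)
      then have "exp (- B * ?N) \<le> exp (- energy (V n) (\<sigma> n \<omega>) f x)" by (simp add: mult.commute)
      also have "\<dots> \<le> partition_sum (V n) (\<sigma> n \<omega>) f \<U>"
        unfolding partition_sum_def using x by (intro member_le_sum finite_good_models finite_V) auto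
      finally show ?thesis using True by simp
    qed (simp add: partition_sum_nonneg)
    have "prob (space (M n) - ?bad) * exp (- B * ?N) = (\<integral>\<omega>. indicator (space (M n) - ?bad) \<omega> * exp (- B * ?N) \<partial>M n)"
      using bad by (simp add: Int_absorb1)
    also have "\<dots> \<le> mean_sum f \<U> n"
      unfolding mean_sum_def using ge bad
      by (intro integral_mono integrable_partition_sum[OF elim(3) U(1) cont_f]) (auto simp: emeasure_eq_measure)
    also have "\<dots> < exp (r * ?N)" using elim(1) .
    also have "\<dots> \<le> exp ((- B - 1) * ?N)" using W(1) by (intro iffD2[OF exp_le_cancel_iff] mult_right_mono) auto
    also have "\<dots> = exp (- B * ?N) * exp (- 1 * ?N)" by (simp add: exp_add[symmetric] algebra_simps)
    also have "\<dots> \<le> exp (- B * ?N) * (1 / 2)" using e by (intro mult_left_mono) auto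
    also have "\<dots> \<le> exp (- B * ?N) * prob (space (M n) - ?bad)" using p by (intro mult_left_mono) auto
    finally show False by (simp add: mult.commute)
  qed
  then show False by simp
qed

text \<open>If every typical Gibbs state gave mass more than \<open>\<delta>\<close> to the models in \<open>W'\<close>, then the
  partition function of \<open>\<U>\<close> would grow no faster than that of \<open>W'\<close>.\<close>

lemma gibbs_concentration:
  assumes \<O>: "openin weak_star \<O>" "\<mu> \<in> \<O>" and W: "openin weak_star W" "maximizers \<subseteq> W" and "\<delta> > 0"
  shows "\<exists>q b. set_pmf q \<subseteq> prob_measures \<and> 1 - \<delta> \<le> measure_pmf.prob q W \<and> b \<in> \<O> \<and>
    (\<forall>l. cylval b l = (\<integral>\<nu>. cylval \<nu> l \<partial>measure_pmf q))"
proof -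
  obtain B where B: "0 < B" "\<And>x. \<bar>f x\<bar> \<le> B" using continuous_bounded[OF cont_f] by blast
  define L where "L = ln CARD('a discrete) + B"
  obtain m where m: "max_pressure = ereal m"
    using max_pressure_less_PInf max_pressure_greater_MInf by (cases max_pressure) auto
  have KW: "compactin weak_star (K - W)"
  proof -
    have "closedin weak_star (topspace weak_star - W)" using W(1) by (rule closedin_diff[OF closedin_topspace])
    from closed_Int_compactin[OF this compactin_K]
    have "compactin weak_star ((topspace weak_star - W) \<inter> K)" .
    also have "(topspace weak_star - W) \<inter> K = K - W" using K_prob by auto
    finally show ?thesis .
  qed
  have "tilted f \<nu> < max_pressure" if "\<nu> \<in> K - W" for \<nu>
    using that W(2) tilted_le_max[of \<nu>] by (auto simp: maximizers_def less_le)
  then obtain c W' where W': "ereal c < max_pressure" "openin weak_star W'" "K - W \<subseteq> W'"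
      "growth_rate V (mean_sum f W') < ereal c"
    using growth_compact_less[OF cont_f KW] max_pressure_greater_MInf by (metis less_irrefl)
  \<comment> \<open>A bad map contributes at most exp (L |V n|), so probability rate c - L bounds
    the total contribution of bad maps by exp (c |V n|), the same rate as for
    \<open>W'\<close>.\<close>
  obtain \<U>0 where U0: "openin weak_star \<U>0" "K \<subseteq> \<U>0"
    "\<And>\<U>'. openin weak_star \<U>' \<Longrightarrow> K \<subseteq> \<U>' \<Longrightarrow> \<U>' \<subseteq> \<U>0 \<Longrightarrow> growth_rate V (bad_prob \<U>' \<O>) < ereal (c - L)"
    using bad_prob_growth[OF \<O>, of "c - L"] by auto
  \<comment> \<open>A model for \<U> whose empirical measure is outside \<open>W\<close> then has it
    in \<open>W'\<close>, whose partition function is under control.\<close>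
  define \<U> where "\<U> = \<U>0 \<inter> (W \<union> W')"
  have U: "openin weak_star \<U>" "K \<subseteq> \<U>" "\<U> \<subseteq> \<U>0" "\<U> \<subseteq> W \<union> W'"
    unfolding \<U>_def using U0 W W' by auto
  have "\<exists>n \<omega>. gibbs_in (V n) (\<sigma> n \<omega>) f \<U> \<O> \<and>
      partition_sum (V n) (\<sigma> n \<omega>) f W' \<le> \<delta> * partition_sum (V n) (\<sigma> n \<omega>) f \<U>"
  proof (rule ccontr)
    assume "\<not> ?thesis"
    then have neg: "\<delta> * partition_sum (V n) (\<sigma> n \<omega>) f \<U> < partition_sum (V n) (\<sigma> n \<omega>) f W'"
      if "gibbs_in (V n) (\<sigma> n \<omega>) f \<U> \<O>" for n \<omega>
      using that not_le by blast
    \<comment> \<open>The gap between \<open>c\<close> and \<open>t\<close> absorbs the constant 1 +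
      1/\<delta>, while \<open>t\<close> stays below the maximal pressure, which gives the
      contradiction.\<close>
    define t where "t = (c + m) / 2"
    have t: "c < t" "t < m" using W'(1) by (auto simp: t_def m)
    have "growth_rate V (mean_sum f \<U>) \<le> ereal t"
    proof (rule growth_rate_leI[OF card_V])
      show "\<forall>\<^sub>F n in sequentially. mean_sum f \<U> n \<le> exp (t * card (V n))"
        using growth_rate_lessD[OF card_V W'(4)] growth_rate_lessD[OF card_V U0(3)[OF U(1-3)]]
          eventually_V_nonempty card_eventually_ge[OF card_V, of "ln (1 + 1 / \<delta>) / (t - c)"]
      proof eventually_elim
        case (elim n)
        interpret prob_space "M n" by (rule prob_M)
        let ?N = "real (card (V n))"
        let ?bad = "{\<omega> \<in> space (M n). \<not> gibbs_in (V n) (\<sigma> n \<omega>) f \<U> \<O>}"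
        have bad: "?bad \<in> events" by (rule measurable_gibbs_in[OF elim(3) U(1) \<O>(1)])
        have le: "partition_sum (V n) (\<sigma> n \<omega>) f \<U>
            \<le> indicator ?bad \<omega> * exp (L * ?N) + partition_sum (V n) (\<sigma> n \<omega>) f W' / \<delta>"
          if "\<omega> \<in> space (M n)" for \<omega>
        proof (cases "\<omega> \<in> ?bad")
          case True
          then have "partition_sum (V n) (\<sigma> n \<omega>) f \<U> \<le> indicator ?bad \<omega> * exp (L * ?N)"
            using partition_sum_le[of f B, OF B(2)] by (simp add: L_def)
          moreover have "0 \<le> partition_sum (V n) (\<sigma> n \<omega>) f W' / \<delta>"
            using \<open>\<delta> > 0\<close> partition_sum_nonneg by (intro divide_nonneg_pos)
          ultimately show ?thesis by linarith
        next
          case False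
          with that neg[of n \<omega>] \<open>\<delta> > 0\<close> show ?thesis by (simp add: field_simps)
        qed
        have "mean_sum f \<U> n
            \<le> (\<integral>\<omega>. indicator ?bad \<omega> * exp (L * ?N) + partition_sum (V n) (\<sigma> n \<omega>) f W' / \<delta> \<partial>M n)"
          unfolding mean_sum_def using le bad
          by (intro integral_mono Bochner_Integration.integrable_add integrable_divide
              integrable_partition_sum[OF elim(3) _ cont_f] U(1) W'(2))
            (auto simp: emeasure_eq_measure)
        also have "\<dots> = (\<integral>\<omega>. indicator ?bad \<omega> * exp (L * ?N) \<partial>M n)
            + (\<integral>\<omega>. partition_sum (V n) (\<sigma> n \<omega>) f W' / \<delta> \<partial>M n)"
          using bad by (intro Bochner_Integration.integral_add integrable_divide
              integrable_partition_sum[OF elim(3) _ cont_f] W'(2)) (auto simp: emeasure_eq_measure)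
        also have "\<dots> = bad_prob \<U> \<O> n * exp (L * ?N) + mean_sum f W' n / \<delta>"
          using bad by (simp add: mean_sum_def bad_prob_def Int_absorb1)
        also have "\<dots> \<le> exp ((c - L) * ?N) * exp (L * ?N) + exp (c * ?N) / \<delta>"
          using elim(1,2) \<open>\<delta> > 0\<close> by (intro add_mono mult_right_mono divide_right_mono) auto
        also have "\<dots> = (1 + 1 / \<delta>) * exp (c * ?N)"
          by (simp add: exp_add[symmetric] algebra_simps)
        also have "\<dots> \<le> exp ((t - c) * ?N) * exp (c * ?N)"
        proof (rule mult_right_mono)
          have "ln (1 + 1 / \<delta>) \<le> (t - c) * ?N" using elim(4) t by (simp add: field_simps)
          then have "exp (ln (1 + 1 / \<delta>)) \<le> exp ((t - c) * ?N)" by (simp only: exp_le_cancel_iff)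
          moreover have "0 < 1 + 1 / \<delta>" using \<open>\<delta> > 0\<close> by (simp add: add_pos_pos)
          ultimately show "1 + 1 / \<delta> \<le> exp ((t - c) * ?N)" by (simp only: exp_ln)
        qed simp
        also have "\<dots> = exp (t * ?N)" by (simp add: exp_add[symmetric] algebra_simps)
        finally show ?case .
      qed
    qed
    from order_trans[OF max_pressure_le_growth[OF U(1,2)] this] t m show False by simp
  qed
  then obtain n \<omega> where n: "gibbs_in (V n) (\<sigma> n \<omega>) f \<U> \<O>"
    "partition_sum (V n) (\<sigma> n \<omega>) f W' \<le> \<delta> * partition_sum (V n) (\<sigma> n \<omega>) f \<U>" by blast
  then obtain \<xi> where \<xi>: "gibbs_state (V n) (\<sigma> n \<omega>) f \<U> = Some \<xi>" "empirical_mean (V n) (\<sigma> n \<omega>) \<xi> \<in> \<O>"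
    by (auto simp: gibbs_in_iff[OF finite_V])
  note g = gibbs_state_props[OF finite_V \<xi>(1)]
  let ?E = "empirical (V n) (\<sigma> n \<omega>) :: _ \<Rightarrow> ('g \<Rightarrow> 'a discrete) measure"
  let ?Z = "partition_sum (V n) (\<sigma> n \<omega>) f \<U>"
  let ?A = "good_models (V n) (\<sigma> n \<omega>) \<U> \<inter> good_models (V n) (\<sigma> n \<omega>) W'"
  have Z: "0 < ?Z" by (rule partition_sum_pos[OF finite_V g(1)])
  have fA: "finite ?A" using finite_good_models[OF finite_V] by blast
  define q where "q = map_pmf ?E \<xi>"
  have "measure \<xi> (?E -` (- W)) = measure \<xi> (?E -` (- W) \<inter> set_pmf \<xi>)"
    by (rule measure_Int_set_pmf[symmetric])
  also have "\<dots> \<le> measure \<xi> ?A"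
    using g(3) U(4) by (intro measure_pmf.finite_measure_mono) (auto simp: good_models_def)
  also have "\<dots> = (\<Sum>x\<in>?A. exp (- energy (V n) (\<sigma> n \<omega>) f x)) / ?Z"
    using fA by (simp add: measure_measure_pmf_finite g(2) sum_divide_distrib)
  also have "\<dots> \<le> partition_sum (V n) (\<sigma> n \<omega>) f W' / ?Z"
    unfolding partition_sum_def[of _ _ _ W'] using Z
    by (intro divide_right_mono sum_mono2 finite_good_models finite_V) auto
  also have "\<dots> \<le> \<delta>" using n(2) Z by (simp add: field_simps)
  finally have small: "measure \<xi> (?E -` (- W)) \<le> \<delta>" .
  have "measure q W = 1 - measure \<xi> (?E -` (- W))"
    using measure_pmf.prob_compl[of "?E -` (- W)" \<xi>]
    by (simp add: q_def vimage_Compl Compl_eq_Diff_UNIV[symmetric])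
  with small have "1 - \<delta> \<le> measure q W" by linarith
  moreover have "set_pmf q \<subseteq> prob_measures"
    by (auto simp: q_def empirical_prob_measures)
  moreover have "cylval (empirical_mean (V n) (\<sigma> n \<omega>) \<xi>) l = (\<integral>\<nu>. cylval \<nu> l \<partial>q)" for l :: "('g \<times> 'a discrete) list"
    by (simp add: q_def cylval_empirical_mean)
  ultimately show ?thesis using \<xi>(2) by blast
qed

text \<open>By upper semicontinuity, the maximisers are \<open>K\<close> without an open sublevel
  set.\<close>

lemma closed_maximizers:
  obtains C where "closed C" "maximizers = prob_measures \<inter> cylval -` C"
proof -
  obtain C where C: "closed C" "K = prob_measures \<inter> cylval -` C" using closed_inv_measures[OF closed_X] .
  obtain S where S: "open S" "{\<nu> \<in> prob_measures. tilted f \<nu> < max_pressure} = prob_measures \<inter> cylval -` S"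
    using openin_tilted_less[of f max_pressure] unfolding openin_weak_star_iff by blast
  have "maximizers = {\<nu> \<in> K. \<not> tilted f \<nu> < max_pressure}"
    using tilted_le_max by (auto simp: maximizers_def less_le)
  also have "\<dots> = prob_measures \<inter> cylval -` (C - S)"
    using S(2) C(2) by blast
  finally show ?thesis using that[of "C - S"] C(1) S(1) by (simp add: closed_Diff)
qed

text \<open>Neighbourhoods of \<mu> and of the maximisers shrink at the same time: the barycenters
  \<open>b k\<close> tend to \<mu> while the laws \<open>q k\<close> concentrate on the maximisers,
  so \<open>limit_barycenter_measure\<close> applies.\<close>

lemma maximizers_barycenter:
  obtains \<pp> where "\<pp> \<in> prob_on K" "has_barycenter \<pp> \<mu>" "AE \<nu> in \<pp>. \<nu> \<in> maximizers"
proof -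
  obtain C where C: "closed C" "maximizers = prob_measures \<inter> cylval -` C" using closed_maximizers .
  define E where "E = cylval ` maximizers"
  have E: "compact E" "E \<noteq> {}"
    unfolding E_def using compact_cylval_closed[OF C] maximizers_nonempty by auto
  define \<epsilon> :: "nat \<Rightarrow> real" where "\<epsilon> k = 1 / Suc k" for k
  have \<epsilon>: "0 < \<epsilon> k" for k by (simp add: \<epsilon>_def)
  have \<epsilon>0: "\<epsilon> \<longlonglongrightarrow> 0" unfolding \<epsilon>_def using LIMSEQ_inverse_real_of_nat by (simp add: inverse_eq_divide)
  define \<O> where "\<O> k = prob_measures \<inter> cylval -` ball (cylval \<mu>) (\<epsilon> k)" for k
  define W where "W k = prob_measures \<inter> cylval -` {t. infdist t E < \<epsilon> k}" for k
  have oO: "openin weak_star (\<O> k)" for k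
    unfolding openin_weak_star_iff \<O>_def using open_ball by blast
  have mO: "\<mu> \<in> \<O> k" for k using mu_prob \<epsilon>[of k] by (simp add: \<O>_def)
  have "open {t. infdist t E < \<epsilon> k}" for k
    by (intro open_Collect_less continuous_on_infdist continuous_intros)
  then have oW: "openin weak_star (W k)" for k
    unfolding openin_weak_star_iff W_def by blast
  have mW: "maximizers \<subseteq> W k" for k
    using C(2) \<epsilon>[of k] by (auto simp: W_def E_def)
  have "\<forall>k. \<exists>q b. set_pmf q \<subseteq> prob_measures \<and> 1 - \<epsilon> k \<le> measure_pmf.prob q (W k) \<and> b \<in> \<O> k \<and>
    (\<forall>l. cylval b l = (\<integral>\<nu>. cylval \<nu> l \<partial>measure_pmf q))"
    using gibbs_concentration[OF oO mO oW mW \<epsilon>] by blast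
  then obtain q b where q: "\<And>k. set_pmf (q k) \<subseteq> prob_measures"
    "\<And>k. 1 - \<epsilon> k \<le> measure_pmf.prob (q k) (W k)" "\<And>k. b k \<in> \<O> k"
    "\<And>k l. cylval (b k) l = (\<integral>\<nu>. cylval \<nu> l \<partial>measure_pmf (q k))"
    by metis
  have "(\<lambda>k. cylval (b k)) \<longlonglongrightarrow> cylval \<mu>"
  proof (rule metric_LIMSEQ_I)
    fix r :: real assume "r > 0"
    obtain k0 where k0: "\<And>k. k \<ge> k0 \<Longrightarrow> \<epsilon> k < r"
      using order_tendstoD(2)[OF \<epsilon>0 \<open>r > 0\<close>] by (auto simp: eventually_sequentially)
    show "\<exists>k0. \<forall>k\<ge>k0. dist (cylval (b k)) (cylval \<mu>) < r"
    proof (intro exI[of _ k0] allI impI)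
      fix k assume "k \<ge> k0"
      then show "dist (cylval (b k)) (cylval \<mu>) < r"
        using q(3)[of k] k0[of k] by (simp add: \<O>_def dist_commute)
    qed
  qed
  then have lim: "(\<lambda>k. \<integral>\<nu>. cylval \<nu> l \<partial>measure_pmf (q k)) \<longlonglongrightarrow> cylval \<mu> l" for l
    using continuous_on_tendsto_compose[OF continuous_on_product_coordinates, of "\<lambda>k. cylval (b k)" "cylval \<mu>" sequentially l]
    by (simp add: q(4))
  have conc: "(\<lambda>k. measure (q k) S) \<longlonglongrightarrow> 1" if S: "openin weak_star S" "maximizers \<subseteq> S" for S
  proof -
    obtain T where T: "open T" "S = prob_measures \<inter> cylval -` T" using S(1) by (auto simp: openin_weak_star_iff)
    have "E \<subseteq> T" using S(2) T(2) by (auto simp: E_def)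
    \<comment> \<open>A compact set in an open one has a metric neighbourhood in it, of radius the
      least distance to the complement. For \<open>T = UNIV\<close> the complement is empty, where
      \<open>infdist\<close> is 0 by convention, and any radius serves.\<close>
    obtain e where e: "e > 0" "{t. infdist t E < e} \<subseteq> T"
    proof (cases "T = UNIV")
      case False
      have "continuous_on E (\<lambda>t. infdist t (- T))"
        by (intro continuous_on_infdist continuous_on_id)
      from continuous_attains_inf[OF E this]
      obtain t0 where t0: "t0 \<in> E" "\<And>t. t \<in> E \<Longrightarrow> infdist t0 (- T) \<le> infdist t (- T)" by blast
      have "infdist t0 (- T) > 0"
      proof (rule ccontr)
        assume "\<not> infdist t0 (- T) > 0"
        then have "infdist t0 (- T) = 0" using infdist_nonneg[of t0 "- T"] by linarith
        moreover have "closed (- T)" "- T \<noteq> {}" using T(1) False by auto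
        ultimately have "t0 \<in> - T" using in_closed_iff_infdist_zero[of "- T" t0] by blast
        then show False using t0(1) \<open>E \<subseteq> T\<close> by blast
      qed
      moreover have "{t. infdist t E < infdist t0 (- T)} \<subseteq> T"
      proof
        fix t assume t: "t \<in> {t. infdist t E < infdist t0 (- T)}"
        show "t \<in> T"
        proof (rule ccontr)
          assume "t \<notin> T"
          then have "infdist t0 (- T) \<le> dist t s" if "s \<in> E" for s
            using t0(2)[OF that] infdist_le[of t "- T" s] by (simp add: dist_commute)
          then have "infdist t0 (- T) \<le> infdist t E"
            unfolding infdist_notempty[OF E(2)] using E(2) by (intro cINF_greatest) auto
          with t show False by simp
        qed
      qed
      ultimately show ?thesis using that by blast
    qed (use that[of 1] in auto)
    show ?thesis
    proof (rule tendsto_sandwich)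
      show "\<forall>\<^sub>F k in sequentially. 1 - \<epsilon> k \<le> measure (q k) S"
        using order_tendstoD(2)[OF \<epsilon>0 e(1)]
      proof eventually_elim
        case (elim k)
        have "W k \<subseteq> S"
        proof
          fix \<nu> assume "\<nu> \<in> W k"
          then have "\<nu> \<in> prob_measures" "cylval \<nu> \<in> {t. infdist t E < e}" using elim by (auto simp: W_def)
          with e(2) show "\<nu> \<in> S" unfolding T(2) by blast
        qed
        then have "measure (q k) (W k) \<le> measure (q k) S" by (intro measure_pmf.finite_measure_mono) auto
        with q(2)[of k] show ?case by linarith
      qed
      show "(\<lambda>k. 1 - \<epsilon> k) \<longlonglongrightarrow> 1" using tendsto_diff[OF tendsto_const \<epsilon>0, of 1] by simp
    qed auto
  qed
  have "maximizers \<subseteq> K" by (auto simp: maximizers_def)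
  from limit_barycenter_measure[OF q(1) mu_prob lim C this K_prob conc] that show ?thesis by blast
qed

end

section \<open>Orbit averages and ergodic decompositions\<close>

text \<open>Since |h| is at most 2^(-k) + 2^k h^2, it suffices to sum the second term. The rate 1/8
  leaves integrals of order 4^(-k) after multiplication by 2^k, so that series is finite almost
  everywhere.\<close>

lemma AE_summable_of_squares:
  fixes h :: "nat \<Rightarrow> 'x \<Rightarrow> real"
  assumes h [measurable]: "\<And>k. h k \<in> borel_measurable M"
    and int: "\<And>k. integrable M (\<lambda>x. (h k x)\<^sup>2)"
    and le: "\<And>k. (\<integral>x. (h k x)\<^sup>2 \<partial>M) \<le> C * (1/8)^k"
  shows "AE x in M. summable (\<lambda>k. h k x)"
proof -
  have "0 \<le> (\<integral>x. (h 0 x)\<^sup>2 \<partial>M)" by simp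
  from order_trans[OF this le[of 0]] have C: "0 \<le> C" by simp
  have "(\<integral>\<^sup>+x. (\<Sum>k. ennreal (2^k * (h k x)\<^sup>2)) \<partial>M) = (\<Sum>k. \<integral>\<^sup>+x. ennreal (2^k * (h k x)\<^sup>2) \<partial>M)"
    by (rule nn_integral_suminf) measurable
  also have "\<dots> \<le> (\<Sum>k. ennreal (C * (1/4)^k))"
  proof (intro suminf_le summableI)
    fix k
    have "(\<integral>\<^sup>+x. ennreal (2^k * (h k x)\<^sup>2) \<partial>M) = ennreal (\<integral>x. 2^k * (h k x)\<^sup>2 \<partial>M)"
      using int by (intro nn_integral_eq_integral) auto
    also have "\<dots> \<le> ennreal (C * (1/4)^k)"
    proof (rule ennreal_leI)
      have "(\<integral>x. 2^k * (h k x)\<^sup>2 \<partial>M) \<le> 2^k * (C * (1/8)^k)"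
        using le[of k] by (simp add: mult_left_mono)
      also have "\<dots> = C * (1/4)^k" by (simp add: power_mult_distrib[symmetric] mult.left_commute)
      finally show "(\<integral>x. 2^k * (h k x)\<^sup>2 \<partial>M) \<le> C * (1/4)^k" .
    qed
    finally show "(\<integral>\<^sup>+x. ennreal (2^k * (h k x)\<^sup>2) \<partial>M) \<le> ennreal (C * (1/4)^k)" .
  qed
  also have "(\<Sum>k. ennreal (C * (1/4)^k)) < \<infinity>"
  proof -
    have "summable (\<lambda>k. C * (1/4)^k)" by (intro summable_mult summable_geometric) simp
    then have "(\<Sum>k. ennreal (C * (1/4)^k)) = ennreal (\<Sum>k. C * (1/4)^k)"
      using C by (intro suminf_ennreal2) auto
    then show ?thesis by simp
  qed
  finally have "AE x in M. (\<Sum>k. ennreal (2^k * (h k x)\<^sup>2)) \<noteq> \<infinity>"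
    by (intro nn_integral_PInf_AE) auto
  then show ?thesis
  proof eventually_elim
    case (elim x)
    then have s: "summable (\<lambda>k. 2^k * (h k x)\<^sup>2)"
      by (intro summable_suminf_not_top) auto
    have "summable (\<lambda>k. (1/2)^k + 2^k * (h k x)\<^sup>2)"
      by (intro summable_add s summable_geometric) simp
    then show ?case
    proof (rule summable_comparison_test'[where N = 0])
      fix k
      define t :: real where "t = (1/2)^k"
      have t: "0 < t" "2^k = 1 / t" by (simp_all add: t_def power_divide)
      have "0 \<le> (\<bar>h k x\<bar> - t)\<^sup>2" by simp
      then have "2 * t * \<bar>h k x\<bar> \<le> t\<^sup>2 + (h k x)\<^sup>2" by (simp add: power2_diff algebra_simps)
      moreover have "0 \<le> t * \<bar>h k x\<bar>" using t by simp
      moreover have "t * (t + (h k x)\<^sup>2 / t) = t\<^sup>2 + (h k x)\<^sup>2"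
        using t by (simp add: power2_eq_square field_simps)
      ultimately have "t * \<bar>h k x\<bar> \<le> t * (t + (h k x)\<^sup>2 / t)" by linarith
      then have "\<bar>h k x\<bar> \<le> t + (h k x)\<^sup>2 / t" using t by (simp add: mult_le_cancel_left_pos)
      then show "norm (h k x) \<le> (1/2)^k + 2^k * (h k x)\<^sup>2" using t by (simp add: t_def)
    qed
  qed
qed

lemma convergent_of_summable_diff:
  fixes s :: "nat \<Rightarrow> real"
  assumes "summable (\<lambda>k. s (Suc k) - s k)"
  shows "convergent s"
proof -
  have "(\<lambda>n. \<Sum>k<n. s (Suc k) - s k) \<longlonglongrightarrow> (\<Sum>k. s (Suc k) - s k)"
    using assms by (rule summable_LIMSEQ)
  then have "(\<lambda>n. (s n - s 0) + s 0) \<longlonglongrightarrow> (\<Sum>k. s (Suc k) - s k) + s 0"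
    unfolding sum_lessThan_telescope by (intro tendsto_intros)
  then show ?thesis unfolding convergent_def by auto
qed

lemma shift_shift: "shift g (shift h x) = shift (g + h) x"
  by (simp add: shift_def add.assoc)

lemma shift_0 [simp]: "shift 0 x = x"
  by (simp add: shift_def)

text \<open>A convex combination of translates, with the weights encoded as a probability on the
  group. Weights stay arbitrary so that they can be chosen by minimisation.\<close>

definition orbit_law :: "'g::group_add pmf \<Rightarrow> ('g \<Rightarrow> 'a::topological_space) \<Rightarrow> ('g \<Rightarrow> 'a) measure" where
  "orbit_law a x = distr (measure_pmf a) borel (\<lambda>g. shift g x)"

definition orbit_avg :: "'g::group_add pmf \<Rightarrow> ('g \<Rightarrow> 'a::topological_space) \<Rightarrow> ('g \<times> 'a) list \<Rightarrow> real" where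
  "orbit_avg a x l = (\<integral>g. indicator (cyl l) (shift g x) \<partial>measure_pmf a)"

lemma orbit_law_prob_measures: "orbit_law a x \<in> prob_measures"
  unfolding orbit_law_def prob_measures_def
  by (auto intro!: prob_space.prob_space_distr prob_space_measure_pmf)

lemma cylval_orbit_law:
  "cylval (orbit_law a x) l = orbit_avg a (x :: 'g::{countable, group_add} \<Rightarrow> 'a::finite discrete) l"
proof -
  have "cylval (orbit_law a x) l = (\<integral>y. indicator (cyl l) y \<partial>orbit_law a x)"
    by (rule cylval_eq_integral[OF orbit_law_prob_measures])
  also have "\<dots> = orbit_avg a x l"
    unfolding orbit_law_def orbit_avg_def by (rule integral_distr) auto
  finally show ?thesis .
qed

lemma orbit_avg_bounds: "0 \<le> orbit_avg a x l \<and> orbit_avg a x l \<le> 1"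
proof -
  have "integrable (measure_pmf a) (\<lambda>g. indicator (cyl l) (shift g x) :: real)"
    by (rule measure_pmf.integrable_const_bound[where B = 1]) auto
  from measure_pmf.integral_le_const[OF this, of 1] show ?thesis
    unfolding orbit_avg_def by (auto simp: indicator_def[abs_def] intro!: integral_nonneg_AE)
qed

lemma orbit_avg_eq_sum:
  assumes "finite S" "set_pmf a \<subseteq> S"
  shows "orbit_avg a x l = (\<Sum>g\<in>S. indicator (cyl l) (shift g x) * pmf a g)"
  unfolding orbit_avg_def using assms by (intro integral_measure_pmf_real) auto

lemma orbit_avg_measurable [measurable]:
  assumes "finite (set_pmf a)"
  shows "(\<lambda>x :: 'g::{countable, group_add} \<Rightarrow> 'a::finite discrete. orbit_avg a x l) \<in> borel_measurable borel"
proof -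
  have "(\<lambda>x. indicator (cyl l) (shift g x) :: real) \<in> borel_measurable borel" for g
    using measurable_compose[OF shift_measurable[of g] borel_measurable_indicator[OF cyl_borel[of l]]] .
  then show ?thesis
    unfolding orbit_avg_eq_sum[OF assms order_refl] by (intro borel_measurable_sum borel_measurable_times) auto
qed

text \<open>Evaluating at a shifted point amounts to changing the weights, so asymptotic invariance
  becomes a comparison of two competitors in the same minimisation.\<close>

lemma orbit_avg_translate: "orbit_avg (map_pmf (\<lambda>g. g + h) a) x l = orbit_avg a (shift h x) l"
  by (simp add: orbit_avg_def shift_shift)

text \<open>The midpoint of two weights, as needed for the parallelogram identity.\<close>

definition mix_pmf :: "'x pmf \<Rightarrow> 'x pmf \<Rightarrow> 'x pmf" where
  "mix_pmf a b = bind_pmf (bernoulli_pmf (1/2)) (\<lambda>t. if t then a else b)"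

lemma pmf_mix: "pmf (mix_pmf a b) x = (pmf a x + pmf b x) / 2"
  by (simp add: mix_pmf_def pmf_bind field_simps)

lemma set_mix_pmf: "set_pmf (mix_pmf a b) \<subseteq> set_pmf a \<union> set_pmf b"
  by (auto simp: mix_pmf_def split: if_splits)

lemma orbit_avg_mix:
  assumes "finite (set_pmf a)" "finite (set_pmf b)"
  shows "orbit_avg (mix_pmf a b) x l = (orbit_avg a x l + orbit_avg b x l) / 2"
proof -
  let ?S = "set_pmf a \<union> set_pmf b"
  have S: "finite ?S" using assms by simp
  show ?thesis
    unfolding orbit_avg_eq_sum[OF S set_mix_pmf] orbit_avg_eq_sum[OF S Un_upper1] orbit_avg_eq_sum[OF S Un_upper2]
    by (simp add: pmf_mix sum_divide_distrib sum.distrib[symmetric] ring_distribs add_divide_distrib)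
qed

text \<open>A mean ergodic theorem simultaneous in all cylinders: averages \<open>a\<close> almost minimising the
  weighted sum of the squared \<open>L\<^sup>2\<close> norms of \<open>orbit_avg a\<close> form a Cauchy sequence, by the
  parallelogram identity, and the same identity makes translates of \<open>a\<close> close to \<open>a\<close>.\<close>

lemma mean_ergodic_averages:
  fixes \<mu> :: "('g::{countable, group_add} \<Rightarrow> 'a::finite discrete) measure"
  assumes \<mu>: "\<mu> \<in> inv_measures UNIV"
  obtains a :: "nat \<Rightarrow> 'g pmf" where "\<And>k. finite (set_pmf (a k))"
    "AE x in \<mu>. \<forall>l. convergent (\<lambda>k. orbit_avg (a k) x l)"
    "AE x in \<mu>. \<forall>h l. (\<lambda>k. orbit_avg (a k) (shift h x) l - orbit_avg (a k) x l) \<longlonglongrightarrow> 0"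
proof -
  have \<mu>P: "\<mu> \<in> prob_measures" and inv: "\<And>g. distr \<mu> borel (shift g) = \<mu>"
    using \<mu> by (auto simp: inv_measures_def)
  interpret prob_space \<mu> using \<mu>P prob_measuresD by blast
  have [measurable_cong]: "sets \<mu> = sets borel" using \<mu>P prob_measuresD by blast
  \<comment> \<open>Positive weights on all lists combine the norms for all cylinders into one
    functional \<Phi>, so that one sequence of averages serves every cylinder.\<close>
  define \<rho> :: "('g \<times> 'a discrete) list pmf" where "\<rho> = map_pmf from_nat (geometric_pmf (1/2))"
  have \<rho>: "0 < pmf \<rho> l" for l
    unfolding pmf_positive_iff by (simp add: \<rho>_def set_pmf_geometric surj_from_nat)
  define sq where "sq a l = (\<integral>x. (orbit_avg a x l)\<^sup>2 \<partial>\<mu>)" for a and l :: "('g \<times> 'a discrete) list"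
  define \<Phi> where "\<Phi> a = (\<integral>l. sq a l \<partial>\<rho>)" for a
  define D where "D a b l = (\<integral>x. (orbit_avg a x l - orbit_avg b x l)\<^sup>2 \<partial>\<mu>)"
    for a b and l :: "('g \<times> 'a discrete) list"
  define \<A> where "\<A> = {a :: 'g pmf. finite (set_pmf a)}"
  have mA: "(\<lambda>x :: 'g \<Rightarrow> 'a discrete. orbit_avg a x l) \<in> borel_measurable borel" if "a \<in> \<A>" for a l
    using that unfolding \<A>_def by (intro orbit_avg_measurable) auto
  have mA' [measurable]: "(\<lambda>x :: 'g \<Rightarrow> 'a discrete. orbit_avg a x l) \<in> borel_measurable \<mu>" if "a \<in> \<A>" for a l
    using mA[OF that] by measurable
  have sq1: "(orbit_avg a x l)\<^sup>2 \<le> 1" for a and x :: "'g \<Rightarrow> 'a discrete" and l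
    using orbit_avg_bounds[of a x l] by (simp add: power_le_one)
  have isq: "integrable \<mu> (\<lambda>x. (orbit_avg a x l)\<^sup>2)" if "a \<in> \<A>" for a l
    using sq1 mA'[OF that] by (intro integrable_const_bound[where B = 1]) auto
  have diff1: "(orbit_avg a x l - orbit_avg b x l)\<^sup>2 \<le> 1" for a b and x :: "'g \<Rightarrow> 'a discrete" and l
  proof -
    have "\<bar>orbit_avg a x l - orbit_avg b x l\<bar> \<le> 1"
      using orbit_avg_bounds[of a x l] orbit_avg_bounds[of b x l] by linarith
    then show ?thesis by (simp add: abs_square_le_1)
  qed
  have iD: "integrable \<mu> (\<lambda>x. (orbit_avg a x l - orbit_avg b x l)\<^sup>2)" if "a \<in> \<A>" "b \<in> \<A>" for a b l
    using diff1 mA'[OF that(1)] mA'[OF that(2)] by (intro integrable_const_bound[where B = 1]) auto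
  have sqb: "0 \<le> sq a l \<and> sq a l \<le> 1" if "a \<in> \<A>" for a l
    unfolding sq_def using integral_le_const[OF isq[OF that], where c = 1] sq1 by auto
  have mix: "mix_pmf a b \<in> \<A>" if "a \<in> \<A>" "b \<in> \<A>" for a b
    using that finite_subset[OF set_mix_pmf, of a b] by (auto simp: \<A>_def)
  have par: "D a b l = 2 * sq a l + 2 * sq b l - 4 * sq (mix_pmf a b) l" if "a \<in> \<A>" "b \<in> \<A>" for a b l
  proof -
    have "D a b l = (\<integral>x. 2 * (orbit_avg a x l)\<^sup>2 + 2 * (orbit_avg b x l)\<^sup>2 - 4 * (orbit_avg (mix_pmf a b) x l)\<^sup>2 \<partial>\<mu>)"
      unfolding D_def using that
      by (intro Bochner_Integration.integral_cong refl)
        (simp add: orbit_avg_mix \<A>_def power2_eq_square field_simps)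
    also have "\<dots> = 2 * sq a l + 2 * sq b l - 4 * sq (mix_pmf a b) l"
      unfolding sq_def using isq that mix by simp
    finally show ?thesis .
  qed
  have i\<rho>: "integrable (measure_pmf \<rho>) (sq a)" if "a \<in> \<A>" for a
    using sqb[OF that] by (intro measure_pmf.integrable_const_bound[where B = 1]) auto
  define d where "d = Inf (\<Phi> ` \<A>)"
  have bdd: "bdd_below (\<Phi> ` \<A>)"
    using sqb by (intro bdd_belowI2[where m = 0]) (auto simp: \<Phi>_def intro!: integral_nonneg_AE)
  have d: "d \<le> \<Phi> a" if "a \<in> \<A>" for a
    unfolding d_def using bdd that by (intro cInf_lower) auto
  \<comment> \<open>The midpoint of two near-minimisers is not below the infimum, so the weighted
    sum of their squared distances is at most 4\<eta>; isolating one cylinder costs its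
    weight.\<close>
  have close: "D a b l \<le> 4 / pmf \<rho> l * \<eta>" if ab: "a \<in> \<A>" "b \<in> \<A>" "\<Phi> a < d + \<eta>" "\<Phi> b < d + \<eta>" for a b l \<eta>
  proof -
    have "pmf \<rho> l * D a b l = (\<integral>l'. D a b l * indicator {l} l' \<partial>\<rho>)"
      by (simp add: pmf.rep_eq)
    also have "\<dots> \<le> (\<integral>l'. D a b l' \<partial>\<rho>)"
    proof (rule integral_mono)
      show "integrable (measure_pmf \<rho>) (D a b)"
        unfolding par[OF ab(1,2), abs_def] using i\<rho> ab mix by simp
      show "D a b l * indicator {l} l' \<le> D a b l'" for l'
        by (auto simp: indicator_def D_def)
    qed (auto simp: measure_pmf.emeasure_eq_measure)
    also have "\<dots> = 2 * \<Phi> a + 2 * \<Phi> b - 4 * \<Phi> (mix_pmf a b)"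
      unfolding par[OF ab(1,2)] \<Phi>_def using i\<rho> ab mix by simp
    also have "\<dots> \<le> 4 * \<eta>" using d[OF mix[OF ab(1,2)]] ab(3,4) by linarith
    finally show ?thesis using \<rho>[of l] by (simp add: field_simps)
  qed
  \<comment> \<open>The gap to the infimum is the rate that \<open>AE_summable_of_squares\<close>
    asks of squared norms.\<close>
  have "\<exists>a\<in>\<A>. \<Phi> a < d + (1/8)^k" for k
  proof -
    have "return_pmf 0 \<in> \<A>" by (simp add: \<A>_def)
    then have "\<Phi> ` \<A> \<noteq> {}" by blast
    then show ?thesis using cInf_lessD[of "\<Phi> ` \<A>" "d + (1/8)^k"] by (auto simp: d_def)
  qed
  then obtain a where a: "\<And>k. a k \<in> \<A>" "\<And>k. \<Phi> (a k) < d + (1/8)^k" by metis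
  have a': "\<Phi> (a (Suc k)) < d + (1/8)^k" for k
  proof -
    have "(1/8 :: real)^Suc k \<le> (1/8)^k" by (rule power_decreasing) auto
    with a(2)[of "Suc k"] show ?thesis by linarith
  qed
  have "AE x in \<mu>. summable (\<lambda>k. orbit_avg (a (Suc k)) x l - orbit_avg (a k) x l)" for l
  proof (rule AE_summable_of_squares)
    show "(\<integral>x. (orbit_avg (a (Suc k)) x l - orbit_avg (a k) x l)\<^sup>2 \<partial>\<mu>) \<le> 4 / pmf \<rho> l * (1/8)^k" for k
      using close[OF a(1,1) a' a(2)] by (simp add: D_def)
  qed (use mA'[OF a(1)] iD[OF a(1,1)] in auto)
  then have "AE x in \<mu>. convergent (\<lambda>k. orbit_avg (a k) x l)" for l
    by (rule AE_mp) (auto intro: convergent_of_summable_diff)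
  then have conv: "AE x in \<mu>. \<forall>l. convergent (\<lambda>k. orbit_avg (a k) x l)"
    by (simp add: AE_all_countable)
  have "AE x in \<mu>. summable (\<lambda>k. orbit_avg (a k) (shift h x) l - orbit_avg (a k) x l)" for h l
  proof -
    define b where "b k = map_pmf (\<lambda>g. g + h) (a k)" for k
    have b: "b k \<in> \<A>" for k using a(1)[of k] by (simp add: b_def \<A>_def)
    \<comment> \<open>Invariance of \<mu> gives translated weights the same norm, so they are
      near-minimisers as well and \<open>close\<close> compares them with
      \<open>a k\<close>.\<close>
    have "sq (b k) l = sq (a k) l" for k l
    proof -
      have "sq (b k) l = (\<integral>x. (orbit_avg (a k) (shift h x) l)\<^sup>2 \<partial>\<mu>)"
        by (simp add: sq_def b_def orbit_avg_translate)
      also have "\<dots> = (\<integral>x. (orbit_avg (a k) x l)\<^sup>2 \<partial>distr \<mu> borel (shift h))"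
        using mA[OF a(1)] shift_measurable_prob[OF \<mu>P]
        by (intro integral_distr[symmetric]) auto
      also have "\<dots> = sq (a k) l" by (simp add: inv sq_def)
      finally show ?thesis .
    qed
    then have b2: "\<Phi> (b k) < d + (1/8)^k" for k using a(2)[of k] by (simp add: \<Phi>_def)
    have "AE x in \<mu>. summable (\<lambda>k. orbit_avg (b k) x l - orbit_avg (a k) x l)"
    proof (rule AE_summable_of_squares)
      show "(\<integral>x. (orbit_avg (b k) x l - orbit_avg (a k) x l)\<^sup>2 \<partial>\<mu>) \<le> 4 / pmf \<rho> l * (1/8)^k" for k
        using close[OF b a(1) b2 a(2)] by (simp add: D_def)
    qed (use mA'[OF a(1)] mA'[OF b] iD[OF b a(1)] in auto)
    then show ?thesis by (simp add: b_def orbit_avg_translate)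
  qed
  then have "AE x in \<mu>. (\<lambda>k. orbit_avg (a k) (shift h x) l - orbit_avg (a k) x l) \<longlonglongrightarrow> 0" for h l
    by (rule AE_mp) (auto intro: summable_LIMSEQ_zero)
  then have "AE x in \<mu>. \<forall>h l. (\<lambda>k. orbit_avg (a k) (shift h x) l - orbit_avg (a k) x l) \<longlonglongrightarrow> 0"
    by (simp add: AE_all_countable)
  with conv a(1) that show ?thesis by (auto simp: \<A>_def)
qed

section \<open>Generic points and the limit kernel of a sequence of orbit averages\<close>

locale orbit_averages =
  fixes a :: "nat \<Rightarrow> 'g::{countable, group_add} pmf"
    and ty :: "'a::finite itself"
  assumes finite_a: "\<And>k. finite (set_pmf (a k))"
begin

definition orbit_lim :: "('g \<Rightarrow> 'a discrete) \<Rightarrow> ('g \<times> 'a discrete) list \<Rightarrow> real" where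
  "orbit_lim x l = lim (\<lambda>k. orbit_avg (a k) x l)"

text \<open>Demanding one limit along the whole orbit makes the set exactly shift invariant and
  \<open>orbit_lim\<close> constant on orbits, rather than up to null sets that depend on a
  measure.\<close>

definition generic :: "('g \<Rightarrow> 'a discrete) set" where
  "generic = {x. \<forall>h l. (\<lambda>k. orbit_avg (a k) (shift h x) l) \<longlonglongrightarrow> orbit_lim x l}"

text \<open>Cylinder values determine a measure, so \<open>SOME\<close> has a single candidate. The
  point mass off \<open>generic\<close> is a default that keeps all values probability
  measures.\<close>

definition \<kappa> :: "('g \<Rightarrow> 'a discrete) \<Rightarrow> ('g \<Rightarrow> 'a discrete) measure" where
  "\<kappa> x = (if x \<in> generic then (SOME \<nu>. \<nu> \<in> prob_measures \<and> cylval \<nu> = orbit_lim x)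
     else return borel (\<lambda>_. undefined))"

lemma orbit_lim_measurable [measurable]: "(\<lambda>x. orbit_lim x l) \<in> borel_measurable borel"
  unfolding orbit_lim_def using orbit_avg_measurable[OF finite_a] by measurable

lemma generic_tendsto: "x \<in> generic \<Longrightarrow> (\<lambda>k. orbit_avg (a k) x l) \<longlonglongrightarrow> orbit_lim x l"
proof -
  assume "x \<in> generic"
  then have "(\<lambda>k. orbit_avg (a k) (shift 0 x) l) \<longlonglongrightarrow> orbit_lim x l" unfolding generic_def by blast
  then show ?thesis by simp
qed

lemma orbit_lim_shift: "x \<in> generic \<Longrightarrow> orbit_lim (shift g x) = orbit_lim x"
  unfolding generic_def orbit_lim_def[of "shift g x"] by (auto intro!: ext limI)

lemma generic_shift: "shift g x \<in> generic \<longleftrightarrow> x \<in> generic"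
proof -
  have 1: "shift g x \<in> generic" if "x \<in> generic" for g x
    using that orbit_lim_shift[OF that, of g] by (simp add: generic_def shift_shift)
  show ?thesis using 1[of x g] 1[of "shift g x" "- g"] by (auto simp: shift_shift)
qed

lemma generic_invariant: "shift g -` {x \<in> generic. P (orbit_lim x)} = {x \<in> generic. P (orbit_lim x)}"
  by (auto simp: generic_shift orbit_lim_shift)

lemma generic_borel [measurable]: "generic \<in> sets borel"
proof -
  \<comment> \<open>Convergence is written with countable quantifiers, which makes the set visibly
    Borel.\<close>
  have "(\<lambda>k. s k) \<longlonglongrightarrow> L \<longleftrightarrow> (\<forall>m::nat. \<exists>N::nat. \<forall>k::nat. N \<le> k \<longrightarrow> \<bar>s k - L\<bar> < 1 / Suc m)" for s L
  proof
    assume *: "s \<longlonglongrightarrow> (L :: real)"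
    show "\<forall>m::nat. \<exists>N::nat. \<forall>k::nat. N \<le> k \<longrightarrow> \<bar>s k - L\<bar> < 1 / Suc m"
    proof
      fix m :: nat
      have "0 < 1 / real (Suc m)" by simp
      from LIMSEQ_D[OF * this] show "\<exists>N::nat. \<forall>k::nat. N \<le> k \<longrightarrow> \<bar>s k - L\<bar> < 1 / Suc m" by simp
    qed
  next
    assume *: "\<forall>m::nat. \<exists>N::nat. \<forall>k::nat. N \<le> k \<longrightarrow> \<bar>s k - L\<bar> < 1 / Suc m"
    show "s \<longlonglongrightarrow> L"
    proof (rule LIMSEQ_I)
      fix r :: real assume "0 < r"
      then obtain m where m: "inverse (real (Suc m)) < r" using reals_Archimedean by blast
      from * obtain N where "\<forall>k\<ge>N. \<bar>s k - L\<bar> < 1 / Suc m" by blast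
      then show "\<exists>N. \<forall>k\<ge>N. norm (s k - L) < r"
        using m by (intro exI[of _ N]) (force simp: inverse_eq_divide)
    qed
  qed
  note tends = this
  have [measurable]: "(\<lambda>x. orbit_avg (a k) (shift h x) l) \<in> borel_measurable borel" for k h
      and l :: "('g \<times> 'a discrete) list"
    by (rule measurable_compose[OF shift_measurable orbit_avg_measurable[OF finite_a]])
  have "{x \<in> space borel. \<forall>h l. \<forall>m::nat. \<exists>N::nat. \<forall>k::nat. N \<le> k \<longrightarrow> \<bar>orbit_avg (a k) (shift h x) l - orbit_lim x l\<bar> < 1 / Suc m} \<in> sets borel"
    by measurable
  then show ?thesis unfolding generic_def tends by simp
qed

text \<open>At a generic point the orbit laws converge on all cylinders, and
  \<open>cylval_limit\<close> provides a measure with the limiting values.\<close>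

lemma \<kappa>_prob: "\<kappa> x \<in> prob_measures"
  and cylval_\<kappa>: "x \<in> generic \<Longrightarrow> cylval (\<kappa> x) = orbit_lim x"
proof -
  have g: "\<kappa> x \<in> prob_measures \<and> cylval (\<kappa> x) = orbit_lim x" if "x \<in> generic"
  proof -
    have "(\<lambda>k. cylval (orbit_law (a k) x) l) \<longlonglongrightarrow> orbit_lim x l" for l
      using generic_tendsto[OF that] by (simp add: cylval_orbit_law)
    from cylval_limit[OF orbit_law_prob_measures this]
    have "\<exists>\<nu>. \<nu> \<in> prob_measures \<and> cylval \<nu> = orbit_lim x" by (auto simp: fun_eq_iff)
    from someI_ex[OF this] that show ?thesis by (simp add: \<kappa>_def)
  qed
  then show "x \<in> generic \<Longrightarrow> cylval (\<kappa> x) = orbit_lim x" by blast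
  show "\<kappa> x \<in> prob_measures"
    using g by (cases "x \<in> generic") (auto simp: \<kappa>_def prob_measures_def intro!: prob_space_return)
qed

lemma cylval_\<kappa>_measurable [measurable]: "(\<lambda>x. cylval (\<kappa> x) l) \<in> borel_measurable borel"
proof -
  have "(\<lambda>x. cylval (\<kappa> x) l)
      = (\<lambda>x. if x \<in> generic then orbit_lim x l else cylval (return borel (\<lambda>_. undefined)) l)"
    by (auto simp: fun_eq_iff cylval_\<kappa>) (simp add: \<kappa>_def)
  then show ?thesis by simp
qed

lemma \<kappa>_measurable [measurable]: "\<kappa> \<in> borel \<rightarrow>\<^sub>M prob_algebra borel"
  by (rule measurable_prob_algebra_cylI) (auto simp: \<kappa>_prob)

lemma \<kappa>_measurable' [measurable]: "\<kappa> \<in> borel \<rightarrow>\<^sub>M subprob_algebra borel"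
  by (rule measurable_prob_algebraD[OF \<kappa>_measurable])

lemma \<kappa>_weak_measurable: "\<kappa> \<in> borel \<rightarrow>\<^sub>M weak_borel prob_measures"
  by (rule measurable_weak_borelI) (auto simp: \<kappa>_prob)

section \<open>Disintegration of an invariant measure along the limit kernel\<close>

context
  fixes \<nu> :: "('g \<Rightarrow> 'a discrete) measure"
  assumes inv: "\<nu> \<in> inv_measures UNIV" and gen: "AE x in \<nu>. x \<in> generic"
begin

lemma nu_prob: "\<nu> \<in> prob_measures" and distr_nu: "distr \<nu> borel (shift g) = \<nu>"
  using inv by (auto simp: inv_measures_def)

lemma sets_nu [measurable_cong]: "sets \<nu> = sets borel" and space_nu: "space \<nu> = UNIV"
  using prob_measuresD[OF nu_prob] by auto

lemma prob_nu: "prob_space \<nu>"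
  using prob_measuresD[OF nu_prob] by auto

lemma integral_shift:
  fixes \<phi> :: "_ \<Rightarrow> real"
  assumes "\<phi> \<in> borel_measurable borel"
  shows "(\<integral>x. \<phi> (shift g x) \<partial>\<nu>) = (\<integral>x. \<phi> x \<partial>\<nu>)"
  using integral_distr[OF shift_measurable_prob[OF nu_prob, of g] assms] by (simp add: distr_nu)

text \<open>The kernel acts as a conditional expectation given invariant functions. For each finite
  average the identity is exact, because \<phi> and \<nu> are invariant and the weights sum to one;
  dominated convergence passes to the limit.\<close>

lemma integral_\<kappa>_cyl:
  fixes \<phi> :: "_ \<Rightarrow> real"
  assumes \<phi> [measurable]: "\<phi> \<in> borel_measurable borel" and B: "\<And>x. \<bar>\<phi> x\<bar> \<le> B"
    and \<phi>inv: "\<And>g x. \<phi> (shift g x) = \<phi> x"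
  shows "(\<integral>x. \<phi> x * cylval (\<kappa> x) l \<partial>\<nu>) = (\<integral>x. \<phi> x * indicator (cyl l) x \<partial>\<nu>)"
proof -
  interpret prob_space \<nu> by (rule prob_nu)
  have "(\<integral>x. \<phi> x * orbit_avg (a k) x l \<partial>\<nu>) = (\<integral>x. \<phi> x * indicator (cyl l) x \<partial>\<nu>)" for k
  proof -
    let ?S = "set_pmf (a k)"
    have m: "(\<lambda>x. \<phi> x * indicator (cyl l) (shift g x)) \<in> borel_measurable \<nu>" for g by measurable
    have i: "integrable \<nu> (\<lambda>x. \<phi> x * indicator (cyl l) (shift g x))" for g
      using B m by (intro integrable_const_bound[where B = B])
        (auto simp: indicator_def intro: order_trans[OF abs_ge_zero])
    have "(\<integral>x. \<phi> x * orbit_avg (a k) x l \<partial>\<nu>)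
        = (\<integral>x. (\<Sum>g\<in>?S. pmf (a k) g * (\<phi> x * indicator (cyl l) (shift g x))) \<partial>\<nu>)"
      unfolding orbit_avg_eq_sum[OF finite_a order_refl] sum_distrib_left
      by (intro Bochner_Integration.integral_cong sum.cong refl) simp
    also have "\<dots> = (\<Sum>g\<in>?S. pmf (a k) g * (\<integral>x. \<phi> x * indicator (cyl l) (shift g x) \<partial>\<nu>))"
      using i by (subst Bochner_Integration.integral_sum) auto
    also have "\<dots> = (\<Sum>g\<in>?S. pmf (a k) g * (\<integral>x. \<phi> x * indicator (cyl l) x \<partial>\<nu>))"
    proof (intro sum.cong refl arg_cong2[where f = "(*)"])
      fix g
      have "(\<integral>x. \<phi> (shift g x) * indicator (cyl l) (shift g x) \<partial>\<nu>) = (\<integral>x. \<phi> x * indicator (cyl l) x \<partial>\<nu>)"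
        by (rule integral_shift[of "\<lambda>x. \<phi> x * indicator (cyl l) x"]) measurable
      then show "(\<integral>x. \<phi> x * indicator (cyl l) (shift g x) \<partial>\<nu>) = (\<integral>x. \<phi> x * indicator (cyl l) x \<partial>\<nu>)"
        by (simp add: \<phi>inv)
    qed
    also have "\<dots> = (\<integral>x. \<phi> x * indicator (cyl l) x \<partial>\<nu>)"
      using sum_pmf_eq_1[OF finite_a order_refl] by (simp add: sum_distrib_right[symmetric])
    finally show ?thesis .
  qed
  moreover have "(\<lambda>k. \<integral>x. \<phi> x * orbit_avg (a k) x l \<partial>\<nu>) \<longlonglongrightarrow> (\<integral>x. \<phi> x * cylval (\<kappa> x) l \<partial>\<nu>)"
  proof (rule integral_dominated_convergence[where w = "\<lambda>_. B"])
    show "AE x in \<nu>. (\<lambda>k. \<phi> x * orbit_avg (a k) x l) \<longlonglongrightarrow> \<phi> x * cylval (\<kappa> x) l"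
      using gen
    proof eventually_elim
      case (elim x)
      then show ?case using generic_tendsto by (auto simp: cylval_\<kappa> intro!: tendsto_intros)
    qed
    show "AE x in \<nu>. norm (\<phi> x * orbit_avg (a k) x l) \<le> B" for k
    proof (rule AE_I2)
      fix x
      have "\<bar>\<phi> x\<bar> * \<bar>orbit_avg (a k) x l\<bar> \<le> B * 1"
        using B[of x] orbit_avg_bounds[of "a k" x l] by (intro mult_mono) auto
      then show "norm (\<phi> x * orbit_avg (a k) x l) \<le> B" by (simp add: abs_mult)
    qed
    show "(\<lambda>x. \<phi> x * orbit_avg (a k) x l) \<in> borel_measurable \<nu>" for k
      using orbit_avg_measurable[OF finite_a] by measurable
  qed (auto, measurable)
  ultimately show ?thesis by (simp add: LIMSEQ_const_iff)
qed

lemma indicator_invariant: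
  assumes "\<And>g. shift g -` E = E"
  shows "indicator E (shift g x) = indicator E x"
  using assms[of g] by (auto simp: indicator_def)

text \<open>Restriction to an invariant set commutes with the disintegration, as the indicator of
  the set is an admissible test function in \<open>integral_\<kappa>_cyl\<close>.\<close>

lemma bind_\<kappa>_density:
  assumes E [measurable]: "E \<in> sets borel" and Einv: "\<And>g. shift g -` E = E"
  shows "density \<nu> (indicator E) = density \<nu> (indicator E) \<bind> \<kappa>"
proof (rule measure_eqI_cyl)
  interpret prob_space \<nu> by (rule prob_nu)
  let ?M = "density \<nu> (indicator E)"
  have sp: "space ?M \<noteq> {}" by (simp add: space_nu)
  have k: "\<kappa> \<in> ?M \<rightarrow>\<^sub>M subprob_algebra borel" by measurable
  show "sets ?M = sets borel" by (simp add: sets_nu)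
  show "sets (?M \<bind> \<kappa>) = sets borel" using k sp by (rule sets_bind_measurable)
  show "finite_measure ?M"
    by (rule finite_measureI) (simp add: emeasure_density space_nu emeasure_eq_measure sets_nu)
  fix l
  have i1: "integrable \<nu> (\<lambda>x. indicator E x * indicator (cyl l) x :: real)"
    by (intro integrable_const_bound[where B = 1]) (auto simp: indicator_def)
  have i2: "integrable \<nu> (\<lambda>x. indicator E x * cylval (\<kappa> x) l)"
    using cylval_bounds[OF \<kappa>_prob] by (intro integrable_const_bound[where B = 1]) (auto simp: indicator_def)
  have "emeasure (?M \<bind> \<kappa>) (cyl l) = (\<integral>\<^sup>+x. emeasure (\<kappa> x) (cyl l) \<partial>?M)"
    by (rule emeasure_bind[OF sp k]) simp
  also have "\<dots> = (\<integral>\<^sup>+x. indicator E x * emeasure (\<kappa> x) (cyl l) \<partial>\<nu>)"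
    by (rule nn_integral_density) measurable
  also have "\<dots> = (\<integral>\<^sup>+x. ennreal (indicator E x * cylval (\<kappa> x) l) \<partial>\<nu>)"
  proof (rule nn_integral_cong)
    fix x
    interpret \<kappa>: prob_space "\<kappa> x" using \<kappa>_prob prob_measuresD by blast
    show "indicator E x * emeasure (\<kappa> x) (cyl l) = ennreal (indicator E x * cylval (\<kappa> x) l)"
      by (simp add: \<kappa>.emeasure_eq_measure cylval_def indicator_def)
  qed
  also have "\<dots> = ennreal (\<integral>x. indicator E x * cylval (\<kappa> x) l \<partial>\<nu>)"
    using cylval_bounds[OF \<kappa>_prob] by (intro nn_integral_eq_integral i2) (auto intro!: mult_nonneg_nonneg)
  also have "(\<integral>x. indicator E x * cylval (\<kappa> x) l \<partial>\<nu>) = (\<integral>x. indicator E x * indicator (cyl l) x \<partial>\<nu>)"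
    by (intro integral_\<kappa>_cyl[where B = 1] indicator_invariant[OF Einv]) (auto simp: indicator_def)
  also have "ennreal \<dots> = (\<integral>\<^sup>+x. ennreal (indicator E x * indicator (cyl l) x) \<partial>\<nu>)"
    by (intro nn_integral_eq_integral[symmetric] i1) auto
  also have "\<dots> = (\<integral>\<^sup>+x. indicator E x * indicator (cyl l) x \<partial>\<nu>)"
    by (intro nn_integral_cong) (auto simp: indicator_def)
  also have "\<dots> = emeasure ?M (cyl l)" by (rule emeasure_density[symmetric]) measurable
  finally show "emeasure ?M (cyl l) = emeasure (?M \<bind> \<kappa>) (cyl l)" by simp
qed

lemma nu_eq_bind: "\<nu> = \<nu> \<bind> \<kappa>"
proof -
  have "(indicator UNIV :: _ \<Rightarrow> ennreal) = (\<lambda>_. 1)" by auto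
  then have "density \<nu> (indicator UNIV) = \<nu>" by (simp add: density_1)
  with bind_\<kappa>_density[of UNIV] show ?thesis by simp
qed

text \<open>The restriction of \<nu> to \<open>E\<close> lives on \<open>E\<close> and is the
  mixture of \<open>\<kappa> x\<close> over \<open>x\<close> in \<open>E\<close>, so almost all of
  these components live on \<open>E\<close>.\<close>

lemma AE_\<kappa>_invariant_set:
  assumes E [measurable]: "E \<in> sets borel" and Einv: "\<And>g. shift g -` E = E"
  shows "AE x in \<nu>. x \<in> E \<longrightarrow> (AE y in \<kappa> x. y \<in> E)"
proof -
  let ?M = "density \<nu> (indicator E)"
  have k: "\<kappa> \<in> ?M \<rightarrow>\<^sub>M subprob_algebra borel" by measurable
  have "AE x in ?M. x \<in> E" by (subst AE_density) (auto simp: indicator_def)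
  then have "AE x in ?M \<bind> \<kappa>. x \<in> E" unfolding bind_\<kappa>_density[OF E Einv, symmetric] .
  then have "AE x in ?M. AE y in \<kappa> x. y \<in> E"
    by (subst (asm) AE_bind[OF k]) measurable
  then have "AE x in \<nu>. 0 < (indicator E x :: ennreal) \<longrightarrow> (AE y in \<kappa> x. y \<in> E)"
    by (subst (asm) AE_density) auto
  then show ?thesis by (rule AE_mp) (auto simp: indicator_def)
qed

lemma AE_\<kappa>_full:
  assumes E [measurable]: "E \<in> sets borel" and "AE x in \<nu>. x \<in> E"
  shows "AE x in \<nu>. AE y in \<kappa> x. y \<in> E"
proof -
  have k: "\<kappa> \<in> \<nu> \<rightarrow>\<^sub>M subprob_algebra borel" by measurable
  have "AE x in \<nu> \<bind> \<kappa>. x \<in> E" unfolding nu_eq_bind[symmetric] by (rule assms(2))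
  then show ?thesis by (subst (asm) AE_bind[OF k]) measurable
qed

text \<open>The difference \<psi> of the limits at a cylinder and its translate is itself an
  invariant function. Testing it against both cylinders shows that its square has integral
  zero.\<close>

lemma AE_\<kappa>_invariant: "AE x in \<nu>. \<kappa> x \<in> inv_measures UNIV"
proof -
  interpret prob_space \<nu> by (rule prob_nu)
  have "AE x in \<nu>. cylval (\<kappa> x) (map (\<lambda>(i, a). (i + g, a)) l) = cylval (\<kappa> x) l" for g l
  proof -
    define l' where "l' = map (\<lambda>(i, a). (i + g, a)) l"
    define \<psi> where "\<psi> x = (if x \<in> generic then orbit_lim x l' - orbit_lim x l else 0)" for x
    have m [measurable]: "\<psi> \<in> borel_measurable borel" unfolding \<psi>_def by measurable
    have \<psi>inv: "\<psi> (shift h x) = \<psi> x" for h x by (simp add: \<psi>_def generic_shift orbit_lim_shift)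
    have b: "\<bar>\<psi> x\<bar> \<le> 1" for x
      using cylval_bounds[OF \<kappa>_prob, of x l] cylval_bounds[OF \<kappa>_prob, of x l']
      by (auto simp: \<psi>_def cylval_\<kappa>)
    have i: "integrable \<nu> (\<lambda>x. \<psi> x * cylval (\<kappa> x) w)" for w
    proof (rule integrable_const_bound[where B = 1])
      show "AE x in \<nu>. norm (\<psi> x * cylval (\<kappa> x) w) \<le> 1"
        using b cylval_bounds[OF \<kappa>_prob, of _ w] by (intro AE_I2) (auto simp: abs_mult intro!: mult_le_one)
    qed measurable
    have "(\<integral>x. \<psi> x * indicator (cyl l') x \<partial>\<nu>) = (\<integral>x. \<psi> (shift g x) * indicator (cyl l) (shift g x) \<partial>\<nu>)"
      by (intro Bochner_Integration.integral_cong refl)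
        (auto simp: \<psi>inv l'_def shift_vimage_cyl[symmetric] indicator_def)
    also have "\<dots> = (\<integral>x. \<psi> x * indicator (cyl l) x \<partial>\<nu>)"
      by (rule integral_shift[of "\<lambda>x. \<psi> x * indicator (cyl l) x"]) measurable
    finally have "(\<integral>x. \<psi> x * cylval (\<kappa> x) l' \<partial>\<nu>) = (\<integral>x. \<psi> x * cylval (\<kappa> x) l \<partial>\<nu>)"
      by (simp add: integral_\<kappa>_cyl[OF m b \<psi>inv])
    then have "(\<integral>x. \<psi> x * cylval (\<kappa> x) l' - \<psi> x * cylval (\<kappa> x) l \<partial>\<nu>) = 0"
      using i by simp
    moreover have "(\<integral>x. \<psi> x * cylval (\<kappa> x) l' - \<psi> x * cylval (\<kappa> x) l \<partial>\<nu>) = (\<integral>x. (\<psi> x)\<^sup>2 \<partial>\<nu>)"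
      using gen by (intro integral_cong_AE; (measurable)?)
        (auto simp: \<psi>_def cylval_\<kappa> power2_eq_square algebra_simps)
    moreover have "integrable \<nu> (\<lambda>x. (\<psi> x)\<^sup>2)"
      using b by (intro integrable_const_bound[where B = 1]) (auto simp: abs_square_le_1)
    ultimately have "AE x in \<nu>. (\<psi> x)\<^sup>2 = 0"
      by (subst integral_nonneg_eq_0_iff_AE[symmetric]) auto
    with gen show ?thesis
      by eventually_elim (simp add: \<psi>_def cylval_\<kappa> l'_def)
  qed
  then have "AE x in \<nu>. \<forall>g l. cylval (\<kappa> x) (map (\<lambda>(i, a). (i + g, a)) l) = cylval (\<kappa> x) l"
    by (simp add: AE_all_countable)
  then show ?thesis
  proof eventually_elim
    case (elim x)
    interpret \<kappa>: prob_space "\<kappa> x" using \<kappa>_prob prob_measuresD by blast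
    show ?case
      using elim \<kappa>_prob[of x] \<kappa>.prob_space prob_measuresD(3)[OF \<kappa>_prob[of x]]
      by (simp add: inv_measures_def invariant_iff_cylval)
  qed
qed

text \<open>If the kernel is constantly \<nu>, an invariant set is independent of all cylinders,
  hence of all Borel sets and so of itself: its measure equals its own square.\<close>

lemma invariant_set_zero_one:
  assumes E [measurable]: "E \<in> sets borel" and Einv: "\<And>g. shift g -` E = E"
    and const: "AE x in \<nu>. cylval (\<kappa> x) = cylval \<nu>"
  shows "measure \<nu> E = 0 \<or> measure \<nu> E = 1"
proof -
  interpret prob_space \<nu> by (rule prob_nu)
  have c: "measure \<nu> (E \<inter> cyl l) = measure \<nu> E * measure \<nu> (cyl l)" for l
  proof -
    have "(\<integral>x. indicator E x * cylval (\<kappa> x) l \<partial>\<nu>) = (\<integral>x. indicator E x * indicator (cyl l) x \<partial>\<nu>)"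
      by (intro integral_\<kappa>_cyl[where B = 1] indicator_invariant[OF Einv]) (auto simp: indicator_def)
    also have "\<dots> = measure \<nu> (E \<inter> cyl l)"
      by (simp add: indicator_inter_arith[symmetric] space_nu)
    also have "(\<integral>x. indicator E x * cylval (\<kappa> x) l \<partial>\<nu>) = (\<integral>x. indicator E x * cylval \<nu> l \<partial>\<nu>)"
      using const by (intro integral_cong_AE; (measurable)?) (auto elim: eventually_mono)
    also have "\<dots> = measure \<nu> E * cylval \<nu> l"
      by (simp add: space_nu)
    finally show ?thesis by (simp add: cylval_def)
  qed
  have "density \<nu> (indicator E) = scale_measure (ennreal (measure \<nu> E)) \<nu>"
  proof (rule measure_eqI_cyl)
    show "finite_measure (density \<nu> (indicator E))"
      by (rule finite_measureI) (simp add: emeasure_density space_nu emeasure_eq_measure sets_nu)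
    fix l
    have "emeasure (density \<nu> (indicator E)) (cyl l) = emeasure \<nu> (E \<inter> cyl l)"
      by (simp add: emeasure_density sets_nu indicator_inter_arith[symmetric])
    then show "emeasure (density \<nu> (indicator E)) (cyl l) = emeasure (scale_measure (ennreal (measure \<nu> E)) \<nu>) (cyl l)"
      using c[of l] by (simp add: emeasure_eq_measure ennreal_mult)
  qed (auto simp: sets_nu)
  then have "emeasure (density \<nu> (indicator E)) E = emeasure (scale_measure (ennreal (measure \<nu> E)) \<nu>) E" by simp
  then have "ennreal (measure \<nu> E) = ennreal (measure \<nu> E * measure \<nu> E)"
    by (simp add: emeasure_density sets_nu emeasure_eq_measure ennreal_mult indicator_inter_arith[symmetric])
  then have "measure \<nu> E = measure \<nu> E * measure \<nu> E" by (simp add: ennreal_inj)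
  then show ?thesis by (simp add: mult_cancel_left1)
qed

text \<open>On the invariant sets where the limit lies above or below \<open>c\<close>, ergodicity
  leaves measure 0 or 1. The kernel averages to \<open>c\<close> times that measure, and a quantity
  of constant sign with mean zero vanishes.\<close>

lemma ergodic_kernel_const:
  assumes "ergodic \<nu>"
  shows "AE x in \<nu>. \<kappa> x = \<nu>"
proof -
  interpret prob_space \<nu> by (rule prob_nu)
  have "AE x in \<nu>. cylval (\<kappa> x) l = cylval \<nu> l" for l
  proof -
    define c where "c = cylval \<nu> l"
    \<comment> \<open>The factor \<open>s\<close> is 1 or -1, so that one argument covers both sides
      of \<open>c\<close>.\<close>
    have key: "AE x in \<nu>. x \<in> E \<longrightarrow> cylval (\<kappa> x) l = c"
      if E [measurable]: "E \<in> sets borel" and Einv: "\<And>g. shift g -` E = E"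
        and s: "\<bar>s\<bar> \<le> 1" "\<And>x. x \<in> E \<Longrightarrow> 0 \<le> s * (cylval (\<kappa> x) l - c)" "s \<noteq> 0" for E and s :: real
    proof -
      have E01: "measure \<nu> E = 0 \<or> measure \<nu> E = 1"
        using assms E Einv unfolding ergodic_def by blast
      have prod: "measure \<nu> (E \<inter> cyl l) = measure \<nu> E * c"
      proof (cases "measure \<nu> E = 0")
        case True
        then have "measure \<nu> (E \<inter> cyl l) \<le> 0"
          using finite_measure_mono[of "E \<inter> cyl l" E] by (simp add: sets_nu)
        with True show ?thesis by (simp add: measure_le_0_iff)
      next
        case False
        then have "AE x in \<nu>. x \<in> E" using E01 by (simp add: prob_eq_1 sets_nu)
        then have "measure \<nu> (E \<inter> cyl l) = measure \<nu> (cyl l)"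
          by (intro finite_measure_eq_AE) (auto simp: sets_nu)
        then show ?thesis using False E01 by (simp add: c_def cylval_def)
      qed
      have i: "integrable \<nu> (\<lambda>x. indicator E x * cylval (\<kappa> x) l)"
        using cylval_bounds[OF \<kappa>_prob] by (intro integrable_const_bound[where B = 1]) (auto simp: indicator_def)
      have i': "integrable \<nu> (\<lambda>x. indicator E x * c)"
        by (intro integrable_mult_left integrable_real_indicator) (auto simp: emeasure_eq_measure sets_nu)
      have "(\<integral>x. indicator E x * cylval (\<kappa> x) l \<partial>\<nu>) = (\<integral>x. indicator E x * indicator (cyl l) x \<partial>\<nu>)"
        by (intro integral_\<kappa>_cyl[where B = 1] indicator_invariant[OF Einv]) (auto simp: indicator_def)
      also have "\<dots> = measure \<nu> E * c"
        by (simp add: indicator_inter_arith[symmetric] space_nu prod)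
      also have "\<dots> = (\<integral>x. indicator E x * c \<partial>\<nu>)" by (simp add: space_nu)
      finally have "(\<integral>x. s * (indicator E x * cylval (\<kappa> x) l - indicator E x * c) \<partial>\<nu>) = 0"
        using i i' by simp
      then have "AE x in \<nu>. s * (indicator E x * cylval (\<kappa> x) l - indicator E x * c) = 0"
        using i i' s(2)
        by (subst (asm) integral_nonneg_eq_0_iff_AE) (auto simp: indicator_def)
      then show ?thesis
        by eventually_elim (use s(3) in auto)
    qed
    have 1: "AE x in \<nu>. x \<in> {x \<in> generic. c \<le> orbit_lim x l} \<longrightarrow> cylval (\<kappa> x) l = c"
      by (rule key[of _ 1]) (auto simp: cylval_\<kappa> generic_shift orbit_lim_shift)
    have 2: "AE x in \<nu>. x \<in> {x \<in> generic. orbit_lim x l \<le> c} \<longrightarrow> cylval (\<kappa> x) l = c"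
      by (rule key[of _ "-1"]) (auto simp: cylval_\<kappa> generic_shift orbit_lim_shift)
    from 1 2 gen show ?thesis by eventually_elim (auto simp: c_def)
  qed
  then have "AE x in \<nu>. \<forall>l. cylval (\<kappa> x) l = cylval \<nu> l" by (simp add: AE_all_countable)
  then show ?thesis by eventually_elim (auto intro: prob_measures_eqI \<kappa>_prob nu_prob)
qed

end

text \<open>For almost every x, almost every y under \<open>\<kappa> x\<close> lies on the same side
  as x of all rational thresholds for all cylinder limits; countably many invariant sets express
  this. Hence \<open>\<kappa> y = \<kappa> x\<close> for such y, and the zero-one law applies with
  \<open>\<kappa> x\<close> in place of \<nu>.\<close>

lemma AE_\<kappa>_ergodic:
  assumes inv: "\<nu> \<in> inv_measures UNIV" and gen: "AE x in \<nu>. x \<in> generic"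
  shows "AE x in \<nu>. ergodic (\<kappa> x)"
proof -
  note ctx = inv gen
  have "AE x in \<nu>. \<forall>l. \<forall>q::rat. x \<in> {x \<in> generic. of_rat q < orbit_lim x l} \<longrightarrow>
      (AE y in \<kappa> x. y \<in> {y \<in> generic. of_rat q < orbit_lim y l})"
    unfolding AE_all_countable
    by (intro allI AE_\<kappa>_invariant_set[OF ctx] generic_invariant[of _ "\<lambda>L. _ < L _"]) measurable
  moreover have "AE x in \<nu>. \<forall>l. \<forall>q::rat. x \<in> {x \<in> generic. \<not> of_rat q < orbit_lim x l} \<longrightarrow>
      (AE y in \<kappa> x. y \<in> {y \<in> generic. \<not> of_rat q < orbit_lim y l})"
    unfolding AE_all_countable
    by (intro allI AE_\<kappa>_invariant_set[OF ctx] generic_invariant[of _ "\<lambda>L. \<not> _ < L _"]) measurable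
  moreover have "AE x in \<nu>. AE y in \<kappa> x. y \<in> generic"
    by (rule AE_\<kappa>_full[OF ctx generic_borel gen])
  ultimately show ?thesis using AE_\<kappa>_invariant[OF ctx] gen
  proof eventually_elim
    case (elim x)
    have "AE y in \<kappa> x. \<forall>l. \<forall>q::rat. of_rat q < orbit_lim y l \<longleftrightarrow> of_rat q < orbit_lim x l"
      unfolding AE_all_countable
    proof (intro allI)
      fix l and q :: rat
      show "AE y in \<kappa> x. of_rat q < orbit_lim y l \<longleftrightarrow> of_rat q < orbit_lim x l"
      proof (cases "of_rat q < orbit_lim x l")
        case True
        with elim(1,5) have "AE y in \<kappa> x. y \<in> {y \<in> generic. of_rat q < orbit_lim y l}" by blast
        then show ?thesis by eventually_elim (use True in auto)
      next
        case False
        with elim(2,5) have "AE y in \<kappa> x. y \<in> {y \<in> generic. \<not> of_rat q < orbit_lim y l}" by blast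
        then show ?thesis by eventually_elim (use False in auto)
      qed
    qed
    then have "AE y in \<kappa> x. cylval (\<kappa> y) = cylval (\<kappa> x)"
      using elim(3)
    proof eventually_elim
      case (elim y)
      have "orbit_lim y l = orbit_lim x l" for l
      proof (rule ccontr)
        assume "orbit_lim y l \<noteq> orbit_lim x l"
        then consider "orbit_lim y l < orbit_lim x l" | "orbit_lim x l < orbit_lim y l" by linarith
        then show False
        proof cases
          case 1
          from of_rat_dense[OF this] elim(1) show False by (metis less_asym)
        next
          case 2
          from of_rat_dense[OF this] elim(1) show False by (metis less_asym)
        qed
      qed
      then show ?case using \<open>x \<in> generic\<close> elim(2) by (simp add: cylval_\<kappa> fun_eq_iff)
    qed
    then show ?case
      unfolding ergodic_def
      using elim(4) invariant_set_zero_one[OF elim(4) elim(3)] by blast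
  qed
qed

end

text \<open>The equality case of monotonicity when \<open>h\<close> may take the value minus
  infinity. The bound by \<open>g\<close> makes the positive part integrable and the real lower
  bound on the integral does so for the negative part; then \<open>h\<close> is finite almost
  everywhere and \<open>g - h\<close> has mean zero.\<close>

lemma AE_eq_of_ereal_integral_ge:
  fixes h :: "'x \<Rightarrow> ereal" and g :: "'x \<Rightarrow> real"
  assumes h [measurable]: "h \<in> borel_measurable P" and g: "integrable P g"
    and le: "AE x in P. h x \<le> ereal (g x)"
    and ge: "ereal (\<integral>x. g x \<partial>P) \<le> ereal_integral P h"
  shows "AE x in P. h x = ereal (g x)"
proof -
  define A where "A = (\<integral>\<^sup>+x. e2ennreal (h x) \<partial>P)"
  define B where "B = (\<integral>\<^sup>+x. e2ennreal (- h x) \<partial>P)"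
  have AB: "ereal_integral P h = enn2ereal A - enn2ereal B" by (simp add: ereal_integral_def A_def B_def)
  have "A \<le> (\<integral>\<^sup>+x. ennreal (g x) \<partial>P)"
    unfolding A_def
  proof (rule nn_integral_mono_AE)
    show "AE x in P. e2ennreal (h x) \<le> ennreal (g x)"
      using le by eventually_elim (metis e2ennreal_ereal e2ennreal_mono)
  qed
  then have A: "A \<noteq> \<infinity>" using g unfolding real_integrable_def by (auto simp: top_unique)
  have B: "B \<noteq> \<infinity>"
  proof
    assume "B = \<infinity>"
    then have "ereal_integral P h = -\<infinity>" using A unfolding AB by (cases A) (auto simp: enn2ereal_top)
    with ge show False by simp
  qed
  have "AE x in P. e2ennreal (- h x) \<noteq> \<infinity>"
    using B unfolding B_def by (intro nn_integral_PInf_AE) auto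
  with le have fin: "AE x in P. h x = ereal (real_of_ereal (h x))"
  proof eventually_elim
    case (elim x)
    then show ?case by (cases "h x") auto
  qed
  define r where "r x = real_of_ereal (h x)" for x
  have rm [measurable]: "r \<in> borel_measurable P" unfolding r_def by measurable
  have rA: "(\<integral>\<^sup>+x. ennreal (r x) \<partial>P) = A"
    unfolding A_def
  proof (rule nn_integral_cong_AE)
    show "AE x in P. ennreal (r x) = e2ennreal (h x)"
      using fin by eventually_elim (metis e2ennreal_ereal r_def)
  qed
  have rB: "(\<integral>\<^sup>+x. ennreal (- r x) \<partial>P) = B"
    unfolding B_def
  proof (rule nn_integral_cong_AE)
    show "AE x in P. ennreal (- r x) = e2ennreal (- h x)"
      using fin by eventually_elim (metis e2ennreal_ereal r_def uminus_ereal.simps(1))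
  qed
  have ri: "integrable P r" using A B rA rB unfolding real_integrable_def by simp
  have "ereal_integral P h = ereal (\<integral>x. r x \<partial>P)"
    unfolding AB real_lebesgue_integral_def[OF ri] rA rB
    using A B by (cases A; cases B) auto
  with ge have "(\<integral>x. g x \<partial>P) \<le> (\<integral>x. r x \<partial>P)" by simp
  then have le0: "(\<integral>x. g x - r x \<partial>P) \<le> 0" using g ri by simp
  have nn: "AE x in P. 0 \<le> g x - r x"
    using le fin
  proof eventually_elim
    case (elim x)
    then have "ereal (r x) \<le> ereal (g x)" by (simp add: r_def)
    then show ?case by simp
  qed
  have "(\<integral>x. g x - r x \<partial>P) = 0"
    using le0 integral_nonneg_AE[OF nn] by linarith
  then have "AE x in P. g x - r x = 0"
    using g ri nn by (subst (asm) integral_nonneg_eq_0_iff_AE) auto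
  with fin show ?thesis
    by eventually_elim (auto simp: r_def)
qed

lemma closed_sets_weak_borel:
  fixes E :: "('i::countable \<Rightarrow> 'b::finite discrete) measure set"
  assumes "closed C" "E = prob_measures \<inter> cylval -` C"
  shows "E \<inter> K \<in> sets (weak_borel K)"
proof -
  have "cylval -` C \<inter> space (weak_borel K) \<in> sets (weak_borel K)"
    using assms(1) by (intro measurable_sets[OF cylval_measurable]) auto
  also have "cylval -` C \<inter> space (weak_borel K) = E \<inter> K" using assms(2) by auto
  finally show ?thesis .
qed

lemma open_sets_weak_borel:
  fixes \<O> :: "('i::countable \<Rightarrow> 'b::finite discrete) measure set"
  assumes "openin weak_star \<O>"
  shows "\<O> \<inter> K \<in> sets (weak_borel K)"
  unfolding sets_weak_borel_eq using assms
  by (intro sigma_sets.Basic) (auto simp: openin_subtopology)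

section \<open>Equilibrium measures as maximisers of the tilted entropy\<close>

context lwlim_maps
begin

text \<open>Members of \<open>K\<close> give full mass to \<open>X\<close>, where the extension
  agrees with \<open>u\<close>.\<close>

lemma pressure_eq_tilted:
  assumes "\<forall>x\<in>X. f x = u x" and \<nu>: "\<nu> \<in> K"
  shows "pressure M V \<sigma> X u \<nu> = tilted f \<nu>"
proof -
  have \<nu>P: "\<nu> \<in> prob_measures" and X1: "measure \<nu> X = 1" using \<nu> by (auto simp: inv_measures_def)
  interpret prob_space \<nu> using \<nu>P prob_measuresD by blast
  have s [measurable_cong]: "sets \<nu> = sets borel" using \<nu>P prob_measuresD by blast
  have X [measurable]: "X \<in> sets borel" using closed_X by simp
  have [measurable]: "f \<in> borel_measurable borel" by (rule borel_measurable_continuous_onI[OF cont_f])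
  have "AE x in \<nu>. x \<in> X" using X1 by (subst prob_eq_1[symmetric]) (auto simp: s)
  then have "(\<integral>x. indicator X x * f x \<partial>\<nu>) = (\<integral>x. f x \<partial>\<nu>)"
    by (intro integral_cong_AE; (measurable)?) (auto elim: eventually_mono)
  moreover have "(LINT x:X|\<nu>. u x) = (\<integral>x. indicator X x * f x \<partial>\<nu>)"
    unfolding set_lebesgue_integral_def using assms(1)
    by (intro Bochner_Integration.integral_cong refl) (auto simp: indicator_def)
  ultimately show ?thesis
    unfolding pressure_def by (simp add: tilted_eq_entropy[OF cont_f \<nu>P])
qed

lemma equilibrium_iff:
  assumes "\<forall>x\<in>X. f x = u x"
  shows "equilibrium M V \<sigma> X u \<nu> \<longleftrightarrow> \<nu> \<in> maximizers"
proof
  assume e: "equilibrium M V \<sigma> X u \<nu>"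
  then have \<nu>: "\<nu> \<in> K" by (simp add: equilibrium_def)
  have "tilted f \<nu>' \<le> tilted f \<nu>" if "\<nu>' \<in> K" for \<nu>'
    using e that pressure_eq_tilted[OF assms] \<nu> by (auto simp: equilibrium_def)
  then have "max_pressure \<le> tilted f \<nu>" unfolding max_pressure_def by (intro SUP_least)
  with tilted_le_max[OF \<nu>] \<nu> show "\<nu> \<in> maximizers" by (auto simp: maximizers_def)
next
  assume "\<nu> \<in> maximizers"
  then show "equilibrium M V \<sigma> X u \<nu>"
    using tilted_le_max pressure_eq_tilted[OF assms] by (auto simp: equilibrium_def maximizers_def)
qed

lemma sofic_entropy_measurable:
  "(sofic_entropy M V \<sigma> :: ('g \<Rightarrow> 'a discrete) measure \<Rightarrow> ereal) \<in> borel_measurable (weak_borel J)"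
  unfolding borel_measurable_ereal_iff_Iio
proof
  fix t
  have "{\<nu> \<in> prob_measures. tilted (\<lambda>x :: 'g \<Rightarrow> 'a discrete. 0) \<nu> < t} \<inter> J \<in> sets (weak_borel J)"
    by (rule open_sets_weak_borel[OF openin_tilted_less])
  also have "{\<nu> \<in> prob_measures. tilted (\<lambda>x :: 'g \<Rightarrow> 'a discrete. 0) \<nu> < t} \<inter> J
      = sofic_entropy M V \<sigma> -` {..<t} \<inter> space (weak_borel J)"
    by (auto simp: sofic_entropy_eq_tilted)
  finally show "(sofic_entropy M V \<sigma> :: ('g \<Rightarrow> 'a discrete) measure \<Rightarrow> ereal) -` {..<t} \<inter> space (weak_borel J)
    \<in> sets (weak_borel J)" .
qed

lemma inv_measures_mono: "K \<subseteq> inv_measures UNIV"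
  using prob_space.prob_space[OF prob_measuresD(1)] prob_measuresD(3) by (fastforce simp: inv_measures_def)

end

section \<open>Ergodic components of equilibrium measures under goodness\<close>

locale ergodic_lwlim = lwlim_maps M V \<sigma> X f \<mu> + orbit_averages a "TYPE('a)"
  for M :: "nat \<Rightarrow> 'w measure" and V :: "nat \<Rightarrow> 'v set"
    and \<sigma> :: "nat \<Rightarrow> 'w \<Rightarrow> 'g::{countable, group_add} \<Rightarrow> 'v \<Rightarrow> 'v"
    and X :: "('g \<Rightarrow> 'a::finite discrete) set" and f \<mu> and a :: "nat \<Rightarrow> 'g pmf" +
  assumes good: "good_approximation TYPE('a discrete) M V \<sigma>"
begin

abbreviation "J \<equiv> inv_measures UNIV :: ('g \<Rightarrow> 'a discrete) measure set"

lemma J_prob: "J \<subseteq> prob_measures"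
  by (auto simp: inv_measures_def)

lemma kernel_vimage_closed:
  assumes "closed C" "E = prob_measures \<inter> cylval -` C"
  shows "{x. \<kappa> x \<in> E} \<in> sets borel"
proof -
  have "E \<inter> prob_measures \<in> sets (weak_borel prob_measures)" by (rule closed_sets_weak_borel[OF assms])
  from measurable_sets[OF \<kappa>_weak_measurable this]
  show ?thesis by (simp add: vimage_def \<kappa>_prob)
qed

lemma kernel_maximizers_borel: "{x. \<kappa> x \<in> maximizers} \<in> sets borel"
proof -
  obtain C where "closed C" "maximizers = prob_measures \<inter> cylval -` C" by (rule closed_maximizers)
  then show ?thesis by (rule kernel_vimage_closed)
qed

text \<open>The law of the kernel under \<nu> is an ergodic decomposition of \<nu>, so goodness
  bounds the entropy of \<nu> by the mean entropy of the components. No component exceeds the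
  maximal pressure, while the mean attains it, so almost all components attain it.\<close>

lemma maximizers_decompose:
  assumes \<nu>: "\<nu> \<in> maximizers" and gen: "AE x in \<nu>. x \<in> generic"
  shows "AE x in \<nu>. \<kappa> x \<in> maximizers"
proof -
  have \<nu>K: "\<nu> \<in> K" and \<nu>m: "tilted f \<nu> = max_pressure" using \<nu> by (auto simp: maximizers_def)
  have \<nu>J: "\<nu> \<in> J" using \<nu>K inv_measures_mono by blast
  have \<nu>P: "\<nu> \<in> prob_measures" using \<nu>J J_prob by blast
  interpret prob_space \<nu> using \<nu>P prob_measuresD by blast
  have s [measurable_cong]: "sets \<nu> = sets borel" using \<nu>P prob_measuresD by blast
  have sp: "space \<nu> = UNIV" using \<nu>P prob_measuresD by blast
  note ctx = \<nu>J gen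
  obtain CJ where CJ: "closed CJ" "J = prob_measures \<inter> cylval -` CJ"
    using closed_inv_measures[OF closed_UNIV] .
  obtain CK where CK: "closed CK" "K = prob_measures \<inter> cylval -` CK" using closed_inv_measures[OF closed_X] .
  obtain CE where CE: "closed CE" "maximizers = prob_measures \<inter> cylval -` CE" using closed_maximizers .
  have JB [measurable]: "{x. \<kappa> x \<in> J} \<in> sets borel" by (rule kernel_vimage_closed[OF CJ])
  \<comment> \<open>The kernel is invariant only almost surely; replacing its other values by \<nu>
    gives a map into \<open>J\<close>, as a law on \<open>J\<close> requires.\<close>
  define k where "k x = (if \<kappa> x \<in> J then \<kappa> x else \<nu>)" for x
  have kJ: "k x \<in> J" for x using \<nu>J by (simp add: k_def)
  have k\<kappa>: "AE x in \<nu>. k x = \<kappa> x"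
    using AE_\<kappa>_invariant[OF ctx] by eventually_elim (simp add: k_def)
  have km [measurable]: "k \<in> \<nu> \<rightarrow>\<^sub>M weak_borel J"
  proof (rule measurable_weak_borelI[OF kJ J_prob])
    fix l
    have "(\<lambda>x. cylval (\<kappa> x) l) \<in> borel_measurable \<nu>"
      by (subst measurable_cong_sets[OF s refl]) (rule cylval_\<kappa>_measurable)
    then have "(\<lambda>x. if x \<in> {x. \<kappa> x \<in> J} then cylval (\<kappa> x) l else cylval \<nu> l) \<in> borel_measurable \<nu>"
      using JB by (intro measurable_If_set) (auto simp: s sp)
    also have "(\<lambda>x. if x \<in> {x. \<kappa> x \<in> J} then cylval (\<kappa> x) l else cylval \<nu> l) = (\<lambda>x. cylval (k x) l)"
      by (auto simp: k_def)
    finally show "(\<lambda>x. cylval (k x) l) \<in> borel_measurable \<nu>" .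
  qed
  define \<theta> where "\<theta> = distr \<nu> (weak_borel J) k"
  have \<theta>: "\<theta> \<in> prob_on J" by (auto simp: \<theta>_def prob_on_iff intro!: prob_space_distr km)
  have s\<theta> [measurable_cong]: "sets \<theta> = sets (weak_borel J)" by (simp add: \<theta>_def)
  have bary: "has_barycenter \<theta> \<nu>"
    unfolding has_barycenter_iff(1)[OF \<theta> \<nu>P]
  proof
    fix l
    have "(\<integral>\<nu>'. cylval \<nu>' l \<partial>\<theta>) = (\<integral>x. cylval (k x) l \<partial>\<nu>)"
      unfolding \<theta>_def by (rule integral_distr) auto
    also have "\<dots> = (\<integral>x. 1 * cylval (\<kappa> x) l \<partial>\<nu>)"
    proof (rule integral_cong_AE)
      show "(\<lambda>x. cylval (k x) l) \<in> borel_measurable \<nu>"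
        by (rule measurable_compose[OF km cylval_measurable_at])
      show "AE x in \<nu>. cylval (k x) l = 1 * cylval (\<kappa> x) l" using k\<kappa> by eventually_elim simp
      show "(\<lambda>x. 1 * cylval (\<kappa> x) l) \<in> borel_measurable \<nu>"
        by (subst measurable_cong_sets[OF s refl]) (simp add: cylval_\<kappa>_measurable)
    qed
    also have "\<dots> = (\<integral>x. 1 * indicator (cyl l) x \<partial>\<nu>)"
      by (rule integral_\<kappa>_cyl[OF ctx, where B = 1]) auto
    also have "\<dots> = cylval \<nu> l" by (simp add: cylval_def sp)
    finally show "cylval \<nu> l = (\<integral>\<nu>'. cylval \<nu>' l \<partial>\<theta>)" ..
  qed
  have "ergodic_decomposition \<theta> \<nu>"
    unfolding ergodic_decomposition_def
  proof (intro conjI ballI impI \<theta> bary)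
    fix S assume S: "S \<in> sets \<theta>" "\<forall>\<nu>'\<in>S. \<not> ergodic \<nu>'"
    have S': "S \<in> sets (weak_borel J)" using S(1) s\<theta> by simp
    have "AE x in \<nu>. x \<notin> k -` S \<inter> space \<nu>"
      using AE_\<kappa>_ergodic[OF ctx] k\<kappa> by eventually_elim (use S(2) in auto)
    from emeasure_eq_0_AE[OF this] have "emeasure \<nu> (k -` S \<inter> space \<nu>) = 0"
      by (simp add: sp vimage_def)
    then show "emeasure \<theta> S = 0"
      unfolding \<theta>_def by (simp add: emeasure_distr[OF km S'])
  qed
  then have ent: "sofic_entropy M V \<sigma> \<nu> \<le> ereal_integral \<theta> (sofic_entropy M V \<sigma>)"
    using good \<nu>J unfolding good_approximation_def by blast
  obtain m where m: "max_pressure = ereal m"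
    using max_pressure_less_PInf max_pressure_greater_MInf by (cases max_pressure) auto
  \<comment> \<open>The largest entropy that the maximal pressure permits at a given energy; it is
    integrable and has the entropy of \<nu> as its mean.\<close>
  define g where "g \<nu>' = m + (\<integral>x. f x \<partial>\<nu>')" for \<nu>'
  obtain B where B: "\<And>x. \<bar>f x\<bar> \<le> B" using continuous_bounded[OF cont_f] by blast
  have fm: "f \<in> borel_measurable borel" by (rule borel_measurable_continuous_onI[OF cont_f])
  have im [measurable]: "(\<lambda>\<nu>'. \<integral>x. f x \<partial>\<nu>') \<in> borel_measurable \<theta>"
  proof -
    have "(\<lambda>\<nu>'. \<nu>') \<in> \<theta> \<rightarrow>\<^sub>M subprob_algebra borel"
      using measurable_prob_algebraD[OF id_measurable_prob_algebra[of J]] measurable_cong_sets[OF s\<theta> refl] by blast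
    from measurable_compose[OF this integral_measurable_subprob_algebra[OF fm]] show ?thesis .
  qed
  interpret \<theta>: prob_space \<theta> using \<theta> prob_onD by blast
  have ii: "integrable \<theta> (\<lambda>\<nu>'. \<integral>x. f x \<partial>\<nu>')"
  proof (rule \<theta>.integrable_const_bound[where B = B])
    show "AE \<nu>' in \<theta>. norm (\<integral>x. f x \<partial>\<nu>') \<le> B"
    proof (rule AE_I2)
      fix \<nu>' assume "\<nu>' \<in> space \<theta>"
      then have \<nu>': "\<nu>' \<in> prob_measures" by (simp add: prob_onD(3)[OF \<theta>])
      interpret \<nu>': prob_space \<nu>' using \<nu>' prob_measuresD by blast
      have "\<bar>\<integral>x. f x \<partial>\<nu>'\<bar> \<le> (\<integral>x. B \<partial>\<nu>')"
        using B continuous_integrable[OF cont_f \<nu>'] by (intro order_trans[OF integral_abs_bound] integral_mono) auto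
      then show "norm (\<integral>x. f x \<partial>\<nu>') \<le> B" by (simp add: \<nu>'.prob_space)
    qed
  qed measurable
  have gint: "integrable \<theta> g" unfolding g_def using ii by simp
  have "(\<integral>\<nu>'. g \<nu>' \<partial>\<theta>) = m + (\<integral>x. f x \<partial>\<nu>)"
  proof -
    have "(\<integral>x. f x \<partial>\<nu>) = (\<integral>\<nu>'. (\<integral>x. f x \<partial>\<nu>') \<partial>\<theta>)"
      using bary cont_f unfolding has_barycenter_def by blast
    then show ?thesis unfolding g_def using ii by (simp add: \<theta>.prob_space)
  qed
  moreover have "sofic_entropy M V \<sigma> \<nu> = ereal (m + (\<integral>x. f x \<partial>\<nu>))"
    using \<nu>m tilted_eq_entropy[OF cont_f \<nu>P] m by (cases "sofic_entropy M V \<sigma> \<nu>") auto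
  ultimately have ge: "ereal (\<integral>\<nu>'. g \<nu>' \<partial>\<theta>) \<le> ereal_integral \<theta> (sofic_entropy M V \<sigma>)" using ent by simp
  have XB: "X \<in> sets borel" using closed_X by simp
  have "measure \<nu> X = 1" using \<nu>K by (simp add: inv_measures_def)
  then have "AE x in \<nu>. x \<in> X" using XB by (subst prob_eq_1[symmetric]) (auto simp: s)
  from AE_\<kappa>_full[OF ctx XB this] k\<kappa> have kK: "AE x in \<nu>. k x \<in> K"
  proof eventually_elim
    case (elim x)
    interpret \<kappa>: prob_space "\<kappa> x" using \<kappa>_prob prob_measuresD by blast
    have "measure (\<kappa> x) X = 1"
      using elim(1) XB prob_measuresD(2)[OF \<kappa>_prob[of x]] by (subst \<kappa>.prob_eq_1) auto
    then show ?case using kJ[of x] elim(2) by (simp add: inv_measures_def)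
  qed
  have setK: "{\<nu>' \<in> space (weak_borel J). \<nu>' \<in> K} \<in> sets (weak_borel J)"
  proof -
    have "{\<nu>' \<in> space (weak_borel J). \<nu>' \<in> K} = K \<inter> J" using K_prob by auto
    then show ?thesis using closed_sets_weak_borel[OF CK, of J] by (simp only:)
  qed
  have setE: "{\<nu>' \<in> space (weak_borel J). \<nu>' \<in> maximizers} \<in> sets (weak_borel J)"
  proof -
    have "{\<nu>' \<in> space (weak_borel J). \<nu>' \<in> maximizers} = maximizers \<inter> J" using J_prob by auto
    then show ?thesis using closed_sets_weak_borel[OF CE, of J] by (simp only:)
  qed
  have AEK: "AE \<nu>' in \<theta>. \<nu>' \<in> K"
    unfolding \<theta>_def using kK by (subst AE_distr_iff[OF km setK])
  have sub: "\<nu>' \<in> K \<Longrightarrow> sofic_entropy M V \<sigma> \<nu>' \<le> ereal (g \<nu>')" for \<nu>'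
    using tilted_le_max[of \<nu>'] tilted_eq_entropy[OF cont_f, of \<nu>'] K_prob
    by (auto simp: g_def m ereal_minus_le subset_iff)
  have "AE \<nu>' in \<theta>. sofic_entropy M V \<sigma> \<nu>' = ereal (g \<nu>')"
  proof (rule AE_eq_of_ereal_integral_ge[OF _ gint _ ge])
    show "sofic_entropy M V \<sigma> \<in> borel_measurable \<theta>"
      using sofic_entropy_measurable[of J] measurable_cong_sets[OF s\<theta> refl] by blast
    show "AE \<nu>' in \<theta>. sofic_entropy M V \<sigma> \<nu>' \<le> ereal (g \<nu>')"
      using AEK by eventually_elim (rule sub)
  qed
  with AEK have "AE \<nu>' in \<theta>. \<nu>' \<in> maximizers"
  proof eventually_elim
    case (elim \<nu>')
    then have "tilted f \<nu>' = ereal m"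
      using tilted_eq_entropy[OF cont_f, of \<nu>'] K_prob by (auto simp: g_def subset_iff)
    with elim(1) show ?case by (simp add: maximizers_def m)
  qed
  then have "AE x in \<nu>. k x \<in> maximizers"
    unfolding \<theta>_def by (subst (asm) AE_distr_iff[OF km setE])
  with k\<kappa> show ?thesis by eventually_elim simp
qed

text \<open>Both \<pp> and \<theta> decompose \<mu>, and points compare them: the set
  \<open>T\<close> of generic points with maximising kernel is full for almost all measures under
  \<pp>, hence for \<mu>, hence for almost all under \<theta>. An ergodic measure with full mass on
  \<open>T\<close> is the kernel at almost all of its points, so it is a maximiser.\<close>

lemma AE_ergodic_decomposition_maximizers:
  assumes gen: "AE x in \<mu>. x \<in> generic" and \<theta>: "ergodic_decomposition \<theta> \<mu>"
  shows "AE \<nu> in \<theta>. \<nu> \<in> maximizers"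
proof -
  have \<theta>J: "\<theta> \<in> prob_on J" and \<theta>b: "has_barycenter \<theta> \<mu>"
    and \<theta>e: "\<And>S. S \<in> sets \<theta> \<Longrightarrow> \<forall>\<nu>\<in>S. \<not> ergodic \<nu> \<Longrightarrow> emeasure \<theta> S = 0"
    using \<theta> by (auto simp: ergodic_decomposition_def)
  obtain \<pp> where \<pp>: "\<pp> \<in> prob_on K" "has_barycenter \<pp> \<mu>" "AE \<nu> in \<pp>. \<nu> \<in> maximizers"
    by (rule maximizers_barycenter)
  have ae_bind: "(AE x in \<mu>. x \<in> S) \<longleftrightarrow> (AE \<nu> in \<qq>. AE x in \<nu>. x \<in> S)"
    if q: "\<qq> \<in> prob_on L" "has_barycenter \<qq> \<mu>" and S [measurable]: "S \<in> sets borel" for \<qq> L S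
  proof -
    have id: "(\<lambda>\<nu>. \<nu>) \<in> \<qq> \<rightarrow>\<^sub>M subprob_algebra borel"
      using measurable_prob_algebraD[OF id_measurable_prob_algebra[of L]]
        measurable_cong_sets[OF prob_onD(2)[OF q(1)] refl] by blast
    have "(AE x in \<qq> \<bind> (\<lambda>\<nu>. \<nu>). x \<in> S) \<longleftrightarrow> (AE \<nu> in \<qq>. AE x in \<nu>. x \<in> S)"
      by (rule AE_bind[OF id]) measurable
    then show ?thesis by (subst has_barycenter_iff(2)[OF q(1) mu_prob q(2)])
  qed
  define T where "T = {x. \<kappa> x \<in> maximizers} \<inter> generic"
  have T: "T \<in> sets borel" unfolding T_def using kernel_maximizers_borel by auto
  have "AE \<nu> in \<pp>. AE x in \<nu>. x \<in> generic"
    using gen ae_bind[OF \<pp>(1,2) generic_borel] by blast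
  with \<pp>(3) have "AE \<nu> in \<pp>. AE x in \<nu>. x \<in> T"
  proof eventually_elim
    case (elim \<nu>)
    from maximizers_decompose[OF this] elim(2) show ?case
      by eventually_elim (simp add: T_def)
  qed
  then have "AE x in \<mu>. x \<in> T" using ae_bind[OF \<pp>(1,2) T] by blast
  then have \<theta>T: "AE \<nu> in \<theta>. AE x in \<nu>. x \<in> T" using ae_bind[OF \<theta>J \<theta>b T] by blast
  \<comment> \<open>The exceptional set is described by Borel conditions rather than by ergodicity,
    so it is measurable, and containing no ergodic measure it is \<theta>-null.\<close>
  define N where "N = {\<nu> \<in> J. measure \<nu> T = 1} - maximizers"
  obtain CE where CE: "closed CE" "maximizers = prob_measures \<inter> cylval -` CE" using closed_maximizers .
  have "N \<in> sets (weak_borel J)"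
  proof -
    have "(\<lambda>\<nu>. measure \<nu> T) \<in> borel_measurable (weak_borel J)"
      by (rule measurable_compose[OF id_measurable_prob_algebra measurable_measure_prob_algebra[OF T]])
    from borel_measurable_vimage[OF this, of 1]
    have "(\<lambda>\<nu>. measure \<nu> T) -` {1} \<inter> space (weak_borel J) - maximizers \<inter> J \<in> sets (weak_borel J)"
      using closed_sets_weak_borel[OF CE, of J] by blast
    also have "(\<lambda>\<nu>. measure \<nu> T) -` {1} \<inter> space (weak_borel J) - maximizers \<inter> J = N"
      using J_prob by (auto simp: N_def)
    finally show ?thesis .
  qed
  then have Ns: "N \<in> sets \<theta>" using prob_onD(2)[OF \<theta>J] by simp
  have "\<not> ergodic \<nu>" if \<nu>: "\<nu> \<in> N" for \<nu>
  proof
    assume e: "ergodic \<nu>"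
    have J: "\<nu> \<in> J" "measure \<nu> T = 1" "\<nu> \<notin> maximizers" using \<nu> by (auto simp: N_def)
    then have \<nu>P: "\<nu> \<in> prob_measures" using J_prob by blast
    interpret prob_space \<nu> using \<nu>P prob_measuresD by blast
    have AT: "AE x in \<nu>. x \<in> T"
      using J(2) T prob_measuresD(2)[OF \<nu>P] by (subst prob_eq_1[symmetric]) auto
    then have "AE x in \<nu>. x \<in> generic" by eventually_elim (simp add: T_def)
    from ergodic_kernel_const[OF J(1) this e] AT have "AE x in \<nu>. False"
    proof eventually_elim
      case (elim x)
      then show ?case using J(3) by (simp add: T_def)
    qed
    then show False by simp
  qed
  with \<theta>e[OF Ns] have "N \<in> null_sets \<theta>" using Ns by (auto simp: null_sets_def)
  then have "AE \<nu> in \<theta>. \<nu> \<notin> N" by (rule AE_not_in)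
  moreover have "AE \<nu> in \<theta>. \<nu> \<in> space \<theta>" by simp
  ultimately show ?thesis using \<theta>T
  proof eventually_elim
    case (elim \<nu>)
    then have \<nu>: "\<nu> \<in> J" "\<nu> \<in> prob_measures" by (auto simp: prob_onD(3)[OF \<theta>J])
    interpret prob_space \<nu> using \<nu>(2) prob_measuresD by blast
    have "measure \<nu> T = 1"
      using elim(3) T prob_measuresD(2)[OF \<nu>(2)] by (subst prob_eq_1) auto
    with elim(1) \<nu>(1) show ?case by (auto simp: N_def)
  qed
qed

end

text \<open>The local weak limit provides \<mu> only as a probability measure; invariance, on which
  the mean ergodic argument rests, is inherited from the mixture of invariant measures.\<close>

lemma (in lwlim_maps) mu_invariant: "\<mu> \<in> inv_measures UNIV"
proof -
  obtain \<pp> where \<pp>: "\<pp> \<in> prob_on K" "has_barycenter \<pp> \<mu>" by (rule maximizers_barycenter)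
  have c: "cylval \<mu> l = (\<integral>\<nu>. cylval \<nu> l \<partial>\<pp>)" for l
    using \<pp>(2) has_barycenter_iff(1)[OF \<pp>(1) mu_prob] by blast
  have "cylval \<mu> (map (\<lambda>(i, a). (i + g, a)) l) = cylval \<mu> l" for g l
    unfolding c
  proof (intro Bochner_Integration.integral_cong refl)
    fix \<nu> assume "\<nu> \<in> space \<pp>"
    then have "\<nu> \<in> prob_measures" "distr \<nu> borel (shift g) = \<nu>"
      by (auto simp: prob_onD(3)[OF \<pp>(1)] inv_measures_def)
    then show "cylval \<nu> (map (\<lambda>(i, a). (i + g, a)) l) = cylval \<nu> l"
      using invariant_iff_cylval by blast
  qed
  then show ?thesis
    using mu_prob prob_space.prob_space[OF prob_measuresD(1)[OF mu_prob]] prob_measuresD(3)[OF mu_prob]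
    by (simp add: inv_measures_def invariant_iff_cylval)
qed

text \<open>The averages are those of \<mu>: their convergence together with asymptotic shift
  invariance makes almost every point generic.\<close>

lemma (in lwlim_maps) good_ergodic_decomposition:
  assumes good: "good_approximation TYPE('a discrete) M V \<sigma>" and \<theta>: "ergodic_decomposition \<theta> \<mu>"
  shows "AE \<nu> in \<theta>. \<nu> \<in> maximizers"
proof -
  obtain a :: "nat \<Rightarrow> 'g pmf" where a: "\<And>k. finite (set_pmf (a k))"
    "AE x in \<mu>. \<forall>l. convergent (\<lambda>k. orbit_avg (a k) x l)"
    "AE x in \<mu>. \<forall>h l. (\<lambda>k. orbit_avg (a k) (shift h x) l - orbit_avg (a k) x l) \<longlonglongrightarrow> 0"
    using mean_ergodic_averages[OF mu_invariant] by blast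
  interpret ergodic_lwlim M V \<sigma> X f \<mu> a
    by unfold_locales (use a(1) good in auto)
  have "AE x in \<mu>. x \<in> generic"
    using a(2,3)
  proof eventually_elim
    case (elim x)
    have "(\<lambda>k. orbit_avg (a k) (shift h x) l) \<longlonglongrightarrow> orbit_lim x l" for h l
    proof -
      have "(\<lambda>k. orbit_avg (a k) x l) \<longlonglongrightarrow> orbit_lim x l"
        using elim(1) unfolding orbit_lim_def by (simp add: convergent_LIMSEQ_iff)
      from tendsto_add[OF elim(2)[rule_format, of h l] this] show ?thesis by simp
    qed
    then show ?case by (simp add: generic_def)
  qed
  then show ?thesis using \<theta> by (rule AE_ergodic_decomposition_maximizers)
qed

theorem theorem6p5:
  fixes X :: "('g::{countable, group_add} \<Rightarrow> 'a::finite discrete) set"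
    and u u_ext :: "('g \<Rightarrow> 'a discrete) \<Rightarrow> real"
    and M :: "nat \<Rightarrow> 'w measure"
    and V :: "nat \<Rightarrow> 'v set"
    and \<sigma> :: "nat \<Rightarrow> 'w \<Rightarrow> 'g \<Rightarrow> 'v \<Rightarrow> 'v"
    and \<mu> :: "('g \<Rightarrow> 'a discrete) measure"
  assumes "sofic_group TYPE('g)"
    and "subshift X"
    and "continuous_on X u"
    and "continuous_on UNIV u_ext"
    and "\<forall>x\<in>X. u_ext x = u x"
    and "random_sofic_approximation M V \<sigma>"
    and "lwlim M V \<sigma> X u_ext \<mu>"
  shows
    "(\<exists>\<pp> \<in> prob_on (inv_measures X).
        has_barycenter \<pp> \<mu> \<and> (AE \<nu> in \<pp>. equilibrium M V \<sigma> X u \<nu>)) \<and>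
     (\<exists>m. (\<exists>\<nu>. equilibrium M V \<sigma> X u \<nu>) \<and>
        (\<forall>\<nu>. equilibrium M V \<sigma> X u \<nu> \<longrightarrow> pressure M V \<sigma> X u \<nu> = m) \<and>
        ((\<lambda>\<U>. growth_rate V (\<lambda>n. \<integral>\<omega>. exp_gibbs_pressure (V n) (\<sigma> n \<omega>) u_ext \<U> \<partial>(M n)))
           \<longlongrightarrow> m) (open_nbhds (inv_measures X))) \<and>
     (good_approximation TYPE('a discrete) M V \<sigma> \<longrightarrow>
        (\<forall>\<theta>. ergodic_decomposition \<theta> \<mu> \<longrightarrow> (AE \<nu> in \<theta>. equilibrium M V \<sigma> X u \<nu>)))"
proof -
  interpret lwlim_maps M V \<sigma> X u_ext \<mu>
  proof (intro lwlim_maps.intro random_maps.intro lwlim_maps_axioms.intro)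
    note r = assms(6)[unfolded random_sofic_approximation_def]
    show "prob_space (M n)" for n by (rule r[THEN conjunct1, rule_format])
    show "finite (V n)" for n by (rule r[THEN conjunct2, THEN conjunct1, rule_format])
    show "(\<lambda>\<omega>. \<sigma> n \<omega> \<gamma> v) \<in> measurable (M n) (count_space (V n))" if "v \<in> V n" for n \<gamma> v
      by (rule r[THEN conjunct2, THEN conjunct2, THEN conjunct2, THEN conjunct1, rule_format, OF that])
    show "filterlim (\<lambda>n. card (V n)) at_top sequentially"
      by (rule r[THEN conjunct2, THEN conjunct2, THEN conjunct2, THEN conjunct2, THEN conjunct1])
    show "closed X" using assms(2) by (simp add: subshift_def)
  qed (fact assms)+
  have eq: "equilibrium M V \<sigma> X u \<nu> \<longleftrightarrow> \<nu> \<in> maximizers" for \<nu>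
    using assms(5) by (rule equilibrium_iff)
  have 1: "\<exists>\<pp>\<in>prob_on K. has_barycenter \<pp> \<mu> \<and> (AE \<nu> in \<pp>. equilibrium M V \<sigma> X u \<nu>)"
  proof -
    obtain \<pp> where "\<pp> \<in> prob_on K" "has_barycenter \<pp> \<mu>" "AE \<nu> in \<pp>. \<nu> \<in> maximizers"
      by (rule maximizers_barycenter)
    then show ?thesis unfolding eq by (intro bexI[of _ \<pp>] conjI)
  qed
  have 2: "\<exists>m. (\<exists>\<nu>. equilibrium M V \<sigma> X u \<nu>) \<and>
      (\<forall>\<nu>. equilibrium M V \<sigma> X u \<nu> \<longrightarrow> pressure M V \<sigma> X u \<nu> = m) \<and>
      ((\<lambda>\<U>. growth_rate V (\<lambda>n. \<integral>\<omega>. exp_gibbs_pressure (V n) (\<sigma> n \<omega>) u_ext \<U> \<partial>M n)) \<longlongrightarrow> m)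
        (open_nbhds K)"
  proof (rule exI[of _ max_pressure], intro conjI)
    show "\<exists>\<nu>. equilibrium M V \<sigma> X u \<nu>" unfolding eq using maximizers_nonempty by auto
    show "\<forall>\<nu>. equilibrium M V \<sigma> X u \<nu> \<longrightarrow> pressure M V \<sigma> X u \<nu> = max_pressure"
      unfolding eq using pressure_eq_tilted[OF assms(5)] by (auto simp: maximizers_def)
    show "((\<lambda>\<U>. growth_rate V (\<lambda>n. \<integral>\<omega>. exp_gibbs_pressure (V n) (\<sigma> n \<omega>) u_ext \<U> \<partial>M n))
        \<longlongrightarrow> max_pressure) (open_nbhds K)"
      using max_pressure_tendsto by (simp add: exp_gibbs_pressure_eq[OF finite_V] mean_sum_def[abs_def])
  qed
  have 3: "good_approximation TYPE('a discrete) M V \<sigma> \<longrightarrow>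
      (\<forall>\<theta>. ergodic_decomposition \<theta> \<mu> \<longrightarrow> (AE \<nu> in \<theta>. equilibrium M V \<sigma> X u \<nu>))"
    unfolding eq by (intro impI allI good_ergodic_decomposition)
  show ?thesis by (intro conjI 1 2 3)
qed

end
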